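(* Let $\phi\colon D\to\mathbb{D}$ be a holomorphic function with Clark measures $\mu_\alpha$, $\alpha\in\mathbb{T}$. For every $\alpha\in\mathbb{T}$, the absolutely continuous part of $\mu_\alpha$ with respect to $\beta$ has density (with respect to $\beta$) $$\mathrm{Re}\left(\frac{\alpha+\phi_1}{\alpha-\phi_1}\right)=\frac{1-|\phi_1|^2}{|\alpha-\phi_1|^2}.$$ In particular, $\phi$ is an inner function if and only if $\mu_\alpha$ is singular with respect to $\beta$ for some (or, equivalently, every) $\alpha\in\mathbb{T}$.
   Context: Setting. $D\subseteq\mathbb{C}^n$ is a bounded symmetric domain (a bounded connected open set such that for every $z\in D$ there is a holomorphic involution of $D$ having $z$ as an isolated fixed point) which is convex and circular ($\alpha z\in D$ for all $z\in D$ and $\alpha\in\mathbb{T}$). Here $\mathbb{D}$ is the open unit disc in $\mathbb{C}$ and $\mathbb{T}=\partial\mathbb{D}$. $\mathrm{b}D$ is the Silov boundary of $D$: the smallest closed subset of $\partial D$ such that $\sup_D|f|=\max_{\mathrm{b}D}|f|$ for every holomorphic $f$ on $D$ extending continuously to the closure $\overline{D}$. $K$ is the compact group of linear automorphisms of $D$; it acts transitively on $\mathrm{b}D$, and it is assumed that $K\subseteq U(n)$ and that $\mathrm{b}D$ is contained in the Euclidean unit sphere. $\beta$ is the unique $K$-invariant probability measure on $\mathrm{b}D$. Kernels. The Hardy space $H^2(D)$ is the space of holomorphic $f$ on $D$ with $\|f\|^2=\sup_{0\le\rho<1}\int_{\mathrm{b}D}|f(\rho\zeta)|^2\,\mathrm{d}\beta(\zeta)<\infty$;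 $\mathcal{C}$ is its reproducing kernel, which extends to a sesqui-holomorphic function on a neighbourhood of $D\times\overline{D}$. The Poisson–Szegő kernel is $\mathcal{P}(z,\zeta)=|\mathcal{C}(z,\zeta)|^2/\mathcal{C}(z,z)$ for $z\in D$, $\zeta\in\mathrm{b}D$, and $(\mathcal{P}\mu)(z)=\int_{\mathrm{b}D}\mathcal{P}(z,\zeta)\,\mathrm{d}\mu(\zeta)$ for a Radon measure $\mu$ on $\mathrm{b}D$. Clark measures. For $\alpha\in\mathbb{T}$, $\mu_\alpha$ is the unique positive Radon measure on $\mathrm{b}D$ such that $\mathcal{P}(\mu_\alpha)=\mathrm{Re}\left(\frac{\alpha+\phi}{\alpha-\phi}\right)=\frac{1-|\phi|^2}{|\alpha-\phi|^2}$ on $D$. Boundary values and inner functions. For a function $f$ on $D$, $f_1(\zeta)=\lim_{\rho\to1^-}f(\rho\zeta)$ for those $\zeta\in\mathrm{b}D$ where the limit exists. An inner function on $D$ is a bounded holomorphic function $\phi\colon D\to\mathbb{C}$ such that $\phi_1(\zeta)\in\mathbb{T}$ for $\beta$-almost every $\zeta\in\mathrm{b}D$. *)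

theory Defs
  imports "HOL-Analysis.Analysis"
begin

section \<open>Holomorphic functions of several variables\<close>

text \<open>On an open set: Frechet differentiability with complex-linear derivative.\<close>

definition mv_holomorphic_on :: "(complex ^ 'n \<Rightarrow> complex) \<Rightarrow> (complex ^ 'n) set \<Rightarrow> bool"
    (infixl \<open>mv'_holomorphic'_on\<close> 50) where
  "f mv_holomorphic_on S \<longleftrightarrow>
     (\<forall>z\<in>S. \<exists>L. (f has_derivative L) (at z) \<and> (\<forall>c v. L (c *s v) = c * L v))"

definition mv_holomorphic_map_on ::
    "(complex ^ 'n \<Rightarrow> complex ^ 'm) \<Rightarrow> (complex ^ 'n) set \<Rightarrow> bool" where
  "mv_holomorphic_map_on f S \<longleftrightarrow> (\<forall>i. (\<lambda>z. f z $ i) mv_holomorphic_on S)"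

text \<open>Holomorphic in the first, antiholomorphic in the second variable: the real-linear
  derivative \<open>L (u, v) = L (u, 0) + L (0, v)\<close> is complex-linear in \<open>u\<close> and conjugate-linear
  in \<open>v\<close>.\<close>

definition sesqui_holomorphic_on ::
    "(complex ^ 'n \<Rightarrow> complex ^ 'n \<Rightarrow> complex) \<Rightarrow> ((complex ^ 'n) \<times> (complex ^ 'n)) set \<Rightarrow> bool" where
  "sesqui_holomorphic_on F U \<longleftrightarrow>
     (\<forall>p\<in>U. \<exists>L. ((\<lambda>q. F (fst q) (snd q)) has_derivative L) (at p) \<and>
        (\<forall>c u v. L (c *s u, cnj c *s v) = c * L (u, v)))"


section \<open>The domain, its Silov boundary and its linear automorphisms\<close>

definition bounded_symmetric_domain :: "(complex ^ 'n) set \<Rightarrow> bool" where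
  "bounded_symmetric_domain D \<longleftrightarrow>
     D \<noteq> {} \<and> open D \<and> connected D \<and> bounded D \<and>
     (\<forall>z\<in>D. \<exists>s. mv_holomorphic_map_on s D \<and> s ` D \<subseteq> D \<and> (\<forall>w\<in>D. s (s w) = w) \<and>
        z isolated_in {w\<in>D. s w = w})"

definition circular :: "(complex ^ 'n) set \<Rightarrow> bool" where
  "circular D \<longleftrightarrow> (\<forall>\<alpha> z. cmod \<alpha> = 1 \<longrightarrow> z \<in> D \<longrightarrow> \<alpha> *s z \<in> D)"

definition norming_boundary :: "(complex ^ 'n) set \<Rightarrow> (complex ^ 'n) set \<Rightarrow> bool" where
  "norming_boundary D S \<longleftrightarrow> closed S \<and> S \<subseteq> frontier D \<and>
     (\<forall>f. f mv_holomorphic_on D \<longrightarrow> continuous_on (closure D) f \<longrightarrow>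
        (\<exists>x\<in>S. (\<forall>y\<in>S. cmod (f y) \<le> cmod (f x)) \<and> (SUP z\<in>D. cmod (f z)) = cmod (f x)))"

definition is_silov_boundary :: "(complex ^ 'n) set \<Rightarrow> (complex ^ 'n) set \<Rightarrow> bool" where
  "is_silov_boundary D B \<longleftrightarrow>
     norming_boundary D B \<and> (\<forall>S. norming_boundary D S \<longrightarrow> B \<subseteq> S)"

definition linear_automorphisms :: "(complex ^ 'n) set \<Rightarrow> (complex ^ 'n ^ 'n) set" where
  "linear_automorphisms D = {A. invertible A \<and> (*v) A ` D = D}"

definition unitary_matrices :: "(complex ^ 'n ^ 'n) set" where
  "unitary_matrices = {A. map_matrix cnj (transpose A) ** A = mat 1}"


section \<open>Measures on the Silov boundary\<close>

text \<open>Since the Silov boundary \<open>B\<close> is compact and metrizable, its positive Radon measures are the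
  finite Borel measures.\<close>

definition radon_measure_on :: "(complex ^ 'n) set \<Rightarrow> (complex ^ 'n) measure \<Rightarrow> bool" where
  "radon_measure_on B \<mu> \<longleftrightarrow> sets \<mu> = sets (restrict_space borel B) \<and> finite_measure \<mu>"

definition invariant_probability_on ::
    "(complex ^ 'n ^ 'n) set \<Rightarrow> (complex ^ 'n) set \<Rightarrow> (complex ^ 'n) measure \<Rightarrow> bool" where
  "invariant_probability_on K B \<beta> \<longleftrightarrow>
     radon_measure_on B \<beta> \<and> emeasure \<beta> B = 1 \<and> (\<forall>A\<in>K. distr \<beta> \<beta> ((*v) A) = \<beta>)"

definition mutually_singular :: "'a measure \<Rightarrow> 'a measure \<Rightarrow> bool" where
  "mutually_singular M N \<longleftrightarrow> sets M = sets N \<and>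
     (\<exists>A\<in>sets N. emeasure N A = 0 \<and> emeasure M (space M - A) = 0)"

definition lebesgue_decomposition ::
    "'a measure \<Rightarrow> 'a measure \<Rightarrow> 'a measure \<Rightarrow> 'a measure \<Rightarrow> bool" where
  "lebesgue_decomposition \<beta> \<mu> \<mu>a \<mu>s \<longleftrightarrow>
     sets \<mu>a = sets \<mu> \<and> sets \<mu>s = sets \<mu> \<and>
     (\<forall>A\<in>sets \<mu>. emeasure \<mu> A = emeasure \<mu>a A + emeasure \<mu>s A) \<and>
     absolutely_continuous \<beta> \<mu>a \<and> mutually_singular \<mu>s \<beta>"

definition has_ac_density :: "'a measure \<Rightarrow> 'a measure \<Rightarrow> ('a \<Rightarrow> real) \<Rightarrow> bool" where
  "has_ac_density \<beta> \<mu> h \<longleftrightarrow> h \<in> borel_measurable \<beta> \<and> (AE x in \<beta>. 0 \<le> h x) \<and>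
     (\<exists>\<mu>s. lebesgue_decomposition \<beta> \<mu> (density \<beta> (\<lambda>x. ennreal (h x))) \<mu>s)"


section \<open>The Hardy space and its kernels\<close>

definition hardy_sup :: "(complex ^ 'n) measure \<Rightarrow> (complex ^ 'n \<Rightarrow> complex) \<Rightarrow> ennreal" where
  "hardy_sup \<beta> f = (SUP \<rho>\<in>{0..<1::real}. \<integral>\<^sup>+\<zeta>. ennreal ((cmod (f (\<rho> *\<^sub>R \<zeta>)))\<^sup>2) \<partial>\<beta>)"

definition hardy_space ::
    "(complex ^ 'n) set \<Rightarrow> (complex ^ 'n) measure \<Rightarrow> (complex ^ 'n \<Rightarrow> complex) set" where
  "hardy_space D \<beta> = {f. f mv_holomorphic_on D \<and> hardy_sup \<beta> f < \<infinity>}"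

definition hardy_norm_sq :: "(complex ^ 'n) measure \<Rightarrow> (complex ^ 'n \<Rightarrow> complex) \<Rightarrow> real" where
  "hardy_norm_sq \<beta> f = enn2real (hardy_sup \<beta> f)"

text \<open>The inner product is recovered from the Hardy norm by polarization; it is linear in the
  first argument.\<close>

definition hardy_inner ::
    "(complex ^ 'n) measure \<Rightarrow> (complex ^ 'n \<Rightarrow> complex) \<Rightarrow> (complex ^ 'n \<Rightarrow> complex) \<Rightarrow> complex" where
  "hardy_inner \<beta> f g = (\<Sum>k<4. \<i> ^ k * of_real (hardy_norm_sq \<beta> (\<lambda>z. f z + \<i> ^ k * g z))) / 4"

text \<open>The reproducing kernel on \<open>D \<times> D\<close>, together with its sesqui-holomorphic extension. As
  every point of \<open>D \<times> closure D\<close> is a limit of points of \<open>D \<times> D\<close>, this determines \<open>C\<close> on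
  \<open>D \<times> closure D\<close>.\<close>

definition is_szego_kernel ::
    "(complex ^ 'n) set \<Rightarrow> (complex ^ 'n) measure \<Rightarrow> (complex ^ 'n \<Rightarrow> complex ^ 'n \<Rightarrow> complex) \<Rightarrow> bool"
  where
  "is_szego_kernel D \<beta> C \<longleftrightarrow>
     (\<forall>w\<in>D. (\<lambda>z. C z w) \<in> hardy_space D \<beta>) \<and>
     (\<forall>f\<in>hardy_space D \<beta>. \<forall>w\<in>D. f w = hardy_inner \<beta> f (\<lambda>z. C z w)) \<and>
     (\<exists>U. open U \<and> D \<times> closure D \<subseteq> U \<and> sesqui_holomorphic_on C U)"

text \<open>\<open>C z z\<close> is a positive real number, being the squared norm of a nonzero kernel function.\<close>

definition poisson_szego ::
    "(complex ^ 'n \<Rightarrow> complex ^ 'n \<Rightarrow> complex) \<Rightarrow> complex ^ 'n \<Rightarrow> complex ^ 'n \<Rightarrow> real" where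
  "poisson_szego C z \<zeta> = (cmod (C z \<zeta>))\<^sup>2 / Re (C z z)"

definition poisson_integral ::
    "(complex ^ 'n \<Rightarrow> complex ^ 'n \<Rightarrow> complex) \<Rightarrow> (complex ^ 'n) measure \<Rightarrow> complex ^ 'n \<Rightarrow> real" where
  "poisson_integral C \<mu> z = (\<integral>\<zeta>. poisson_szego C z \<zeta> \<partial>\<mu>)"


section \<open>Clark measures, boundary values and inner functions\<close>

definition is_clark_measure ::
    "(complex ^ 'n) set \<Rightarrow> (complex ^ 'n) set \<Rightarrow> (complex ^ 'n \<Rightarrow> complex ^ 'n \<Rightarrow> complex) \<Rightarrow>
     (complex ^ 'n \<Rightarrow> complex) \<Rightarrow> complex \<Rightarrow> (complex ^ 'n) measure \<Rightarrow> bool" where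
  "is_clark_measure D B C \<phi> \<alpha> \<mu> \<longleftrightarrow> radon_measure_on B \<mu> \<and>
     (\<forall>z\<in>D. poisson_integral C \<mu> z = Re ((\<alpha> + \<phi> z) / (\<alpha> - \<phi> z)))"

definition has_radial_limit :: "(complex ^ 'n \<Rightarrow> complex) \<Rightarrow> complex ^ 'n \<Rightarrow> complex \<Rightarrow> bool" where
  "has_radial_limit f \<zeta> l \<longleftrightarrow> ((\<lambda>\<rho>::real. f (\<rho> *\<^sub>R \<zeta>)) \<longlongrightarrow> l) (at_left 1)"

text \<open>Meaningful only at those \<open>\<zeta>\<close> where the limit exists.\<close>

definition radial_limit :: "(complex ^ 'n \<Rightarrow> complex) \<Rightarrow> complex ^ 'n \<Rightarrow> complex" where
  "radial_limit f \<zeta> = Lim (at_left 1) (\<lambda>\<rho>::real. f (\<rho> *\<^sub>R \<zeta>))"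

definition inner_function ::
    "(complex ^ 'n) set \<Rightarrow> (complex ^ 'n) measure \<Rightarrow> (complex ^ 'n \<Rightarrow> complex) \<Rightarrow> bool" where
  "inner_function D \<beta> \<phi> \<longleftrightarrow> \<phi> mv_holomorphic_on D \<and> bounded (\<phi> ` D) \<and>
     (AE \<zeta> in \<beta>. has_radial_limit \<phi> \<zeta> (radial_limit \<phi> \<zeta>) \<and> cmod (radial_limit \<phi> \<zeta>) = 1)"

end

theory Submission
  imports Defs "HOL-Complex_Analysis.Complex_Analysis" "HOL-Real_Asymp.Real_Asymp"
begin

text \<open>
  The Clark measure \<open>\<mu>\<^sub>\<alpha>\<close> has the Poisson--Szego integral \<open>h = Re ((\<alpha> + \<phi>) / (\<alpha> - \<phi>))\<close>, and
  \<open>h\<close> has radial limits \<open>h\<^sub>1\<close> at almost every point of the Silov boundary. The theorem is therefore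
  an instance of a Fatou theorem: the radial limit of a Poisson--Szego integral \<open>\<P>\<mu>\<close>, where it
  exists almost everywhere, is the density of the absolutely continuous part of \<open>\<mu>\<close>.

  The kernel enters only through three properties of \<open>p\<^sub>\<rho>(\<zeta>, \<eta>) = \<P>(\<rho>\<zeta>, \<eta>)\<close> on \<open>B \<times> B\<close>
  (\<open>poisson_approximate_identity\<close>). It is symmetric, because the Szego kernel is invariant under
  the linear automorphisms, which act transitively on \<open>B\<close> and contain the circle. It has mass one, and
  \<open>\<integral> p\<^sub>\<rho>(\<zeta>, \<eta>) |\<zeta> - \<eta>|\<^sup>2 d\<beta>(\<zeta>) = 2 - 2 \<rho>\<close>. The last two hold because the reproducing property
  makes \<open>\<P>(z, \<cdot>) \<beta>\<close> a probability measure that represents evaluation at \<open>z\<close> of functions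
  holomorphic on \<open>D\<close> and continuous on its closure (\<open>kernel_represents\<close>); for \<open>z = \<rho>\<eta>\<close> the linear
  function \<open>\<zeta> \<mapsto> \<langle>\<zeta>, \<eta>\<rangle>\<close> is such a function, and on the unit sphere
  \<open>|\<zeta> - \<eta>|\<^sup>2 = 2 - 2 Re \<langle>\<zeta>, \<eta>\<rangle>\<close>. Thus mass concentrates at \<open>\<eta>\<close> in the mean, although for
  domains of higher rank \<open>p\<^sub>\<rho>\<close> need not tend to zero away from the diagonal.

  For such kernels an almost everywhere limit is the density of the absolutely continuous part
  (\<open>limit_is_ac_density\<close>). Fatou's lemma gives \<open>h\<^sub>1 \<beta> \<le> \<mu>\<close>. Conversely, if \<open>w \<beta> \<le> \<mu>\<close>, then
  \<open>p\<^sub>\<rho> \<mu> \<ge> p\<^sub>\<rho> (w \<beta>)\<close> by positivity, and the right hand side tends to \<open>w\<close> in measure; hence \<open>h\<^sub>1 \<ge> w\<close>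
  almost everywhere.

  Almost everywhere existence of the radial limit \<open>\<phi>\<^sub>1\<close> (\<open>AE_has_radial_limit\<close>) is reduced to one
  variable: as \<open>\<beta>\<close> is invariant under rotations \<open>\<zeta> \<mapsto> c \<zeta>\<close> with \<open>|c| = 1\<close>, a Borel set is null if almost
  every point of every circle avoids it, and on the disc spanned by a circle Fatou's theorem applies.
  Finally \<open>\<phi>\<^sub>1 \<noteq> \<alpha>\<close> almost everywhere (\<open>AE_radial_limit_neq\<close>), because the square root of
  \<open>(\<alpha> + \<phi>) / (\<alpha> - \<phi>)\<close> takes values in a sector, so its modulus has bounded means over \<open>\<rho>B\<close>.

  As \<open>h\<^sub>1 = (1 - |\<phi>\<^sub>1|\<^sup>2) / |\<alpha> - \<phi>\<^sub>1|\<^sup>2\<close>, the density vanishes almost everywhere exactly when \<open>\<phi>\<close> is inner,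
  whatever the value of \<open>\<alpha>\<close>.
\<close>

section \<open>Fatou's theorem for bounded holomorphic functions of one variable\<close>

text \<open>Adding a large multiple of \<open>x\<close> to \<open>g\<close> gives an increasing bi-Lipschitz bijection \<open>G\<close>. The
  pushforward of Lebesgue measure under its inverse \<open>H\<close> gives mass \<open>G b - G a\<close> to \<open>[a, b]\<close> and, since
  Lipschitz maps preserve null sets, is absolutely continuous; so \<open>G\<close> is an indefinite
  integral and the differentiation theorem for integrals applies.\<close>

lemma lipschitz_right_derivative_AE:
  fixes g :: "real \<Rightarrow> real"
  assumes lip: "\<And>x y. \<bar>g x - g y\<bar> \<le> L * \<bar>x - y\<bar>"
  obtains N where "negligible N"
    "\<And>t. t \<notin> N \<Longrightarrow> \<exists>l. ((\<lambda>h. (g (t + h) - g t) / h) \<longlongrightarrow> l) (at_right 0)"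
proof -
  define G where "G x = g x + (L + 1) * x" for x
  have L0: "0 \<le> L" using lip[of 0 1] by auto
  have G_lower: "y - x \<le> G y - G x" if "x \<le> y" for x y
    using lip[of x y] that by (auto simp: G_def abs_if algebra_simps split: if_splits)
  have G_lip: "\<bar>G y - G x\<bar> \<le> (2 * L + 1) * \<bar>y - x\<bar>" for x y
  proof -
    have "\<bar>G y - G x\<bar> \<le> \<bar>g y - g x\<bar> + \<bar>(L + 1) * (y - x)\<bar>"
      unfolding G_def by (simp add: algebra_simps)
    also have "\<dots> \<le> L * \<bar>y - x\<bar> + (L + 1) * \<bar>y - x\<bar>"
      using lip[of y x] L0 by (simp add: abs_mult)
    finally show ?thesis by (simp add: algebra_simps)
  qed
  have G_cont: "continuous_on S G" for S
  proof -
    have "(2 * L + 1)-lipschitz_on S G"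
      using G_lip L0 by (intro lipschitz_onI) (auto simp: dist_real_def)
    then show ?thesis by (rule lipschitz_on_continuous_on)
  qed
  have "\<exists>x. G x = y" for y
  proof -
    define r where "r = \<bar>y - G 0\<bar>"
    have "G (- r) \<le> y" "y \<le> G r" using G_lower[of "-r" 0] G_lower[of 0 r] by (auto simp: r_def)
    with IVT'[of G "-r" y r] G_cont show ?thesis by (auto simp: r_def)
  qed
  then obtain H where GH: "\<And>y. G (H y) = y" by metis
  have G_le_iff: "G x \<le> G y \<longleftrightarrow> x \<le> y" for x y
    using G_lower[of x y] G_lower[of y x] by linarith
  have HG: "H (G x) = x" for x
    using GH[of "G x"] G_le_iff by (metis order_antisym order_refl)
  have H_lip: "\<bar>H u - H v\<bar> \<le> \<bar>u - v\<bar>" for u v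
    using G_lower[of "H u" "H v"] G_lower[of "H v" "H u"] GH by (cases "H u \<le> H v") auto
  have "1-lipschitz_on UNIV H" using H_lip by (intro lipschitz_onI) (auto simp: dist_real_def)
  then have H_meas [measurable]: "H \<in> borel_measurable borel"
    by (intro borel_measurable_continuous_onI lipschitz_on_continuous_on)
  define \<nu> where "\<nu> = distr lborel borel H"
  have \<nu>_Icc: "emeasure \<nu> {a..b} = ennreal (G b - G a)" if "a \<le> b" for a b
  proof -
    have "H -` {a..b} = {G a..G b}" by (intro set_eqI) (metis GH G_le_iff atLeastAtMost_iff vimage_eq)
    moreover have "G a \<le> G b" using G_le_iff that by simp
    ultimately show ?thesis by (simp add: \<nu>_def emeasure_distr)
  qed
  have ac: "absolutely_continuous lborel \<nu>"
  proof (unfold absolutely_continuous_def, safe)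
    fix A :: "real set" assume A: "A \<in> null_sets lborel"
    then have "negligible A" by (simp add: null_sets_completionI negligible_iff_null_sets)
    then have "negligible (G ` A)"
      using G_lip by (intro negligible_locally_Lipschitz_image) auto
    moreover have "H -` A = G ` A" using GH HG by (auto simp: image_iff) metis
    moreover have "H -` A \<in> sets borel" using A H_meas
      by (metis measurable_sets_borel null_setsD2 sets_lborel)
    ultimately have "emeasure lborel (H -` A) = 0"
      using null_sets_completion_iff[of "H -` A" lborel] by (auto simp: negligible_iff_null_sets null_sets_def)
    then show "A \<in> null_sets \<nu>" using A by (auto simp: \<nu>_def null_sets_def emeasure_distr)
  qed
  obtain k where k[measurable]: "k \<in> borel_measurable lborel" and k\<nu>: "density lborel k = \<nu>"
    using sigma_finite_measure.Radon_Nikodym[OF sigma_finite_lborel ac] by (auto simp: \<nu>_def)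
  have k_Icc: "(\<integral>\<^sup>+x. k x * indicator {a..b} x \<partial>lborel) = ennreal (G b - G a)" if "a \<le> b" for a b
    using \<nu>_Icc[OF that] by (simp add: emeasure_density flip: k\<nu>)
  have "AE x in lborel. \<forall>n::nat. x \<in> {-real n..real n} \<longrightarrow> k x \<noteq> \<infinity>"
  proof (subst AE_all_countable, intro allI)
    fix n :: nat
    have "AE x in lborel. k x * indicator {-real n..real n} x \<noteq> \<infinity>"
      by (rule nn_integral_PInf_AE) (simp_all add: k_Icc)
    then show "AE x in lborel. x \<in> {-real n..real n} \<longrightarrow> k x \<noteq> \<infinity>"
      by eventually_elim (auto simp: indicator_def)
  qed
  then have k_fin: "AE x in lborel. k x \<noteq> \<infinity>"
  proof eventually_elim
    case (elim x)
    obtain n :: nat where "\<bar>x\<bar> \<le> real n" using real_arch_simple by blast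
    then show ?case using elim[rule_format, of n] by (auto simp: abs_le_iff)
  qed
  define \<kappa> where "\<kappa> x = enn2real (k x)" for x
  have \<kappa>_int: "(\<kappa> has_integral (G b - G a)) {a..b}" if "a \<le> b" for a b
  proof -
    have "(\<integral>\<^sup>+x. ennreal (\<kappa> x * indicator {a..b} x) \<partial>lborel) = (\<integral>\<^sup>+x. k x * indicator {a..b} x \<partial>lborel)"
      using k_fin by (intro nn_integral_cong_AE) (auto simp: \<kappa>_def indicator_def top.not_eq_extremum)
    also have "\<dots> = ennreal (G b - G a)" by (rule k_Icc[OF that])
    finally have "((\<lambda>x. \<kappa> x * indicator {a..b} x) has_integral (G b - G a)) UNIV"
      using that G_le_iff[of a b] by (intro nn_integral_has_integral) (auto simp: \<kappa>_def)
    then show ?thesis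
      by (subst has_integral_restrict_UNIV[symmetric]) (simp add: indicator_def of_bool_def if_distrib cong: if_cong)
  qed
  have "\<kappa> integrable_on cbox a b" for a b
    using \<kappa>_int[of a b] by (cases "a \<le> b") (auto simp: integrable_on_def)
  then obtain N where N: "negligible N" "\<And>x e. \<lbrakk>x \<notin> N; 0 < e\<rbrakk> \<Longrightarrow>
      \<exists>d>0. \<forall>h. 0 < h \<and> h < d \<longrightarrow>
         norm (integral (cbox x (x + h *\<^sub>R One)) \<kappa> /\<^sub>R h ^ DIM(real) - \<kappa> x) < e"
    using integrable_ccontinuous_explicit by blast
  show thesis
  proof (rule that[OF N(1)])
    fix t assume t: "t \<notin> N"
    have "((\<lambda>h. (G (t + h) - G t) / h) \<longlongrightarrow> \<kappa> t) (at_right 0)"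
    proof (rule tendstoI)
      fix e :: real assume "0 < e"
      from N(2)[OF t this] obtain d where d: "d > 0" "\<And>h. 0 < h \<Longrightarrow> h < d \<Longrightarrow>
          norm (integral (cbox t (t + h *\<^sub>R One)) \<kappa> /\<^sub>R h ^ DIM(real) - \<kappa> t) < e" by blast
      show "\<forall>\<^sub>F h in at_right 0. dist ((G (t + h) - G t) / h) (\<kappa> t) < e"
        using d(2) \<kappa>_int[THEN integral_unique] eventually_at_right_real[OF d(1)]
        by (auto simp: dist_norm divide_inverse mult.commute elim!: eventually_mono)
    qed
    moreover have "\<forall>\<^sub>F h in at_right 0. (G (t + h) - G t) / h - (L + 1) = (g (t + h) - g t) / h"
      using eventually_at_right_less[of "0::real"]
      by eventually_elim (auto simp: G_def field_simps)
    ultimately have "((\<lambda>h. (g (t + h) - g t) / h) \<longlongrightarrow> \<kappa> t - (L + 1)) (at_right 0)"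
      by (rule Lim_transform_eventually[OF tendsto_diff[OF _ tendsto_const]])
    then show "\<exists>l. ((\<lambda>h. (g (t + h) - g t) / h) \<longlongrightarrow> l) (at_right 0)" ..
  qed
qed

text \<open>If the vertical limit failed along a sequence of heights \<open>y\<^sub>n\<close>, the blow-ups of \<open>U\<close> at \<open>t\<close> with scale
  \<open>y\<^sub>n\<close>, corrected by the linear function \<open>l s\<close>, would be uniformly Lipschitz, so a subsequence
  converges on a half disc. By the one-sided derivative the limit vanishes on a segment of the real
  axis, hence everywhere by continuation across that segment. Its derivative at \<open>\<i>\<close> is then zero, which is
  the limit of \<open>u(t + \<i> y\<^sub>n) - l\<close>.\<close>

lemma vertical_limit_of_derivative:
  fixes U u :: "complex \<Rightarrow> complex" and t :: real
  assumes lip: "\<And>z w. 0 \<le> Im z \<Longrightarrow> 0 \<le> Im w \<Longrightarrow> norm (U z - U w) \<le> M * norm (z - w)"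
    and der: "\<And>z. 0 < Im z \<Longrightarrow> (U has_field_derivative u z) (at z)"
    and right: "((\<lambda>h. (U (of_real (t + h)) - U (of_real t)) / of_real h) \<longlongrightarrow> l) (at_right 0)"
  shows "((\<lambda>y. u (of_real t + \<i> * of_real y)) \<longlongrightarrow> l) (at_right 0)"
proof (rule ccontr)
  assume "\<not> ?thesis"
  then obtain e where "e > 0" and
    ne: "\<not> (\<forall>\<^sub>F y in at_right 0. dist (u (of_real t + \<i> * of_real y)) l < e)"
    unfolding tendsto_iff by blast
  have "\<exists>y. 0 < y \<and> y < inverse (real (Suc n)) \<and> \<not> dist (u (of_real t + \<i> * of_real y)) l < e" for n
    using ne unfolding eventually_at_right_field by (metis inverse_Suc)
  then obtain y where y: "\<And>n. 0 < y n" "\<And>n. y n < inverse (real (Suc n))"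
      "\<And>n. e \<le> dist (u (of_real t + \<i> * of_real (y n))) l" by (metis not_less)
  have y0: "y \<longlonglongrightarrow> 0"
    by (rule tendsto_sandwich[OF _ _ tendsto_const LIMSEQ_inverse_real_of_nat])
       (use y in \<open>auto intro!: always_eventually less_imp_le\<close>)
  have M0: "0 \<le> M" using lip[of 0 1] norm_ge_zero[of "U 0 - U 1"] by (simp del: norm_ge_zero)
  \<comment> \<open>Blow-ups of \<open>U\<close>, minus its linear part, at the boundary point.\<close>
  define V where "V n s = (U (of_real t + of_real (y n) * s) - U (of_real t)) / of_real (y n) - l * s" for n s
  define S where "S = cball (0::complex) 3 \<inter> {z. 0 \<le> Im z}"
  define S' where "S' = ball (0::complex) 3 \<inter> {z. 0 < Im z}"
  have S'_S: "S' \<subseteq> S" by (auto simp: S_def S'_def)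
  have "compact S" unfolding S_def by (intro compact_Int_closed compact_cball closed_halfspace_Im_ge)
  have "open S'" unfolding S'_def by (intro open_Int open_ball open_halfspace_Im_gt)
  have V_lip: "norm (V n a - V n b) \<le> (M + norm l) * norm (a - b)"
    if "0 \<le> Im a" "0 \<le> Im b" for n a b
  proof -
    let ?a = "of_real t + of_real (y n) * a" and ?b = "of_real t + of_real (y n) * b"
    have "V n a - V n b = (U ?a - U ?b) / of_real (y n) - l * (a - b)"
      by (simp add: V_def diff_divide_distrib algebra_simps)
    also have "norm \<dots> \<le> norm ((U ?a - U ?b) / of_real (y n)) + norm (l * (a - b))"
      by (rule norm_triangle_ineq4)
    finally have tri: "norm (V n a - V n b) \<le> norm ((U ?a - U ?b) / of_real (y n)) + norm (l * (a - b))" .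
    have "norm (U ?a - U ?b) \<le> M * norm (?a - ?b)"
      using that y(1)[of n] by (intro lip) auto
    then have "norm ((U ?a - U ?b) / of_real (y n)) \<le> M * norm (?a - ?b) / y n"
      using y(1)[of n] by (simp add: norm_divide divide_right_mono)
    moreover have "?a - ?b = of_real (y n) * (a - b)" by (simp add: algebra_simps)
    ultimately have "norm (V n a - V n b) \<le> M * norm (of_real (y n) * (a - b)) / y n + norm (l * (a - b))"
      using tri by simp
    also have "norm (of_real (y n) * (a - b)) = y n * norm (a - b)"
      using y(1)[of n] by (simp add: norm_mult)
    finally show ?thesis using y(1)[of n] by (simp add: norm_mult distrib_right)
  qed
  have V0: "V n 0 = 0" for n by (simp add: V_def)
  have bounded_V: "norm (V n x) \<le> (M + norm l) * 3" if "x \<in> S" for n x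
  proof -
    have "norm (V n x - V n 0) \<le> (M + norm l) * norm (x - 0)" using that by (intro V_lip) (auto simp: S_def)
    also have "\<dots> \<le> (M + norm l) * 3"
      using \<open>x \<in> S\<close> M0 by (intro mult_left_mono) (auto simp: S_def)
    finally show ?thesis by (simp add: V0)
  qed
  have equicont_V: "\<exists>b>0. \<forall>n w. w \<in> S \<and> norm (x - w) < b \<longrightarrow> norm (V n x - V n w) < d"
    if x: "x \<in> S" "0 < d" for x d
    proof (intro exI[of _ "d / (M + norm l + 1)"] conjI allI impI)
      show "0 < d / (M + norm l + 1)" using x M0 by (simp add: add_nonneg_pos)
      fix n w assume w: "w \<in> S \<and> norm (x - w) < d / (M + norm l + 1)"
      have "norm (V n x - V n w) \<le> (M + norm l) * norm (x - w)"
        using x w by (intro V_lip) (auto simp: S_def)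
      also have "\<dots> \<le> (M + norm l + 1) * norm (x - w)" by (intro mult_right_mono) auto
      also have "\<dots> < d"
        using w M0 pos_less_divide_eq[of "M + norm l + 1" "norm (x - w)" d]
        by (simp add: add_nonneg_pos mult.commute)
      finally show "norm (V n x - V n w) < d" .
    qed
  obtain g k where g: "continuous_on S g" "strict_mono (k :: nat \<Rightarrow> nat)"
    "\<And>e. 0 < e \<Longrightarrow> \<exists>N. \<forall>n x. n \<ge> N \<and> x \<in> S \<longrightarrow> norm (V (k n) x - g x) < e"
    using Arzela_Ascoli[OF \<open>compact S\<close> bounded_V equicont_V] by blast
  have V_unif: "uniform_limit S (\<lambda>n. V (k n)) g sequentially"
  proof (rule uniform_limitI)
    fix d :: real assume "0 < d"
    then obtain N where "\<forall>n x. n \<ge> N \<and> x \<in> S \<longrightarrow> norm (V (k n) x - g x) < d" using g(3) by metis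
    then show "\<forall>\<^sub>F n in sequentially. \<forall>x\<in>S. dist (V (k n) x) (g x) < d"
      unfolding eventually_sequentially dist_norm by (intro exI[of _ N]) simp
  qed
  have V_g: "(\<lambda>n. V (k n) x) \<longlonglongrightarrow> g x" if "x \<in> S" for x
    by (rule tendsto_uniform_limitI[OF V_unif that])
  have g_real: "g (of_real x) = 0" if x: "0 \<le> x" "x \<le> 3" for x :: real
  proof (cases "x = 0")
    case True
    then show ?thesis using V_g[of 0] V0 by (simp add: S_def LIMSEQ_const_iff)
  next
    case False
    then have "x > 0" using x by simp
    have "filterlim (\<lambda>n. y (k n) * x) (at_right 0) sequentially"
      unfolding filterlim_at
      using tendsto_mult_left_zero[OF LIMSEQ_subseq_LIMSEQ[OF y0 g(2)], of x] y(1) \<open>x > 0\<close>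
      by (auto simp: o_def less_imp_neq[symmetric] less_imp_neq)
    from filterlim_compose[OF right this]
    have "(\<lambda>n. of_real x * ((U (of_real (t + y (k n) * x)) - U (of_real t)) / of_real (y (k n) * x) - l))
        \<longlonglongrightarrow> of_real x * (l - l)"
      by (intro tendsto_intros)
    moreover have "of_real x * ((U (of_real (t + y (k n) * x)) - U (of_real t)) / of_real (y (k n) * x) - l)
        = V (k n) (of_real x)" for n
      using \<open>x > 0\<close> y(1)[of "k n"] by (simp add: V_def field_simps)
    ultimately have "(\<lambda>n. V (k n) (of_real x)) \<longlonglongrightarrow> 0" by simp
    then show ?thesis using V_g[of "of_real x"] x LIMSEQ_unique by (auto simp: S_def)
  qed
  have V_der: "(V n has_field_derivative (u (of_real t + of_real (y n) * s) - l)) (at s)"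
    if "0 < Im s" for n s
  proof -
    have "((\<lambda>s. U (of_real t + of_real (y n) * s)) has_field_derivative
        (u (of_real t + of_real (y n) * s) * of_real (y n))) (at s)"
      using that y(1)[of n] by (intro DERIV_chain2[OF der]) (auto intro!: derivative_eq_intros)
    then have "((\<lambda>s. (U (of_real t + of_real (y n) * s) - U (of_real t)) / of_real (y n) - l * s)
        has_field_derivative ((u (of_real t + of_real (y n) * s) * of_real (y n) - 0) / of_real (y n) - l)) (at s)"
      by (intro DERIV_diff DERIV_cdivide DERIV_const DERIV_cmult_Id)
    then show ?thesis using less_imp_neq[OF y(1)[of n], symmetric] by (simp add: V_def[abs_def])
  qed
  have V_hol: "V n holomorphic_on A" if "A \<subseteq> {z. 0 < Im z}" for n A
    unfolding holomorphic_on_def field_differentiable_def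
    using that V_der has_field_derivative_at_within by blast
  have g_hol: "g holomorphic_on S'"
  proof (rule holomorphic_uniform_sequence[OF \<open>open S'\<close>, of "\<lambda>n. V (k n)"])
    show "V (k n) holomorphic_on S'" for n by (rule V_hol) (auto simp: S'_def)
    fix x assume "x \<in> S'"
    then obtain d where d: "0 < d" "cball x d \<subseteq> S'"
      using \<open>open S'\<close> open_contains_cball by blast
    have "cball x d \<subseteq> S" using d S'_S by simp
    then have "uniform_limit (cball x d) (\<lambda>n. V (k n)) g sequentially"
      by (intro uniform_limit_on_subset[OF V_unif])
    with d show "\<exists>d>0. cball x d \<subseteq> S' \<and> uniform_limit (cball x d) (\<lambda>n. V (k n)) g sequentially"
      by blast
  qed
  \<comment> \<open>As \<open>g\<close> vanishes on an interval of the real axis, it continues by zero across it.\<close>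
  define W where "W z = (if Im z \<le> 0 then 0 else g z)" for z
  have W_hol: "W holomorphic_on ball 1 1"
  proof (rule holomorphic_on_paste_across_line[where d = \<i> and k = 0])
    have norm3: "norm z < 3" if "dist 1 z < 1" for z :: complex
      using that norm_triangle_ineq[of 1 "z - 1"] by (simp add: dist_norm norm_minus_commute)
    have sub: "ball 1 1 \<inter> {z. 0 < Im z} \<subseteq> S'" using norm3 by (auto simp: S'_def)
    show "W holomorphic_on (ball 1 1 \<inter> {z. \<i> \<bullet> z < 0})"
      by (rule holomorphic_transform[of "\<lambda>_. 0"]) (auto simp: W_def inner_complex_def)
    show "W holomorphic_on (ball 1 1 \<inter> {z. 0 < \<i> \<bullet> z})"
      using sub by (intro holomorphic_transform[OF holomorphic_on_subset[OF g_hol]])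
         (auto simp: W_def inner_complex_def)
    have "g z = 0" if "z \<in> ball 1 1" "Im z = 0" for z
    proof -
      have "\<bar>1 - Re z\<bar> < 1" using that abs_Re_le_cmod[of "1 - z"] by (auto simp: dist_norm)
      then show ?thesis using g_real[of "Re z"] that by (simp add: complex_is_Real_iff abs_if split: if_splits)
    qed
    moreover have "continuous_on {z \<in> ball 1 1. 0 \<le> Im z} g"
      using norm3 by (intro continuous_on_subset[OF g(1)]) (force simp: S_def)
    ultimately show "continuous_on (ball 1 1) W"
      unfolding W_def[abs_def] by (intro continuous_on_cases_le continuous_on_Im) auto
  qed auto
  have W_zero: "W z = 0" if "z \<in> ball 1 1" for z
  proof (rule analytic_continuation_open[of "ball 1 1 \<inter> {z. Im z < 0}" "ball 1 1" W "\<lambda>_. 0"])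
    have "1 - \<i> / 2 \<in> ball 1 1 \<inter> {z. Im z < 0}" by (simp add: dist_norm norm_divide)
    then show "ball 1 1 \<inter> {z. Im z < 0} \<noteq> {}" by blast
  qed (use that W_hol in \<open>auto simp: W_def open_halfspace_Im_lt\<close>)
  have g_zero: "g z = 0" if "z \<in> S'" for z
  proof (rule analytic_continuation_open[of "ball 1 1 \<inter> S'" S' g "\<lambda>_. 0"])
    have "1 + \<i> / 2 \<in> ball 1 1 \<inter> S'"
    proof -
      have "dist (1 + \<i> / 2) 1 < 1" "dist (1 + \<i> / 2) 0 < 3"
        using norm_triangle_ineq[of 1 "\<i> / 2"] by (simp_all add: dist_norm norm_divide)
      then show ?thesis by (simp add: S'_def dist_commute)
    qed
    then show "ball 1 1 \<inter> S' \<noteq> {}" by blast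
    show "connected S'" unfolding S'_def
      by (intro convex_connected convex_Int convex_ball convex_halfspace_Im_gt)
    show "g z = 0" if "z \<in> ball 1 1 \<inter> S'" for z
      using W_zero[of z] that by (auto simp: W_def S'_def)
  qed (use that g_hol \<open>open S'\<close> in auto)
  \<comment> \<open>By Cauchy's inequality on a disc about \<open>\<i>\<close> the derivatives of the blow-ups at \<open>\<i>\<close> tend to zero.\<close>
  have ball_S': "cball \<i> (1/2) \<subseteq> S'"
  proof
    fix z assume z: "z \<in> cball \<i> (1/2)"
    then have "\<bar>1 - Im z\<bar> \<le> 1/2" using abs_Im_le_cmod[of "\<i> - z"] by (auto simp: dist_norm)
    moreover have "norm z \<le> 3/2"
      using z norm_triangle_ineq[of \<i> "z - \<i>"] by (simp add: dist_norm norm_minus_commute)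
    ultimately show "z \<in> S'" by (auto simp: S'_def abs_if split: if_splits)
  qed
  obtain n where n: "\<And>x. x \<in> S \<Longrightarrow> norm (V (k n) x - g x) < e / 4"
    using g(3)[of "e / 4"] \<open>e > 0\<close> by (meson order_refl zero_less_divide_iff zero_less_numeral)
  have "norm ((deriv ^^ 1) (V (k n)) \<i>) \<le> fact 1 * (e / 4) / (1/2) ^ 1"
  proof (rule Cauchy_inequality)
    have "V (k n) holomorphic_on cball \<i> (1/2)"
      using ball_S' by (intro V_hol) (auto simp: S'_def)
    then show "V (k n) holomorphic_on ball \<i> (1/2)" "continuous_on (cball \<i> (1/2)) (V (k n))"
      by (auto intro: holomorphic_on_subset holomorphic_on_imp_continuous_on)
    fix x assume "norm (\<i> - x) = 1/2"
    then have "x \<in> S'" using ball_S' by (auto simp: dist_norm)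
    then show "norm (V (k n) x) \<le> e / 4" using n[of x] S'_S g_zero[of x] by auto
  qed auto
  moreover have "deriv (V (k n)) \<i> = u (of_real t + of_real (y (k n)) * \<i>) - l"
    by (rule DERIV_imp_deriv, rule V_der) simp
  ultimately have "dist (u (of_real t + \<i> * of_real (y (k n)))) l \<le> e / 2"
    by (simp add: dist_norm mult.commute)
  with y(3)[of "k n"] \<open>e > 0\<close> show False by simp
qed

text \<open>A primitive of \<open>u\<close> is Lipschitz because \<open>u\<close> is bounded. It extends to the real axis, where
  it is differentiable from the right almost everywhere.\<close>

theorem Fatou_upper_half_plane:
  fixes u :: "complex \<Rightarrow> complex"
  assumes hol: "u holomorphic_on {z. 0 < Im z}"
    and bound: "\<And>z. 0 < Im z \<Longrightarrow> norm (u z) \<le> M"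
  obtains N where "negligible N"
    "\<And>t. t \<notin> N \<Longrightarrow> \<exists>l. ((\<lambda>y. u (of_real t + \<i> * of_real y)) \<longlongrightarrow> l) (at_right 0)"
proof -
  let ?H = "{z. 0 < Im z}"
  have H: "convex ?H" "open ?H" by (simp_all add: convex_halfspace_Im_gt open_halfspace_Im_gt)
  have M0: "0 \<le> M" using norm_ge_zero[of "u \<i>"] bound[of \<i>] by (simp del: norm_ge_zero)
  obtain U0 where U0: "\<And>z. z \<in> ?H \<Longrightarrow> (U0 has_field_derivative u z) (at z within ?H)"
    using holomorphic_convex_primitive'[OF H hol] by metis
  have "M-lipschitz_on ?H U0"
    using field_differentiable_bound[OF H(1) U0, of M] bound M0
    by (intro lipschitz_onI) (auto simp: dist_norm)
  then obtain U where U: "M-lipschitz_on (closure ?H) U" "\<And>z. z \<in> ?H \<Longrightarrow> U z = U0 z"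
    using lipschitz_extend_closure by metis
  have lip: "norm (U z - U w) \<le> M * norm (z - w)" if "0 \<le> Im z" "0 \<le> Im w" for z w
    using lipschitz_onD[OF U(1), of z w] that
    by (simp add: dist_norm closure_halfspace_gt[of \<i> 0, unfolded inner_complex_def, simplified])
  have der: "(U has_field_derivative u z) (at z)" if "0 < Im z" for z
  proof (rule has_field_derivative_transform_within_open[OF _ H(2)])
    show "(U0 has_field_derivative u z) (at z)"
      using U0[of z] at_within_open[OF _ H(2), of z] that by simp
  qed (use U(2) that in auto)
  have lip_real: "norm (U (of_real x) - U (of_real y)) \<le> M * \<bar>x - y\<bar>" for x y :: real
    using lip[of "of_real x" "of_real y"] by (simp flip: of_real_diff)
  have lip_Re: "\<bar>Re (U (of_real x)) - Re (U (of_real y))\<bar> \<le> M * \<bar>x - y\<bar>" for x y :: real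
    using order_trans[OF abs_Re_le_cmod lip_real[of x y]] by simp
  have lip_Im: "\<bar>Im (U (of_real x)) - Im (U (of_real y))\<bar> \<le> M * \<bar>x - y\<bar>" for x y :: real
    using order_trans[OF abs_Im_le_cmod lip_real[of x y]] by simp
  obtain N1 where N1: "negligible N1" "\<And>t. t \<notin> N1 \<Longrightarrow>
      \<exists>l. ((\<lambda>h. (Re (U (of_real (t + h))) - Re (U (of_real t))) / h) \<longlongrightarrow> l) (at_right 0)"
    by (rule lipschitz_right_derivative_AE[of "\<lambda>t. Re (U (of_real t))" M, OF lip_Re]) (rule that)
  obtain N2 where N2: "negligible N2" "\<And>t. t \<notin> N2 \<Longrightarrow>
      \<exists>l. ((\<lambda>h. (Im (U (of_real (t + h))) - Im (U (of_real t))) / h) \<longlongrightarrow> l) (at_right 0)"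
    by (rule lipschitz_right_derivative_AE[of "\<lambda>t. Im (U (of_real t))" M, OF lip_Im]) (rule that)
  show thesis
  proof (rule that[of "N1 \<union> N2"])
    fix t assume "t \<notin> N1 \<union> N2"
    then obtain l1 l2 where
      "((\<lambda>h. (Re (U (of_real (t + h))) - Re (U (of_real t))) / h) \<longlongrightarrow> l1) (at_right 0)"
      "((\<lambda>h. (Im (U (of_real (t + h))) - Im (U (of_real t))) / h) \<longlongrightarrow> l2) (at_right 0)"
      using N1(2) N2(2) by blast
    then have "((\<lambda>h. Complex ((Re (U (of_real (t + h))) - Re (U (of_real t))) / h)
        ((Im (U (of_real (t + h))) - Im (U (of_real t))) / h)) \<longlongrightarrow> Complex l1 l2) (at_right 0)"
      by (rule tendsto_Complex)
    also have "(\<lambda>h. Complex ((Re (U (of_real (t + h))) - Re (U (of_real t))) / h)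
        ((Im (U (of_real (t + h))) - Im (U (of_real t))) / h)) =
        (\<lambda>h. (U (of_real (t + h)) - U (of_real t)) / of_real h)"
      by (simp add: fun_eq_iff complex_eq_iff)
    finally show "\<exists>l. ((\<lambda>y. u (of_real t + \<i> * of_real y)) \<longlongrightarrow> l) (at_right 0)"
      using vertical_limit_of_derivative[OF lip der] by blast
  qed (use N1(1) N2(1) in auto)
qed

section \<open>The Poisson formula on a disc\<close>

text \<open>The circle is parametrized with period one, so that normalized arc length is Lebesgue measure
  on the unit interval.\<close>

definition circle_point :: "real \<Rightarrow> complex" where
  "circle_point t = exp (2 * of_real pi * \<i> * of_real t)"

lemma norm_circle_point [simp]: "cmod (circle_point t) = 1"
  by (simp add: circle_point_def norm_exp_eq_Re)

lemma continuous_on_circle_point [continuous_intros]: "continuous_on S circle_point"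
  unfolding circle_point_def by (intro continuous_intros)

text \<open>The Poisson kernel of the disc of radius \<open>r\<close> at the point \<open>\<rho>\<close> of the positive real axis.\<close>

definition disc_poisson :: "real \<Rightarrow> real \<Rightarrow> real \<Rightarrow> real" where
  "disc_poisson r \<rho> t = (r\<^sup>2 - \<rho>\<^sup>2) / (cmod (of_real r * circle_point t - of_real \<rho>))\<^sup>2"

lemma disc_poisson_nonneg: "0 \<le> \<rho> \<Longrightarrow> \<rho> < r \<Longrightarrow> 0 \<le> disc_poisson r \<rho> t"
  by (simp add: disc_poisson_def power_mono)

text \<open>Cauchy's formula for \<open>h k\<close>, where \<open>k(z) = (r\<^sup>2 - \<rho>\<^sup>2) / (r\<^sup>2 - \<rho> z)\<close> satisfies \<open>k(\<rho>) = 1\<close> and turns the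
  Cauchy kernel into the Poisson kernel on \<open>|z| = r\<close>.\<close>

lemma poisson_formula_disc:
  assumes h: "h holomorphic_on ball 0 R" and r: "0 \<le> \<rho>" "\<rho> < r" "r < R"
  shows "((\<lambda>t. of_real (disc_poisson r \<rho> t) * h (of_real r * circle_point t)) has_integral h (of_real \<rho>)) {0..1}"
proof -
  define k where "k z = (of_real r ^ 2 - of_real \<rho> ^ 2) / (of_real r ^ 2 - of_real \<rho> * z)" for z :: complex
  have nz: "of_real r ^ 2 - of_real \<rho> * z \<noteq> (0::complex)" if "z \<in> cball 0 r" for z :: complex
  proof
    assume "of_real r ^ 2 - of_real \<rho> * z = (0::complex)"
    then have "cmod (of_real r ^ 2) = cmod (of_real \<rho> * z)" by simp
    then have "r ^ 2 = \<rho> * cmod z" using r by (simp add: norm_mult norm_power)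
    also have "\<dots> \<le> \<rho> * r" using that r by (intro mult_left_mono) auto
    also have "\<dots> < r * r" using r by (intro mult_strict_right_mono) auto
    finally show False by (simp add: power2_eq_square)
  qed
  have hol: "(\<lambda>z. h z * k z) holomorphic_on cball 0 r"
    unfolding k_def using nz r
    by (intro holomorphic_intros holomorphic_on_subset[OF h]) auto
  have "((\<lambda>z. h z * k z / (z - of_real \<rho>)) has_contour_integral
      (2 * of_real pi * \<i> * (h (of_real \<rho>) * k (of_real \<rho>)))) (circlepath 0 r)"
    using r by (intro Cauchy_integral_circlepath)
      (auto intro: holomorphic_on_subset[OF hol] holomorphic_on_imp_continuous_on[OF hol])
  moreover have "k (of_real \<rho>) = 1"
    using nz[of "of_real \<rho>"] r by (simp add: k_def power2_eq_square)
  ultimately have "((\<lambda>t. h (circlepath 0 r t) * k (circlepath 0 r t) / (circlepath 0 r t - of_real \<rho>)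
      * vector_derivative (circlepath 0 r) (at t within {0..1})) has_integral
      (2 * of_real pi * \<i> * h (of_real \<rho>))) {0..1}"
    by (simp add: has_contour_integral_def)
  then have "((\<lambda>t. h (circlepath 0 r t) * k (circlepath 0 r t) / (circlepath 0 r t - of_real \<rho>)
      * vector_derivative (circlepath 0 r) (at t within {0..1}) / (2 * of_real pi * \<i>)) has_integral
      (2 * of_real pi * \<i> * h (of_real \<rho>)) / (2 * of_real pi * \<i>)) {0..1}"
    by (rule has_integral_divide)
  then have int: "((\<lambda>t. h (circlepath 0 r t) * k (circlepath 0 r t) / (circlepath 0 r t - of_real \<rho>)
      * vector_derivative (circlepath 0 r) (at t within {0..1}) / (2 * of_real pi * \<i>)) has_integral
      h (of_real \<rho>)) {0..1}" by simp
  show ?thesis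
  proof (rule has_integral_eq[OF _ int])
    fix t :: real assume t: "t \<in> {0..1}"
    define w where "w = of_real r * circle_point t"
    have w: "circlepath 0 r t = w" by (simp add: circlepath w_def circle_point_def)
    have vd: "vector_derivative (circlepath 0 r) (at t within {0..1}) = 2 * of_real pi * \<i> * w"
      using t by (simp add: vector_derivative_circlepath01 w_def circle_point_def mult_ac)
    have nw: "cmod w = r" using r by (simp add: w_def norm_mult)
    then have w0: "w \<noteq> 0" "w - of_real \<rho> \<noteq> 0" using r by auto
    have ww: "w * cnj w = of_real r ^ 2" by (simp flip: complex_norm_square add: nw)
    have eq: "of_real r ^ 2 - of_real \<rho> * w = w * cnj (w - of_real \<rho>)"
      by (simp add: ww[symmetric] algebra_simps)
    have "k w * w / (w - of_real \<rho>) = (of_real r ^ 2 - of_real \<rho> ^ 2) / (cnj (w - of_real \<rho>) * (w - of_real \<rho>))"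
      using w0(1) unfolding k_def eq by (simp del: complex_cnj_diff)
    also have "cnj (w - of_real \<rho>) * (w - of_real \<rho>) = of_real ((cmod (w - of_real \<rho>))\<^sup>2)"
      by (simp only: complex_norm_square mult.commute)
    finally have "k w * w / (w - of_real \<rho>) = of_real (disc_poisson r \<rho> t)"
      by (simp add: disc_poisson_def w_def)
    moreover have "h w * k w / (w - of_real \<rho>) * (2 * of_real pi * \<i> * w) / (2 * of_real pi * \<i>)
        = (k w * w / (w - of_real \<rho>)) * h w"
      using w0(2) by (simp add: divide_simps)
    ultimately show "h (circlepath 0 r t) * k (circlepath 0 r t) / (circlepath 0 r t - of_real \<rho>)
        * vector_derivative (circlepath 0 r) (at t within {0..1}) / (2 * of_real pi * \<i>)
        = of_real (disc_poisson r \<rho> t) * h (of_real r * circle_point t)"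
      by (simp only: w vd w_def)
  qed
qed

lemma disc_poisson_mass:
  assumes "0 \<le> \<rho>" "\<rho> < r"
  shows "(\<integral>\<^sup>+t. ennreal (disc_poisson r \<rho> t) * indicator {0..1} t \<partial>lborel) = 1"
proof -
  have "((\<lambda>t. of_real (disc_poisson r \<rho> t) * 1) has_integral (1::complex)) {0..1}"
    using assms by (intro poisson_formula_disc[of "\<lambda>_. 1" "r + 1"]) auto
  then have "((\<lambda>t. Re (of_real (disc_poisson r \<rho> t) * 1)) has_integral Re 1) {0..1}"
    by (rule has_integral_Re)
  then show ?thesis
    using nn_integral_has_integral_lebesgue'[of "{0..1}" "disc_poisson r \<rho>" 1] assms
    by (simp add: disc_poisson_nonneg)
qed

text \<open>The Poisson formula is applied to \<open>h\<^sup>2\<close>, which is holomorphic too; its modulus is then bounded by the triangle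
  inequality for integrals.\<close>

lemma norm_square_le_poisson_average:
  assumes h: "h holomorphic_on ball 0 R" and r: "0 \<le> \<rho>" "\<rho> < r" "r < R"
  shows "ennreal ((cmod (h (of_real \<rho>)))\<^sup>2)
    \<le> (\<integral>\<^sup>+t. ennreal (disc_poisson r \<rho> t) * indicator {0..1} t
        * ennreal ((cmod (h (of_real r * circle_point t)))\<^sup>2) \<partial>lborel)"
proof -
  let ?P = "disc_poisson r \<rho>" and ?w = "\<lambda>t. of_real r * circle_point t"
  have P_cont: "continuous_on {0..1} ?P"
  proof -
    have "cmod (?w t - of_real \<rho>) \<noteq> 0" for t
    proof
      assume "cmod (?w t - of_real \<rho>) = 0"
      then have "cmod (?w t) = cmod (of_real \<rho>)" by simp
      then show False using r by (simp add: norm_mult)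
    qed
    then show ?thesis unfolding disc_poisson_def by (intro continuous_intros) auto
  qed
  have "?w t \<in> ball 0 R" for t using r by (simp add: norm_mult)
  then have h_cont: "continuous_on {0..1} (\<lambda>t. h (?w t))"
    by (intro continuous_on_compose2[OF holomorphic_on_imp_continuous_on[OF h]] continuous_intros) auto
  have "(\<lambda>z. h z ^ 2) holomorphic_on ball 0 R" by (intro holomorphic_intros h)
  from poisson_formula_disc[OF this r]
  have int: "((\<lambda>t. of_real (?P t) * h (?w t) ^ 2) has_integral h (of_real \<rho>) ^ 2) {0..1}" .
  have "(\<lambda>t. ?P t * (cmod (h (?w t)))\<^sup>2) integrable_on {0..1}"
    by (intro integrable_continuous_real continuous_intros P_cont h_cont)
  then obtain I where I: "((\<lambda>t. ?P t * (cmod (h (?w t)))\<^sup>2) has_integral I) {0..1}" by blast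
  have "norm (integral {0..1} (\<lambda>t. of_real (?P t) * h (?w t) ^ 2))
      \<le> integral {0..1} (\<lambda>t. ?P t * (cmod (h (?w t)))\<^sup>2)"
    using int I disc_poisson_nonneg[OF r(1,2)]
    by (intro integral_norm_bound_integral) (auto simp: norm_mult norm_power)
  then have "ennreal ((cmod (h (of_real \<rho>)))\<^sup>2) \<le> ennreal I"
    unfolding integral_unique[OF int] integral_unique[OF I] by (intro ennreal_leI) (simp add: norm_power)
  also have "ennreal I = (\<integral>\<^sup>+t. ennreal (?P t * (cmod (h (?w t)))\<^sup>2) * indicator {0..1} t \<partial>lborel)"
    using disc_poisson_nonneg[OF r(1,2)]
    by (intro nn_integral_has_integral_lebesgue'[symmetric] I) simp
  also have "\<dots> = (\<integral>\<^sup>+t. ennreal (?P t) * indicator {0..1} t * ennreal ((cmod (h (?w t)))\<^sup>2) \<partial>lborel)"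
    by (intro nn_integral_cong) (simp add: ennreal_mult'' mult_ac)
  finally show ?thesis .
qed

lemma mean_value_nonneg_Re:
  assumes h: "h holomorphic_on ball 0 R" and r: "0 < r" "r < R"
    and nonneg: "\<And>z. z \<in> ball 0 R \<Longrightarrow> 0 \<le> Re (h z)"
  shows "(\<integral>\<^sup>+t. indicator {0..1} t * ennreal (Re (h (of_real r * circle_point t))) \<partial>lborel) = ennreal (Re (h 0))"
proof -
  have "disc_poisson r 0 t = 1" for t using r by (simp add: disc_poisson_def norm_mult)
  then have "((\<lambda>t. h (of_real r * circle_point t)) has_integral h 0) {0..1}"
    using poisson_formula_disc[OF h order_refl r] by simp
  from has_integral_Re[OF this]
  have "((\<lambda>t. Re (h (of_real r * circle_point t))) has_integral Re (h 0)) {0..1}" .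
  from nn_integral_has_integral_lebesgue'[OF _ this] show ?thesis
    using nonneg r by (simp add: norm_mult mult.commute)
qed

section \<open>Radial limits on the boundary of a circular domain\<close>

lemma scaleR_eq_smult: "r *\<^sub>R (z :: complex ^ 'n) = of_real r *s z"
  by (simp add: vec_eq_iff scaleR_conv_of_real[where 'a = complex])

lemma bounded_linear_smult_left: "bounded_linear (\<lambda>c. c *s (z :: complex ^ 'n))"
  by (intro linear_conv_bounded_linear[THEN iffD1] linearI)
     (simp_all add: vec_eq_iff algebra_simps)

lemma bounded_linear_smult_right: "bounded_linear (\<lambda>z :: complex ^ 'n. c *s z)"
  by (intro linear_conv_bounded_linear[THEN iffD1] linearI)
     (simp_all add: vec_eq_iff algebra_simps)

lemma continuous_on_smult [continuous_intros]:
  fixes f :: "'a::topological_space \<Rightarrow> complex" and g :: "'a \<Rightarrow> complex ^ 'n"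
  assumes "continuous_on S f" "continuous_on S g"
  shows "continuous_on S (\<lambda>x. f x *s g x)"
  unfolding vector_scalar_mult_def using assms by (intro continuous_intros)

lemma continuous_on_mv_holomorphic: "f mv_holomorphic_on D \<Longrightarrow> continuous_on D f"
  unfolding mv_holomorphic_on_def
  by (metis continuous_at_imp_continuous_on has_derivative_continuous)

text \<open>The Cauchy criterion with countable quantifiers in front; it makes the set of radial
  convergence a Borel set.\<close>

lemma limit_at_left_1_iff_Cauchy:
  fixes g :: "real \<Rightarrow> complex"
  shows "(\<exists>l. (g \<longlongrightarrow> l) (at_left 1)) \<longleftrightarrow>
    (\<forall>k::nat. \<exists>m::nat. \<forall>x\<in>{1 - 1 / (real m + 2)..<1}. \<forall>y\<in>{1 - 1 / (real m + 2)..<1}.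
       dist (g x) (g y) \<le> 1 / (real k + 1))" (is "?L \<longleftrightarrow> ?R")
proof
  assume ?L
  then obtain l where l: "(g \<longlongrightarrow> l) (at_left 1)" ..
  show ?R
  proof
    fix k :: nat
    have "\<forall>\<^sub>F x in at_left 1. dist (g x) l < 1 / (real k + 1) / 2"
      using l by (intro tendstoD) auto
    then obtain b where b: "b < 1" "\<And>x. b < x \<Longrightarrow> x < 1 \<Longrightarrow> dist (g x) l < 1 / (real k + 1) / 2"
      unfolding eventually_at_left_field by blast
    obtain m :: nat where "inverse (real (Suc m)) < 1 - b"
      using reals_Archimedean[of "1 - b"] b(1) by auto
    moreover have "1 / (real m + 2) < inverse (real (Suc m))" by (simp add: field_simps)
    ultimately have m: "b < 1 - 1 / (real m + 2)" by linarith
    show "\<exists>m::nat. \<forall>x\<in>{1 - 1 / (real m + 2)..<1}. \<forall>y\<in>{1 - 1 / (real m + 2)..<1}.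
       dist (g x) (g y) \<le> 1 / (real k + 1)"
    proof (intro exI[of _ m] ballI)
      fix x y assume "x \<in> {1 - 1 / (real m + 2)..<1}" "y \<in> {1 - 1 / (real m + 2)..<1}"
      then have "dist (g x) l < 1 / (real k + 1) / 2" "dist (g y) l < 1 / (real k + 1) / 2"
        using m by (intro b(2); simp)+
      then show "dist (g x) (g y) \<le> 1 / (real k + 1)"
        using dist_triangle2[of "g x" "g y" l] by linarith
    qed
  qed
next
  assume R: ?R
  define x where "x n = 1 - 1 / (real n + 2)" for n
  have x_in: "x n \<in> {1 - 1 / (real m + 2)..<1}" if "m \<le> n" for m n
    using that by (auto simp: x_def field_simps)
  have small: "\<exists>k::nat. 1 / (real k + 1) < e" if "0 < e" for e
    using reals_Archimedean[OF that] by (auto simp: inverse_eq_divide add.commute)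
  have "Cauchy (\<lambda>n. g (x n))"
  proof (rule metric_CauchyI)
    fix e :: real assume "0 < e"
    then obtain k :: nat where k: "1 / (real k + 1) < e" using small by blast
    obtain m :: nat where m: "\<And>x y. x \<in> {1 - 1 / (real m + 2)..<1} \<Longrightarrow> y \<in> {1 - 1 / (real m + 2)..<1} \<Longrightarrow>
        dist (g x) (g y) \<le> 1 / (real k + 1)" using R[rule_format, of k] by blast
    show "\<exists>M. \<forall>i\<ge>M. \<forall>j\<ge>M. dist (g (x i)) (g (x j)) < e"
      using m[OF x_in x_in] k by (intro exI[of _ m]) (auto intro: le_less_trans)
  qed
  then obtain l where l: "(\<lambda>n. g (x n)) \<longlonglongrightarrow> l"
    using Cauchy_convergent unfolding convergent_def by blast
  have "(g \<longlongrightarrow> l) (at_left 1)"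
  proof (rule tendstoI)
    fix e :: real assume "0 < e"
    then obtain k :: nat where k: "1 / (real k + 1) < e / 2" using small[of "e / 2"] by auto
    obtain m :: nat where m: "\<And>x y. x \<in> {1 - 1 / (real m + 2)..<1} \<Longrightarrow> y \<in> {1 - 1 / (real m + 2)..<1} \<Longrightarrow>
        dist (g x) (g y) \<le> 1 / (real k + 1)" using R[rule_format, of k] by blast
    have "\<forall>\<^sub>F n in sequentially. dist (g (x n)) l < e / 2" using l \<open>0 < e\<close> by (intro tendstoD) auto
    then obtain n where n: "m \<le> n" "dist (g (x n)) l < e / 2"
      using eventually_conj[OF eventually_ge_at_top[of m]] eventually_happens' sequentially_bot by blast
    have "1 - 1 / (real m + 2) < (1::real)" by simp
    from eventually_at_left_real[OF this]
    show "\<forall>\<^sub>F y in at_left 1. dist (g y) l < e"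
    proof eventually_elim
      case (elim y)
      then have "dist (g y) (g (x n)) \<le> 1 / (real k + 1)" using x_in[OF n(1)] by (intro m) auto
      then show ?case using k n(2) dist_triangle[of "g y" l "g (x n)"] by linarith
    qed
  qed
  then show ?L ..
qed

text \<open>A sequence of radii in \<open>(0, 1)\<close> along which radial limits are computed, so that convergence
  theorems for sequences of integrals apply.\<close>

definition radius :: "nat \<Rightarrow> real" where "radius n = 1 - 1 / (real n + 2)"

lemma radius: "0 < radius n" "0 \<le> radius n" "radius n < 1" by (simp_all add: radius_def field_simps)

lemma radius_tendsto: "radius \<longlonglongrightarrow> 1" unfolding radius_def by real_asymp

lemma radius_at_left: "filterlim radius (at_left 1) sequentially"
  unfolding filterlim_at using radius radius_tendsto
  by (auto intro!: always_eventually) (metis less_irrefl radius(3))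

lemma radial_limit_eq: "has_radial_limit f \<zeta> l \<Longrightarrow> radial_limit f \<zeta> = l"
  unfolding has_radial_limit_def radial_limit_def
  by (rule tendsto_Lim[OF trivial_limit_at_left_real])

locale circular_domain =
  fixes D :: "(complex ^ 'n) set"
  assumes open_D: "open D" and convex_D: "convex D" and circular_D: "circular D" and nonempty_D: "D \<noteq> {}"
begin

lemma zero_in_D: "0 \<in> D"
proof -
  obtain z where z: "z \<in> D" using nonempty_D by blast
  then have "(-1) *s z \<in> D" using circular_D unfolding circular_def by (metis norm_minus_cancel norm_one)
  from convexD[OF convex_D z this, of "1/2" "1/2"] show ?thesis by (simp add: vec_eq_iff zero_vec_def)
qed

lemma rotate_closure: "\<zeta> \<in> closure D \<Longrightarrow> cmod c = 1 \<Longrightarrow> c *s \<zeta> \<in> closure D"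
  using image_closure_subset[of D "\<lambda>z. c *s z" "closure D"] circular_D closure_subset
  by (force simp: circular_def intro!: continuous_intros)

text \<open>Every point of the half-open segment from the interior point \<open>0\<close> to a point of the closure of a
  convex set is interior.\<close>

lemma scale_in_D:
  assumes "\<zeta> \<in> closure D" "cmod c < 1"
  shows "c *s \<zeta> \<in> D"
proof (cases "c = 0")
  case True
  then show ?thesis using zero_in_D by (simp add: vec_eq_iff zero_vec_def)
next
  case False
  define u where "u = c / of_real (cmod c)"
  have u: "cmod u = 1" using False by (simp add: u_def norm_divide)
  have "u *s \<zeta> - (1 - cmod c) *\<^sub>R (u *s \<zeta> - 0) \<in> interior D"
    using assms False zero_in_D open_D
    by (intro mem_interior_closure_convex_shrink[OF convex_D _ rotate_closure[OF assms(1) u]])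
       (auto simp: interior_open)
  also have "u *s \<zeta> - (1 - cmod c) *\<^sub>R (u *s \<zeta> - 0) = c *s \<zeta>"
    using False by (simp add: vec_eq_iff u_def scaleR_conv_of_real[where 'a = complex] field_simps)
  finally show ?thesis using interior_subset by blast
qed

lemma scaleR_in_D: "\<zeta> \<in> closure D \<Longrightarrow> 0 \<le> r \<Longrightarrow> r < 1 \<Longrightarrow> r *\<^sub>R \<zeta> \<in> D"
  using scale_in_D[of \<zeta> "of_real r"] by (simp add: scaleR_eq_smult)

text \<open>The slice through \<open>\<zeta>\<close>: complex linearity of the derivative of \<open>f\<close> makes its restriction to a
  complex line holomorphic in the usual sense.\<close>

lemma slice_holomorphic:
  assumes f: "f mv_holomorphic_on D" and "\<zeta> \<in> closure D"
  shows "(\<lambda>c. f (c *s \<zeta>)) holomorphic_on ball 0 1"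
proof (rule holomorphic_onI)
  fix c :: complex assume "c \<in> ball 0 1"
  then have "c *s \<zeta> \<in> D" using assms by (intro scale_in_D) auto
  then obtain L where L: "(f has_derivative L) (at (c *s \<zeta>))" "\<And>a v. L (a *s v) = a * L v"
    using f unfolding mv_holomorphic_on_def by blast
  have "((\<lambda>c. f (c *s \<zeta>)) has_derivative (\<lambda>h. L (h *s \<zeta>))) (at c)"
    by (rule has_derivative_compose[OF bounded_linear_imp_has_derivative[OF bounded_linear_smult_left] L(1)])
  then have "((\<lambda>c. f (c *s \<zeta>)) has_field_derivative L \<zeta>) (at c)"
    unfolding has_field_derivative_def by (simp add: L(2) mult_commute_abs)
  then show "(\<lambda>c. f (c *s \<zeta>)) field_differentiable at c within ball 0 1"
    by (metis field_differentiable_at_within field_differentiable_def)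
qed

end

locale circular_domain_boundary = circular_domain D for D :: "(complex ^ 'n) set" +
  fixes B :: "(complex ^ 'n) set" and \<beta> :: "(complex ^ 'n) measure"
  assumes compact_B: "compact B" and B_closure: "B \<subseteq> closure D"
    and rotate_B: "\<And>c \<zeta>. cmod c = 1 \<Longrightarrow> \<zeta> \<in> B \<Longrightarrow> c *s \<zeta> \<in> B"
    and sets_\<beta>: "sets \<beta> = sets (restrict_space borel B)" and finite_\<beta>: "finite_measure \<beta>"
    and prob_\<beta>: "emeasure \<beta> B = 1"
    and rotate_\<beta>: "\<And>c. cmod c = 1 \<Longrightarrow> distr \<beta> \<beta> (\<lambda>z. c *s z) = \<beta>"
begin

sublocale finite_measure \<beta> by (rule finite_\<beta>)

lemma space_\<beta>: "space \<beta> = B"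
  using sets_eq_imp_space_eq[OF sets_\<beta>] by (simp add: space_restrict_space)

lemma B_borel: "B \<in> sets borel" using compact_B by (rule borel_compact)

lemma measurable_into_\<beta>:
  assumes "f \<in> borel_measurable M" "\<And>x. x \<in> space M \<Longrightarrow> f x \<in> B"
  shows "f \<in> measurable M \<beta>"
  unfolding measurable_cong_sets[OF refl sets_\<beta>] using assms by (intro measurable_restrict_space2) auto

lemma continuous_imp_measurable: "continuous_on B f \<Longrightarrow> f \<in> borel_measurable \<beta>"
  unfolding measurable_cong_sets[OF sets_\<beta> refl] by (rule borel_measurable_continuous_on_restrict)

lemma closed_in_\<beta>: "closed A \<Longrightarrow> A \<subseteq> B \<Longrightarrow> A \<in> sets \<beta>"
  unfolding sets_\<beta> using B_borel by (simp add: sets_restrict_space_iff)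

lemma continuous_on_scaled:
  assumes "f mv_holomorphic_on D" "0 \<le> r" "r < 1"
  shows "continuous_on B (\<lambda>\<zeta>. f (r *\<^sub>R \<zeta>))"
  using assms B_closure
  by (intro continuous_on_compose2[OF continuous_on_mv_holomorphic] continuous_intros)
     (auto intro: scaleR_in_D)

text \<open>Fubini's theorem and the rotation invariance of \<open>\<beta>\<close>: averaging \<open>u\<close> over circles with any weight
  only multiplies its integral by the mass of the weight. It transfers statements about
  discs to \<open>B\<close>.\<close>

lemma circle_average:
  fixes u :: "complex ^ 'n \<Rightarrow> ennreal" and k :: "real \<Rightarrow> ennreal"
  assumes u [measurable]: "u \<in> borel_measurable \<beta>" and k [measurable]: "k \<in> borel_measurable borel"
  shows "(\<integral>\<^sup>+\<zeta>. (\<integral>\<^sup>+t. k t * u (circle_point t *s \<zeta>) \<partial>lborel) \<partial>\<beta>)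
    = (\<integral>\<^sup>+t. k t \<partial>lborel) * (\<integral>\<^sup>+\<zeta>. u \<zeta> \<partial>\<beta>)"
proof -
  interpret pair_sigma_finite lborel \<beta>
    by (simp add: pair_sigma_finite_def sigma_finite_measure_axioms lborel.sigma_finite_measure_axioms)
  have id_meas: "(\<lambda>x. x) \<in> measurable \<beta> borel"
    by (rule continuous_imp_measurable) (rule continuous_on_id)
  have "(\<lambda>z. circle_point (fst z) *s snd z) \<in> borel_measurable (borel \<Otimes>\<^sub>M borel :: (real \<times> (complex ^ 'n)) measure)"
    unfolding borel_prod
    by (intro borel_measurable_continuous_onI continuous_intros
        continuous_on_compose2[OF continuous_on_circle_point[of UNIV]]) auto
  note product = this
  have "(\<lambda>z. (fst z, snd z)) \<in> measurable (lborel \<Otimes>\<^sub>M \<beta>) (borel \<Otimes>\<^sub>M borel)"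
    by (intro measurable_Pair measurable_compose[OF measurable_snd id_meas]) simp
  from measurable_compose[OF this product]
  have "(\<lambda>z. circle_point (fst z) *s snd z) \<in> borel_measurable (lborel \<Otimes>\<^sub>M \<beta>)" by simp
  then have [measurable]: "(\<lambda>z. circle_point (fst z) *s snd z) \<in> measurable (lborel \<Otimes>\<^sub>M \<beta>) \<beta>"
    by (rule measurable_into_\<beta>) (auto simp: space_pair_measure space_\<beta> rotate_B)
  have "(\<lambda>z. k (fst z) * u (circle_point (fst z) *s snd z)) \<in> borel_measurable (lborel \<Otimes>\<^sub>M \<beta>)"
    by measurable
  then have "(\<lambda>(t, \<zeta>). k t * u (circle_point t *s \<zeta>)) \<in> borel_measurable (lborel \<Otimes>\<^sub>M \<beta>)"
    by (simp add: split_beta')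
  from Fubini'[OF this]
  have "(\<integral>\<^sup>+\<zeta>. (\<integral>\<^sup>+t. k t * u (circle_point t *s \<zeta>) \<partial>lborel) \<partial>\<beta>)
      = (\<integral>\<^sup>+t. (\<integral>\<^sup>+\<zeta>. k t * u (circle_point t *s \<zeta>) \<partial>\<beta>) \<partial>lborel)" .
  also have "\<dots> = (\<integral>\<^sup>+t. k t * (\<integral>\<^sup>+\<zeta>. u \<zeta> \<partial>\<beta>) \<partial>lborel)"
  proof (rule nn_integral_cong)
    fix t :: real
    have rot: "(\<lambda>z. circle_point t *s z) \<in> measurable \<beta> \<beta>"
      by (intro measurable_into_\<beta> continuous_imp_measurable continuous_intros) (simp add: rotate_B space_\<beta>)
    have "(\<integral>\<^sup>+\<zeta>. k t * u (circle_point t *s \<zeta>) \<partial>\<beta>) = k t * (\<integral>\<^sup>+\<zeta>. u (circle_point t *s \<zeta>) \<partial>\<beta>)"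
      by (rule nn_integral_cmult) (rule measurable_compose[OF rot u])
    also have "(\<integral>\<^sup>+\<zeta>. u (circle_point t *s \<zeta>) \<partial>\<beta>) = (\<integral>\<^sup>+\<zeta>. u \<zeta> \<partial>distr \<beta> \<beta> (\<lambda>z. circle_point t *s z))"
      by (subst nn_integral_distr[OF rot]) (simp_all add: u)
    finally show "(\<integral>\<^sup>+\<zeta>. k t * u (circle_point t *s \<zeta>) \<partial>\<beta>) = k t * (\<integral>\<^sup>+\<zeta>. u \<zeta> \<partial>\<beta>)"
      by (simp add: rotate_\<beta>)
  qed
  also have "\<dots> = (\<integral>\<^sup>+t. k t \<partial>lborel) * (\<integral>\<^sup>+\<zeta>. u \<zeta> \<partial>\<beta>)" by (rule nn_integral_multc) simp
  finally show ?thesis .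
qed

lemma null_set_of_null_circles:
  assumes N [measurable]: "N \<in> sets \<beta>"
    and null: "\<And>\<zeta>. \<zeta> \<in> B \<Longrightarrow> AE t in lborel. circle_point t *s \<zeta> \<notin> N"
  shows "N \<in> null_sets \<beta>"
proof -
  have "(\<integral>\<^sup>+\<zeta>. (\<integral>\<^sup>+t. indicator {0..1} t * indicator N (circle_point t *s \<zeta>) \<partial>lborel) \<partial>\<beta>) = (\<integral>\<^sup>+\<zeta>. 0 \<partial>\<beta>)"
  proof (rule nn_integral_cong)
    fix \<zeta> assume "\<zeta> \<in> space \<beta>"
    then have "AE t in lborel. circle_point t *s \<zeta> \<notin> N" using null by (simp add: space_\<beta>)
    then have "(\<integral>\<^sup>+t. indicator {0..1} t * indicator N (circle_point t *s \<zeta>) \<partial>lborel) = (\<integral>\<^sup>+t. (0::ennreal) \<partial>(lborel::real measure))"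
      by (intro nn_integral_cong_AE) (auto elim!: eventually_mono)
    then show "(\<integral>\<^sup>+t. indicator {0..1} t * indicator N (circle_point t *s \<zeta>) \<partial>lborel) = (0::ennreal)" by simp
  qed
  then have "emeasure \<beta> N = 0" using circle_average[of "indicator N" "indicator {0..1}"] by simp
  then show ?thesis by (auto simp: null_sets_def)
qed

text \<open>By the Cauchy criterion the set is built by countable operations from sets that are
  closed, as arbitrary intersections of closed conditions on \<open>\<zeta>\<close> that involve only points
  \<open>x \<zeta>\<close>, \<open>y \<zeta>\<close> inside \<open>D\<close>.\<close>

lemma radial_convergence_set: "{\<zeta> \<in> B. \<exists>l. has_radial_limit \<phi> \<zeta> l} \<in> sets \<beta>"
  if \<phi>: "\<phi> mv_holomorphic_on D"
proof -
  let ?I = "\<lambda>m::nat. {1 - 1 / (real m + 2)..<1}"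
  let ?G = "\<lambda>(k::nat) m. {\<zeta> \<in> B. \<forall>x\<in>?I m. \<forall>y\<in>?I m. dist (\<phi> (x *\<^sub>R \<zeta>)) (\<phi> (y *\<^sub>R \<zeta>)) \<le> 1 / (real k + 1)}"
  have "?G k m \<in> sets \<beta>" for k m
  proof (rule closed_in_\<beta>)
    have "closed (B \<inter> (\<lambda>\<zeta>. dist (\<phi> (x *\<^sub>R \<zeta>)) (\<phi> (y *\<^sub>R \<zeta>))) -` {..1 / (real k + 1)})"
      if "x \<in> ?I m" "y \<in> ?I m" for x y
    proof -
      have "0 \<le> 1 - 1 / (real m + 2)" by (simp add: field_simps)
      then have "0 \<le> x" "0 \<le> y" "x < 1" "y < 1" using that by (simp_all only: atLeastLessThan_iff) linarith+
      then show ?thesis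
        using compact_B
        by (intro continuous_closed_preimage continuous_intros continuous_on_scaled \<phi>)
           (auto intro: compact_imp_closed)
    qed
    then have "closed (\<Inter>x\<in>?I m. \<Inter>y\<in>?I m. B \<inter> (\<lambda>\<zeta>. dist (\<phi> (x *\<^sub>R \<zeta>)) (\<phi> (y *\<^sub>R \<zeta>))) -` {..1 / (real k + 1)})"
      by (rule closed_INT[OF ballI[OF closed_INT[OF ballI]]])
    from closed_Int[OF compact_imp_closed[OF compact_B] this]
    have "closed (B \<inter> (\<Inter>x\<in>?I m. \<Inter>y\<in>?I m. B \<inter> (\<lambda>\<zeta>. dist (\<phi> (x *\<^sub>R \<zeta>)) (\<phi> (y *\<^sub>R \<zeta>))) -` {..1 / (real k + 1)}))" .
    also have "B \<inter> (\<Inter>x\<in>?I m. \<Inter>y\<in>?I m. B \<inter> (\<lambda>\<zeta>. dist (\<phi> (x *\<^sub>R \<zeta>)) (\<phi> (y *\<^sub>R \<zeta>))) -` {..1 / (real k + 1)}) = ?G k m"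
      by auto
    finally show "closed (?G k m)" .
  qed auto
  then have "B \<inter> (\<Inter>k. \<Union>m. ?G k m) \<in> sets \<beta>"
    using sets.top[of \<beta>] by (intro sets.Int sets.countable_INT' sets.countable_UN) (auto simp: space_\<beta>)
  also have "B \<inter> (\<Inter>k. \<Union>m. ?G k m) = {\<zeta> \<in> B. \<exists>l. has_radial_limit \<phi> \<zeta> l}"
    unfolding has_radial_limit_def limit_at_left_1_iff_Cauchy by auto
  finally show ?thesis .
qed

text \<open>Where the limit does not exist, \<^const>\<open>radial_limit\<close> is the default value of the description
  operator, which does not depend on \<open>\<zeta>\<close>; the rest is a limit along a sequence of radii.\<close>

lemma radial_limit_measurable:
  assumes \<phi>: "\<phi> mv_holomorphic_on D"
  shows "radial_limit \<phi> \<in> borel_measurable \<beta>"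
proof -
  let ?C = "{\<zeta> \<in> B. \<exists>l. has_radial_limit \<phi> \<zeta> l}"
  let ?g = "\<lambda>\<zeta>. lim (\<lambda>n. \<phi> (radius n *\<^sub>R \<zeta>))"
  \<comment> \<open>The value of \<^const>\<open>radial_limit\<close> where no limit exists.\<close>
  let ?junk = "THE l :: complex. False"
  have seq [measurable]: "(\<lambda>\<zeta>. \<phi> (radius n *\<^sub>R \<zeta>)) \<in> borel_measurable \<beta>" for n
    by (intro continuous_imp_measurable continuous_on_scaled \<phi> radius)
  have C [measurable]: "?C \<in> sets \<beta>" by (rule radial_convergence_set[OF \<phi>])
  have "(\<lambda>\<zeta>. if \<zeta> \<in> ?C then ?g \<zeta> else ?junk) \<in> borel_measurable \<beta>"
    by (intro measurable_If_set borel_measurable_lim_metric seq) (use C in simp_all)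
  moreover have "radial_limit \<phi> \<zeta> = (if \<zeta> \<in> ?C then ?g \<zeta> else ?junk)" if "\<zeta> \<in> space \<beta>" for \<zeta>
  proof (cases "\<zeta> \<in> ?C")
    case True
    then obtain l where l: "has_radial_limit \<phi> \<zeta> l" by blast
    then have "(\<lambda>n. \<phi> (radius n *\<^sub>R \<zeta>)) \<longlonglongrightarrow> l"
      unfolding has_radial_limit_def by (rule filterlim_compose[OF _ radius_at_left])
    then have "?g \<zeta> = l" by (rule limI)
    then show ?thesis using True radial_limit_eq[OF l] by simp
  next
    case False
    then have "\<not> has_radial_limit \<phi> \<zeta> l" for l using that by (auto simp: space_\<beta>)
    then have "(\<lambda>l. has_radial_limit \<phi> \<zeta> l) = (\<lambda>_. False)" by auto
    then have "radial_limit \<phi> \<zeta> = ?junk"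
      unfolding radial_limit_def Topological_Spaces.Lim_def has_radial_limit_def by simp
    then show ?thesis by (simp only: False if_False)
  qed
  ultimately show ?thesis by (subst measurable_cong) auto
qed

text \<open>On the disc through \<open>\<zeta>\<close> the substitution \<open>s \<mapsto> exp (2 \<pi> \<i> s)\<close> turns radial approach to a point of
  the circle into vertical approach to the real axis.\<close>

theorem AE_has_radial_limit:
  assumes \<phi>: "\<phi> mv_holomorphic_on D" and bound: "\<And>z. z \<in> D \<Longrightarrow> cmod (\<phi> z) \<le> M"
  shows "AE \<zeta> in \<beta>. has_radial_limit \<phi> \<zeta> (radial_limit \<phi> \<zeta>)"
proof -
  let ?C = "{\<zeta> \<in> B. \<exists>l. has_radial_limit \<phi> \<zeta> l}"
  have "B - ?C \<in> null_sets \<beta>"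
  proof (rule null_set_of_null_circles)
    show "B - ?C \<in> sets \<beta>" using radial_convergence_set[OF \<phi>] sets.compl_sets[of ?C \<beta>] by (simp add: space_\<beta>)
    fix \<zeta> assume \<zeta>: "\<zeta> \<in> B"
    define e where "e s = exp (2 * of_real pi * \<i> * s)" for s :: complex
    have e_less: "cmod (e s) < 1" if "0 < Im s" for s
      using that by (simp add: e_def norm_exp_eq_Re)
    obtain N where N: "negligible N" "\<And>t. t \<notin> N \<Longrightarrow>
        \<exists>l. ((\<lambda>y. \<phi> (e (of_real t + \<i> * of_real y) *s \<zeta>)) \<longlongrightarrow> l) (at_right 0)"
    proof (rule Fatou_upper_half_plane)
      have "(\<lambda>c. \<phi> (c *s \<zeta>)) holomorphic_on ball 0 1"
        using \<zeta> B_closure by (intro slice_holomorphic[OF \<phi>]) auto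
      moreover have "e holomorphic_on {z. 0 < Im z}" unfolding e_def by (intro holomorphic_intros)
      moreover have "e ` {z. 0 < Im z} \<subseteq> ball 0 1" using e_less by auto
      ultimately have "((\<lambda>c. \<phi> (c *s \<zeta>)) \<circ> e) holomorphic_on {z. 0 < Im z}"
        using holomorphic_on_compose_gen by blast
      then show "(\<lambda>s. \<phi> (e s *s \<zeta>)) holomorphic_on {z. 0 < Im z}" by (simp add: o_def)
      show "cmod (\<phi> (e s *s \<zeta>)) \<le> M" if "0 < Im s" for s
        using \<zeta> B_closure by (intro bound scale_in_D e_less that) auto
    qed blast
    have "AE t in lborel. t \<notin> N"
      using AE_not_in[of N lebesgue] N(1) by (simp add: negligible_iff_null_sets AE_completion_iff)
    then show "AE t in lborel. circle_point t *s \<zeta> \<notin> B - ?C"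
    proof eventually_elim
      case (elim t)
      from N(2)[OF elim] obtain l where
        l: "((\<lambda>y. \<phi> (e (of_real t + \<i> * of_real y) *s \<zeta>)) \<longlongrightarrow> l) (at_right 0)" by blast
      have "filterlim (\<lambda>\<rho>::real. - ln \<rho> / (2 * pi)) (at_right 0) (at_left 1)" by real_asymp
      from filterlim_compose[OF l this]
      have "((\<lambda>\<rho>. \<phi> (e (of_real t + \<i> * of_real (- ln \<rho> / (2 * pi))) *s \<zeta>)) \<longlongrightarrow> l) (at_left 1)" .
      moreover have "\<forall>\<^sub>F \<rho> in at_left 1. \<phi> (e (of_real t + \<i> * of_real (- ln \<rho> / (2 * pi))) *s \<zeta>)
          = \<phi> (\<rho> *\<^sub>R (circle_point t *s \<zeta>))"
        using eventually_at_left_real[OF zero_less_one]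
      proof eventually_elim
        case (elim \<rho>)
        have "2 * of_real pi * \<i> * (of_real t + \<i> * of_real (- ln \<rho> / (2 * pi)))
            = 2 * of_real pi * \<i> * of_real t + of_real (ln \<rho>)"
          by (simp add: field_simps)
        then have "e (of_real t + \<i> * of_real (- ln \<rho> / (2 * pi))) = circle_point t * of_real \<rho>"
          using elim unfolding e_def by (simp add: exp_add circle_point_def exp_of_real)
        then show ?case by (simp add: scaleR_eq_smult vec_eq_iff mult_ac)
      qed
      ultimately have "has_radial_limit \<phi> (circle_point t *s \<zeta>) l"
        unfolding has_radial_limit_def by (rule Lim_transform_eventually)
      then show ?case by blast
    qed
  qed
  then have "AE \<zeta> in \<beta>. \<zeta> \<notin> B - ?C" by (rule AE_not_in)
  moreover have "AE \<zeta> in \<beta>. \<zeta> \<in> B" by (rule AE_I2) (simp add: space_\<beta>)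
  ultimately show ?thesis
  proof eventually_elim
    case (elim \<zeta>)
    then obtain l where "has_radial_limit \<phi> \<zeta> l" by blast
    then show ?case using radial_limit_eq by metis
  qed
qed

end

lemma Re_cayley:
  assumes "cmod \<alpha> = 1"
  shows "Re ((\<alpha> + w) / (\<alpha> - w)) = (1 - (cmod w)\<^sup>2) / (cmod (\<alpha> - w))\<^sup>2"
proof -
  have "Re ((\<alpha> + w) * cnj (\<alpha> - w)) = (cmod \<alpha>)\<^sup>2 - (cmod w)\<^sup>2"
    unfolding cmod_power2 by (simp add: algebra_simps power2_eq_square)
  then show ?thesis
    using assms unfolding complex_div_cnj[of "\<alpha> + w" "\<alpha> - w"] by (simp flip: of_real_power add: Re_divide_of_real)
qed

lemma mv_holomorphic_add:
  "f mv_holomorphic_on D \<Longrightarrow> g mv_holomorphic_on D \<Longrightarrow> (\<lambda>z. f z + g z) mv_holomorphic_on D"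
  unfolding mv_holomorphic_on_def
proof
  fix z assume "\<forall>z\<in>D. \<exists>L. (f has_derivative L) (at z) \<and> (\<forall>c v. L (c *s v) = c * L v)"
    "\<forall>z\<in>D. \<exists>L. (g has_derivative L) (at z) \<and> (\<forall>c v. L (c *s v) = c * L v)" "z \<in> D"
  then obtain L L' where "(f has_derivative L) (at z)" "\<forall>c v. L (c *s v) = c * L v"
    "(g has_derivative L') (at z)" "\<forall>c v. L' (c *s v) = c * L' v" by metis
  then show "\<exists>L. ((\<lambda>z. f z + g z) has_derivative L) (at z) \<and> (\<forall>c v. L (c *s v) = c * L v)"
    by (intro exI[of _ "\<lambda>v. L v + L' v"]) (auto intro: has_derivative_add simp: distrib_left)
qed

lemma mv_holomorphic_mult:
  "f mv_holomorphic_on D \<Longrightarrow> g mv_holomorphic_on D \<Longrightarrow> (\<lambda>z. f z * g z) mv_holomorphic_on D"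
  unfolding mv_holomorphic_on_def
proof
  fix z assume "\<forall>z\<in>D. \<exists>L. (f has_derivative L) (at z) \<and> (\<forall>c v. L (c *s v) = c * L v)"
    "\<forall>z\<in>D. \<exists>L. (g has_derivative L) (at z) \<and> (\<forall>c v. L (c *s v) = c * L v)" "z \<in> D"
  then obtain L L' where "(f has_derivative L) (at z)" "\<forall>c v. L (c *s v) = c * L v"
    "(g has_derivative L') (at z)" "\<forall>c v. L' (c *s v) = c * L' v" by metis
  then show "\<exists>L. ((\<lambda>z. f z * g z) has_derivative L) (at z) \<and> (\<forall>c v. L (c *s v) = c * L v)"
    by (intro exI[of _ "\<lambda>v. f z * L' v + L v * g z"] conjI has_derivative_mult)
      (auto simp: algebra_simps)
qed

lemma mv_holomorphic_const: "(\<lambda>_. c) mv_holomorphic_on D"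
  unfolding mv_holomorphic_on_def by (auto intro!: exI[of _ "\<lambda>_. 0"])

lemma mv_holomorphic_linear:
  assumes "bounded_linear f" "\<And>c v. f (c *s v) = c * f v"
  shows "f mv_holomorphic_on D"
  unfolding mv_holomorphic_on_def using assms bounded_linear_imp_has_derivative by blast

lemma mv_holomorphic_compose_linear:
  fixes T :: "complex ^ 'n \<Rightarrow> complex ^ 'n"
  assumes "f mv_holomorphic_on D" and T: "bounded_linear T" "\<And>c v. T (c *s v) = c *s T v" "T ` D \<subseteq> D"
  shows "(\<lambda>z. f (T z)) mv_holomorphic_on D"
  unfolding mv_holomorphic_on_def
proof
  fix z assume "z \<in> D"
  then have "T z \<in> D" using T(3) by blast
  then obtain L where L: "(f has_derivative L) (at (T z))" "\<forall>c v. L (c *s v) = c * L v"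
    using assms(1) unfolding mv_holomorphic_on_def by blast
  show "\<exists>L. ((\<lambda>z. f (T z)) has_derivative L) (at z) \<and> (\<forall>c v. L (c *s v) = c * L v)"
    using has_derivative_compose[OF bounded_linear_imp_has_derivative[OF T(1)] L(1)] L(2) T(2)
    by (intro exI[of _ "\<lambda>v. L (T v)"]) auto
qed

text \<open>The polarization identity in \<open>\<complex>\<close>, in the form in which it defines the Hardy inner product.\<close>

lemma polarization:
  "(\<Sum>k<4. \<i> ^ k * of_real ((cmod (a + \<i> ^ k * b))\<^sup>2)) / 4 = a * cnj b"
  by (simp add: eval_nat_numeral complex_eq_iff cmod_power2[unfolded power2_eq_square] power2_eq_square field_simps)

context circular_domain_boundary
begin

text \<open>With \<open>F = (\<alpha> + \<phi>) / (\<alpha> - \<phi>)\<close> of positive real part, \<open>g = \<surd>F\<close> has argument at most \<open>\<pi>/4\<close> in modulus, so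
  \<open>\<surd>(|F| / 2) \<le> Re g\<close>. The means of the harmonic function \<open>Re g\<close> over \<open>\<rho>B\<close> all equal \<open>Re g(0)\<close>, so by
  Fatou's lemma \<open>Re g\<close> cannot tend to infinity along radii on a set of positive measure, as it would
  where \<open>\<phi>\<^sub>1 = \<alpha>\<close>.\<close>

lemma AE_radial_limit_neq:
  assumes \<phi>: "\<phi> mv_holomorphic_on D" "\<phi> ` D \<subseteq> ball 0 1" and \<alpha>: "cmod \<alpha> = 1"
  shows "AE \<zeta> in \<beta>. radial_limit \<phi> \<zeta> \<noteq> \<alpha>"
proof -
  define F where "F z = (\<alpha> + \<phi> z) / (\<alpha> - \<phi> z)" for z
  define g where "g z = csqrt (F z)" for z
  have \<phi>_less: "cmod (\<phi> z) < 1" if "z \<in> D" for z using \<phi>(2) that by auto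
  have ne: "\<alpha> - \<phi> z \<noteq> 0" if "z \<in> D" for z using \<phi>_less[OF that] \<alpha> by auto
  have F_pos: "0 < Re (F z)" if "z \<in> D" for z
    unfolding F_def Re_cayley[OF \<alpha>] using \<phi>_less[OF that] ne[OF that]
    by (intro divide_pos_pos) (auto simp: power_less_one_iff)
  have g_nonneg: "0 \<le> Re (g z)" for z
    using abs_Re_le_cmod[of "F z"] by (simp add: g_def abs_le_iff)
  have g_lower: "sqrt (cmod (F z) / 2) \<le> Re (g z)" if "z \<in> D" for z
  proof -
    have sq: "g z ^ 2 = F z" by (simp add: g_def)
    then have "(Re (g z))\<^sup>2 - (Im (g z))\<^sup>2 > 0"
      using F_pos[OF that] by (simp add: Re_power2 flip: sq)
    moreover have "cmod (F z) = (Re (g z))\<^sup>2 + (Im (g z))\<^sup>2"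
      by (simp add: norm_power cmod_power2 flip: sq)
    ultimately have "cmod (F z) / 2 \<le> (Re (g z))\<^sup>2" by simp
    then show ?thesis using g_nonneg[of z] by (intro real_le_lsqrt) auto
  qed
  have slice: "(\<lambda>c. g (c *s \<zeta>)) holomorphic_on ball 0 1" if "\<zeta> \<in> B" for \<zeta>
  proof -
    have inD: "c *s \<zeta> \<in> D" if "c \<in> ball 0 1" for c
      using that \<open>\<zeta> \<in> B\<close> B_closure by (intro scale_in_D) auto
    have sl: "(\<lambda>c. \<phi> (c *s \<zeta>)) holomorphic_on ball 0 1"
      using that B_closure by (intro slice_holomorphic[OF \<phi>(1)]) auto
    have "F (c *s \<zeta>) \<notin> \<real>\<^sub>\<le>\<^sub>0" if "c \<in> ball 0 1" for c
      using F_pos[OF inD[OF that]] by (auto simp: complex_nonpos_Reals_iff)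
    then show ?thesis
      unfolding g_def using ne[OF inD]
      by (intro holomorphic_on_csqrt') (auto simp: F_def intro!: holomorphic_intros sl)
  qed
  have g_meas: "(\<lambda>\<zeta>. ennreal (Re (g (r *\<^sub>R \<zeta>)))) \<in> borel_measurable \<beta>" if r: "0 \<le> r" "r < 1" for r
  proof -
    have "(\<lambda>\<zeta>. \<phi> (r *\<^sub>R \<zeta>)) \<in> borel_measurable \<beta>"
      by (intro continuous_imp_measurable continuous_on_scaled \<phi>(1) r)
    then show ?thesis unfolding g_def F_def csqrt.sel by measurable
  qed
  have int_g: "(\<integral>\<^sup>+\<zeta>. ennreal (Re (g (r *\<^sub>R \<zeta>))) \<partial>\<beta>) = ennreal (Re (g 0))" if r: "0 < r" "r < 1" for r
  proof -
    have "(\<integral>\<^sup>+\<zeta>. (\<integral>\<^sup>+t. indicator {0..1} t * ennreal (Re (g (r *\<^sub>R (circle_point t *s \<zeta>)))) \<partial>lborel) \<partial>\<beta>)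
        = (\<integral>\<^sup>+\<zeta>. ennreal (Re (g 0)) \<partial>\<beta>)"
    proof (rule nn_integral_cong)
      fix \<zeta> assume "\<zeta> \<in> space \<beta>"
      then have \<zeta>: "\<zeta> \<in> B" by (simp add: space_\<beta>)
      have "r *\<^sub>R (circle_point t *s \<zeta>) = (of_real r * circle_point t) *s \<zeta>" for t
        by (simp add: scaleR_eq_smult vec_eq_iff)
      then show "(\<integral>\<^sup>+t. indicator {0..1} t * ennreal (Re (g (r *\<^sub>R (circle_point t *s \<zeta>)))) \<partial>lborel) = ennreal (Re (g 0))"
        using mean_value_nonneg_Re[OF slice[OF \<zeta>] r] g_nonneg by simp
    qed
    also have "\<dots> = ennreal (Re (g 0))" by (simp add: space_\<beta> prob_\<beta>)
    finally show ?thesis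
      using circle_average[OF g_meas, of r "indicator {0..1}"] r by simp
  qed
  let ?u = "\<lambda>n \<zeta>. ennreal (Re (g (radius n *\<^sub>R \<zeta>)))"
  have u_meas: "?u n \<in> borel_measurable \<beta>" for n using g_meas radius by simp
  have "(\<integral>\<^sup>+\<zeta>. liminf (\<lambda>n. ?u n \<zeta>) \<partial>\<beta>) \<le> liminf (\<lambda>n. \<integral>\<^sup>+\<zeta>. ?u n \<zeta> \<partial>\<beta>)"
    by (rule nn_integral_liminf[OF u_meas])
  also have "\<dots> = ennreal (Re (g 0))" using int_g radius by (simp add: Liminf_const)
  finally have "(\<integral>\<^sup>+\<zeta>. liminf (\<lambda>n. ?u n \<zeta>) \<partial>\<beta>) \<noteq> \<infinity>" using ennreal_less_top by (metis infinity_ennreal_def leD)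
  then have "AE \<zeta> in \<beta>. liminf (\<lambda>n. ?u n \<zeta>) \<noteq> \<infinity>"
    by (intro nn_integral_PInf_AE borel_measurable_liminf u_meas)
  moreover have "AE \<zeta> in \<beta>. has_radial_limit \<phi> \<zeta> (radial_limit \<phi> \<zeta>)"
    using \<phi>_less by (intro AE_has_radial_limit[OF \<phi>(1), of 1]) (simp add: less_imp_le)
  moreover have "AE \<zeta> in \<beta>. \<zeta> \<in> B" by (rule AE_I2) (simp add: space_\<beta>)
  ultimately show ?thesis
  proof eventually_elim
    case (elim \<zeta>)
    have inD: "radius n *\<^sub>R \<zeta> \<in> D" for n using elim(3) B_closure radius by (intro scaleR_in_D) auto
    show ?case
    proof
      assume eq: "radial_limit \<phi> \<zeta> = \<alpha>"
      have lim: "(\<lambda>n. \<phi> (radius n *\<^sub>R \<zeta>)) \<longlonglongrightarrow> \<alpha>"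
        using elim(2) filterlim_compose[OF _ radius_at_left] unfolding has_radial_limit_def eq by blast
      have "(\<lambda>n. cmod (\<alpha> + \<phi> (radius n *\<^sub>R \<zeta>)) / 2) \<longlonglongrightarrow> cmod (\<alpha> + \<alpha>) / 2"
        by (intro tendsto_intros lim) simp
      then have num: "(\<lambda>n. cmod (\<alpha> + \<phi> (radius n *\<^sub>R \<zeta>)) / 2) \<longlonglongrightarrow> 1"
        using \<alpha> by (simp flip: mult_2 add: norm_mult)
      have "(\<lambda>n. cmod (\<alpha> - \<phi> (radius n *\<^sub>R \<zeta>))) \<longlonglongrightarrow> cmod (\<alpha> - \<alpha>)"
        by (intro tendsto_intros lim)
      then have "LIM n sequentially. inverse (cmod (\<alpha> - \<phi> (radius n *\<^sub>R \<zeta>))) :> at_top"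
        using ne[OF inD] by (intro filterlim_inverse_at_top) (auto intro!: always_eventually)
      from filterlim_tendsto_pos_mult_at_top[OF num _ this]
      have "LIM n sequentially. cmod (F (radius n *\<^sub>R \<zeta>)) / 2 :> at_top"
        by (simp add: F_def norm_divide field_simps)
      then have "LIM n sequentially. sqrt (cmod (F (radius n *\<^sub>R \<zeta>)) / 2) :> at_top"
        by (rule filterlim_compose[OF sqrt_at_top])
      then have "LIM n sequentially. Re (g (radius n *\<^sub>R \<zeta>)) :> at_top"
        by (rule filterlim_at_top_mono) (intro always_eventually allI g_lower inD)
      then have "(\<lambda>n. ?u n \<zeta>) \<longlonglongrightarrow> top"
        unfolding tendsto_top_iff_ennreal filterlim_at_top_dense
        by (auto elim!: eventually_mono intro: ennreal_lessI simp: ennreal_less_iff)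
      then have "liminf (\<lambda>n. ?u n \<zeta>) = top" by (intro lim_imp_Liminf) auto
      with elim(1) show False by simp
    qed
  qed
qed

section \<open>Boundary values in the Hardy space\<close>

text \<open>Hardy's monotonicity of means: on each disc \<open>|H|\<^sup>2\<close> is dominated by its Poisson average over a
  larger circle, and averaging over circles does not change integrals over \<open>B\<close>.\<close>

lemma square_mean_mono:
  assumes H: "H mv_holomorphic_on D" and r: "0 \<le> \<rho>" "\<rho> < r" "r < 1"
  shows "(\<integral>\<^sup>+\<zeta>. ennreal ((cmod (H (\<rho> *\<^sub>R \<zeta>)))\<^sup>2) \<partial>\<beta>) \<le> (\<integral>\<^sup>+\<zeta>. ennreal ((cmod (H (r *\<^sub>R \<zeta>)))\<^sup>2) \<partial>\<beta>)"
proof -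
  let ?k = "\<lambda>t. ennreal (disc_poisson r \<rho> t) * indicator {0..1} t"
  let ?u = "\<lambda>\<zeta>. ennreal ((cmod (H (r *\<^sub>R \<zeta>)))\<^sup>2)"
  have H_meas: "(\<lambda>\<zeta>. H (r *\<^sub>R \<zeta>)) \<in> borel_measurable \<beta>"
    using r by (intro continuous_imp_measurable continuous_on_scaled H) auto
  have k_meas: "?k \<in> borel_measurable borel"
  proof -
    have [measurable]: "circle_point \<in> borel_measurable borel"
      by (intro borel_measurable_continuous_onI continuous_on_circle_point)
    show ?thesis unfolding disc_poisson_def by measurable
  qed
  have "(\<integral>\<^sup>+\<zeta>. ennreal ((cmod (H (\<rho> *\<^sub>R \<zeta>)))\<^sup>2) \<partial>\<beta>)
      \<le> (\<integral>\<^sup>+\<zeta>. (\<integral>\<^sup>+t. ?k t * ?u (circle_point t *s \<zeta>) \<partial>lborel) \<partial>\<beta>)"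
  proof (rule nn_integral_mono)
    fix \<zeta> assume "\<zeta> \<in> space \<beta>"
    then have "(\<lambda>c. H (c *s \<zeta>)) holomorphic_on ball 0 1"
      using B_closure by (intro slice_holomorphic[OF H]) (auto simp: space_\<beta>)
    from norm_square_le_poisson_average[OF this r]
    show "ennreal ((cmod (H (\<rho> *\<^sub>R \<zeta>)))\<^sup>2) \<le> (\<integral>\<^sup>+t. ?k t * ?u (circle_point t *s \<zeta>) \<partial>lborel)"
      by (simp add: scaleR_eq_smult vector_smult_assoc)
  qed
  also have "\<dots> = (\<integral>\<^sup>+t. ?k t \<partial>lborel) * (\<integral>\<^sup>+\<zeta>. ?u \<zeta> \<partial>\<beta>)"
    using H_meas by (intro circle_average k_meas) measurable
  also have "(\<integral>\<^sup>+t. ?k t \<partial>lborel) = 1" by (rule disc_poisson_mass[OF r(1,2)])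
  finally show ?thesis by simp
qed

text \<open>The means increase with the radius, so their supremum is their limit, which dominated convergence
  computes.\<close>

lemma hardy_sup_boundary:
  assumes H: "H mv_holomorphic_on D" and bound: "\<And>z. z \<in> D \<Longrightarrow> cmod (H z) \<le> M"
    and lim: "\<And>\<zeta>. \<zeta> \<in> B \<Longrightarrow> (\<lambda>n. H (radius n *\<^sub>R \<zeta>)) \<longlonglongrightarrow> G \<zeta>"
  shows "hardy_sup \<beta> H = (\<integral>\<^sup>+\<zeta>. ennreal ((cmod (G \<zeta>))\<^sup>2) \<partial>\<beta>)"
proof -
  let ?I = "\<lambda>\<rho>. \<integral>\<^sup>+\<zeta>. ennreal ((cmod (H (\<rho> *\<^sub>R \<zeta>)))\<^sup>2) \<partial>\<beta>"
  have [measurable]: "(\<lambda>\<zeta>. H (radius n *\<^sub>R \<zeta>)) \<in> borel_measurable \<beta>" for n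
    by (intro continuous_imp_measurable continuous_on_scaled H radius)
  have [measurable]: "G \<in> borel_measurable \<beta>"
    by (rule borel_measurable_LIMSEQ_metric[of "\<lambda>n \<zeta>. H (radius n *\<^sub>R \<zeta>)"]) (auto simp: space_\<beta> lim)
  have I_lim: "(\<lambda>n. ?I (radius n)) \<longlonglongrightarrow> (\<integral>\<^sup>+\<zeta>. ennreal ((cmod (G \<zeta>))\<^sup>2) \<partial>\<beta>)"
  proof (rule nn_integral_dominated_convergence[where w = "\<lambda>_. ennreal (M\<^sup>2)"])
    show "AE \<zeta> in \<beta>. ennreal ((cmod (H (radius n *\<^sub>R \<zeta>)))\<^sup>2) \<le> ennreal (M\<^sup>2)" for n
      using B_closure radius
      by (intro AE_I2 ennreal_leI power_mono bound scaleR_in_D) (auto simp: space_\<beta>)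
    show "AE \<zeta> in \<beta>. (\<lambda>n. ennreal ((cmod (H (radius n *\<^sub>R \<zeta>)))\<^sup>2)) \<longlonglongrightarrow> ennreal ((cmod (G \<zeta>))\<^sup>2)"
      by (intro AE_I2 tendsto_ennrealI tendsto_intros lim) (simp add: space_\<beta>)
  qed (auto simp: space_\<beta> prob_\<beta>)
  show ?thesis
  proof (rule antisym)
    show "hardy_sup \<beta> H \<le> (\<integral>\<^sup>+\<zeta>. ennreal ((cmod (G \<zeta>))\<^sup>2) \<partial>\<beta>)"
      unfolding hardy_sup_def
    proof (rule SUP_least)
      fix \<rho> :: real assume \<rho>: "\<rho> \<in> {0..<1}"
      have "\<forall>\<^sub>F n in sequentially. \<rho> < radius n" using radius_tendsto \<rho> by (intro order_tendstoD) auto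
      then have "\<forall>\<^sub>F n in sequentially. ?I \<rho> \<le> ?I (radius n)"
        by eventually_elim (use \<rho> in \<open>auto intro!: square_mean_mono[OF H] radius\<close>)
      then show "?I \<rho> \<le> (\<integral>\<^sup>+\<zeta>. ennreal ((cmod (G \<zeta>))\<^sup>2) \<partial>\<beta>)"
        by (intro tendsto_lowerbound[OF I_lim]) auto
    qed
    show "(\<integral>\<^sup>+\<zeta>. ennreal ((cmod (G \<zeta>))\<^sup>2) \<partial>\<beta>) \<le> hardy_sup \<beta> H"
    proof (rule LIMSEQ_le_const2[OF I_lim], intro exI allI impI)
      show "?I (radius n) \<le> hardy_sup \<beta> H" for n
        unfolding hardy_sup_def using radius by (intro SUP_upper) auto
    qed
  qed
qed

lemma bounded_in_hardy_space:
  assumes H: "H mv_holomorphic_on D" and bound: "\<And>z. z \<in> D \<Longrightarrow> cmod (H z) \<le> M"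
  shows "H \<in> hardy_space D \<beta>"
proof -
  have "hardy_sup \<beta> H \<le> ennreal (M\<^sup>2)"
    unfolding hardy_sup_def
  proof (rule SUP_least)
    fix \<rho> :: real assume \<rho>: "\<rho> \<in> {0..<1}"
    have "(\<integral>\<^sup>+\<zeta>. ennreal ((cmod (H (\<rho> *\<^sub>R \<zeta>)))\<^sup>2) \<partial>\<beta>) \<le> (\<integral>\<^sup>+\<zeta>. ennreal (M\<^sup>2) \<partial>\<beta>)"
      using B_closure \<rho>
      by (intro nn_integral_mono ennreal_leI power_mono bound scaleR_in_D) (auto simp: space_\<beta>)
    then show "(\<integral>\<^sup>+\<zeta>. ennreal ((cmod (H (\<rho> *\<^sub>R \<zeta>)))\<^sup>2) \<partial>\<beta>) \<le> ennreal (M\<^sup>2)"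
      by (simp add: space_\<beta> prob_\<beta>)
  qed
  then show ?thesis using H by (auto simp: hardy_space_def intro: le_less_trans)
qed

text \<open>Polarization, under the integral sign, reduces the inner product to Hardy norms.\<close>

lemma hardy_inner_boundary:
  assumes f: "f mv_holomorphic_on D" "\<And>z. z \<in> D \<Longrightarrow> cmod (f z) \<le> M"
      "\<And>\<zeta>. \<zeta> \<in> B \<Longrightarrow> (\<lambda>n. f (radius n *\<^sub>R \<zeta>)) \<longlonglongrightarrow> f1 \<zeta>"
    and g: "g mv_holomorphic_on D" "\<And>z. z \<in> D \<Longrightarrow> cmod (g z) \<le> M'"
      "\<And>\<zeta>. \<zeta> \<in> B \<Longrightarrow> (\<lambda>n. g (radius n *\<^sub>R \<zeta>)) \<longlonglongrightarrow> g1 \<zeta>"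
  shows "hardy_inner \<beta> f g = (\<integral>\<zeta>. f1 \<zeta> * cnj (g1 \<zeta>) \<partial>\<beta>)"
proof -
  let ?H = "\<lambda>k z. f z + \<i> ^ k * g z" and ?G = "\<lambda>k \<zeta>. f1 \<zeta> + \<i> ^ k * g1 \<zeta>"
  have meas: "h1 \<in> borel_measurable \<beta>"
    if "h mv_holomorphic_on D" "\<And>\<zeta>. \<zeta> \<in> B \<Longrightarrow> (\<lambda>n. h (radius n *\<^sub>R \<zeta>)) \<longlonglongrightarrow> h1 \<zeta>" for h h1
  proof (rule borel_measurable_LIMSEQ_metric[of "\<lambda>n \<zeta>. h (radius n *\<^sub>R \<zeta>)"])
    show "(\<lambda>\<zeta>. h (radius n *\<^sub>R \<zeta>)) \<in> borel_measurable \<beta>" for n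
      by (intro continuous_imp_measurable continuous_on_scaled radius that(1))
  qed (simp add: space_\<beta> that(2))
  have [measurable]: "f1 \<in> borel_measurable \<beta>" "g1 \<in> borel_measurable \<beta>"
    using meas[OF f(1) f(3)] meas[OF g(1) g(3)] by simp_all
  have H_hol: "?H k mv_holomorphic_on D" for k
    by (intro mv_holomorphic_add mv_holomorphic_mult mv_holomorphic_const f g)
  have H_bound: "cmod (?H k z) \<le> M + M'" if "z \<in> D" for k z
    using norm_triangle_ineq[of "f z" "\<i> ^ k * g z"] f(2)[OF that] g(2)[OF that]
    by (simp add: norm_mult norm_power)
  have H_lim: "(\<lambda>n. ?H k (radius n *\<^sub>R \<zeta>)) \<longlonglongrightarrow> ?G k \<zeta>" if "\<zeta> \<in> B" for k \<zeta>
    by (intro tendsto_intros f(3) g(3) that)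
  have G_bound: "cmod (?G k \<zeta>) \<le> M + M'" if "\<zeta> \<in> B" for k \<zeta>
    using that B_closure radius
    by (intro Lim_bounded[OF tendsto_norm[OF H_lim[OF that]], of 0]) (auto intro!: H_bound scaleR_in_D)
  have norm_sq: "hardy_norm_sq \<beta> (?H k) = (\<integral>\<zeta>. (cmod (?G k \<zeta>))\<^sup>2 \<partial>\<beta>)" for k
  proof -
    have "hardy_sup \<beta> (?H k) = (\<integral>\<^sup>+\<zeta>. ennreal ((cmod (?G k \<zeta>))\<^sup>2) \<partial>\<beta>)"
      by (rule hardy_sup_boundary[OF H_hol H_bound H_lim])
    moreover have "(\<integral>\<zeta>. (cmod (?G k \<zeta>))\<^sup>2 \<partial>\<beta>) = enn2real (\<integral>\<^sup>+\<zeta>. ennreal ((cmod (?G k \<zeta>))\<^sup>2) \<partial>\<beta>)"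
      by (rule integral_eq_nn_integral) auto
    ultimately show ?thesis by (simp only: hardy_norm_sq_def)
  qed
  have int: "integrable \<beta> (\<lambda>\<zeta>. \<i> ^ k * of_real ((cmod (?G k \<zeta>))\<^sup>2))" for k
    by (rule integrable_const_bound[of _ "(M + M')\<^sup>2"])
       (auto simp: space_\<beta> norm_mult norm_power intro!: AE_I2 power_mono G_bound)
  have "hardy_inner \<beta> f g = (\<Sum>k<4. \<integral>\<zeta>. \<i> ^ k * of_real ((cmod (?G k \<zeta>))\<^sup>2) \<partial>\<beta>) / 4"
    unfolding hardy_inner_def norm_sq by (simp only: integral_mult_right_zero integral_complex_of_real)
  also have "\<dots> = (\<integral>\<zeta>. (\<Sum>k<4. \<i> ^ k * of_real ((cmod (?G k \<zeta>))\<^sup>2)) / 4 \<partial>\<beta>)"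
    by (simp only: integral_divide_zero Bochner_Integration.integral_sum[OF int])
  finally show ?thesis unfolding polarization .
qed

end

section \<open>The Szego kernel\<close>

lemma hardy_sup_cong:
  assumes "\<And>\<rho> \<zeta>. 0 \<le> \<rho> \<Longrightarrow> \<rho> < 1 \<Longrightarrow> \<zeta> \<in> space \<beta> \<Longrightarrow> cmod (f (\<rho> *\<^sub>R \<zeta>)) = cmod (g (\<rho> *\<^sub>R \<zeta>))"
  shows "hardy_sup \<beta> f = hardy_sup \<beta> g"
  unfolding hardy_sup_def using assms by (intro SUP_cong refl nn_integral_cong) auto

lemma hardy_inner_hermitian:
  fixes f g :: "complex ^ 'n \<Rightarrow> complex"
  shows "hardy_inner \<beta> g f = cnj (hardy_inner \<beta> f g)"
proof -
  have rot: "hardy_norm_sq \<beta> h = hardy_norm_sq \<beta> h'"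
    if "cmod c = 1" "\<And>z. h z = c * h' z" for h h' :: "complex ^ 'n \<Rightarrow> complex" and c
    unfolding hardy_norm_sq_def using that by (intro arg_cong[of _ _ enn2real] hardy_sup_cong) (simp add: norm_mult)
  have "hardy_norm_sq \<beta> (\<lambda>z. g z + \<i> * f z) = hardy_norm_sq \<beta> (\<lambda>z. f z - \<i> * g z)"
    by (rule rot[of \<i>]) (simp_all add: algebra_simps)
  moreover have "hardy_norm_sq \<beta> (\<lambda>z. g z - f z) = hardy_norm_sq \<beta> (\<lambda>z. f z - g z)"
    by (rule rot[of "-1"]) simp_all
  moreover have "hardy_norm_sq \<beta> (\<lambda>z. g z - \<i> * f z) = hardy_norm_sq \<beta> (\<lambda>z. f z + \<i> * g z)"
    by (rule rot[of "-\<i>"]) (simp_all add: algebra_simps)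
  ultimately show ?thesis
    by (simp add: hardy_inner_def eval_nat_numeral add.commute[of "g _"])
qed

locale szego = circular_domain_boundary D B \<beta>
  for D B :: "(complex ^ 'n) set" and \<beta> +
  fixes C :: "complex ^ 'n \<Rightarrow> complex ^ 'n \<Rightarrow> complex"
  assumes bounded_D: "bounded D" and kernel: "is_szego_kernel D \<beta> C"
begin

lemma kernel_in_hardy: "w \<in> D \<Longrightarrow> (\<lambda>z. C z w) \<in> hardy_space D \<beta>"
  using kernel by (simp add: is_szego_kernel_def)

lemma kernel_holomorphic: "w \<in> D \<Longrightarrow> (\<lambda>z. C z w) mv_holomorphic_on D"
  using kernel_in_hardy by (simp add: hardy_space_def)

lemma reproducing: "f \<in> hardy_space D \<beta> \<Longrightarrow> w \<in> D \<Longrightarrow> hardy_inner \<beta> f (\<lambda>z. C z w) = f w"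
  using kernel by (simp add: is_szego_kernel_def)

text \<open>Both sides are Hardy inner products of two kernel functions.\<close>

lemma kernel_hermitian: "z \<in> D \<Longrightarrow> w \<in> D \<Longrightarrow> C z w = cnj (C w z)"
  using hardy_inner_hermitian[of \<beta> "\<lambda>u. C u w" "\<lambda>u. C u z"]
  by (simp add: reproducing[OF kernel_in_hardy])

lemma kernel_continuous: "continuous_on (D \<times> closure D) (\<lambda>(z, w). C z w)"
proof -
  obtain U where U: "D \<times> closure D \<subseteq> U" "sesqui_holomorphic_on C U"
    using kernel by (auto simp: is_szego_kernel_def)
  have "isCont (\<lambda>q. C (fst q) (snd q)) p" if "p \<in> U" for p
    using U(2) that unfolding sesqui_holomorphic_on_def by (blast intro: has_derivative_continuous)
  then show ?thesis
    using U(1) by (simp add: split_beta' continuous_at_imp_continuous_on subset_eq)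
qed

lemma continuous_on_kernel:
  assumes "continuous_on S f" "continuous_on S g" "f ` S \<subseteq> D" "g ` S \<subseteq> closure D"
  shows "continuous_on S (\<lambda>x. C (f x) (g x))"
proof -
  have "continuous_on S ((\<lambda>(z, w). C z w) \<circ> (\<lambda>x. (f x, g x)))"
    using assms
    by (intro continuous_on_compose continuous_on_Pair continuous_on_subset[OF kernel_continuous]) auto
  then show ?thesis by (simp add: o_def)
qed

lemma kernel_bounded:
  assumes w: "w \<in> D"
  shows "\<exists>M. \<forall>\<zeta>\<in>closure D. cmod (C w \<zeta>) \<le> M"
proof -
  have "compact ((\<lambda>\<zeta>. C w \<zeta>) ` closure D)"
    using w bounded_D by (intro compact_continuous_image continuous_on_kernel continuous_intros) auto
  then show ?thesis by (auto dest!: compact_imp_bounded simp: bounded_iff)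
qed

lemma radius_closure_tendsto:
  assumes f: "continuous_on (closure D) f" and \<zeta>: "\<zeta> \<in> closure D"
  shows "(\<lambda>n. f (radius n *\<^sub>R \<zeta>)) \<longlonglongrightarrow> f \<zeta>"
proof (rule continuous_on_tendsto_compose[OF f _ \<zeta>])
  have "(\<lambda>n. radius n *\<^sub>R \<zeta>) \<longlonglongrightarrow> 1 *\<^sub>R \<zeta>" by (intro tendsto_intros radius_tendsto)
  then show "(\<lambda>n. radius n *\<^sub>R \<zeta>) \<longlonglongrightarrow> \<zeta>" by simp
  show "\<forall>\<^sub>F n in sequentially. radius n *\<^sub>R \<zeta> \<in> closure D"
    using scaleR_in_D[OF \<zeta> radius(2,3)] closure_subset by (auto intro!: always_eventually)
qed

text \<open>The reproducing property at \<open>w\<close>, applied to \<open>f C(\<cdot>, w)\<close>. Hermitian symmetry carries the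
  continuity of \<open>C(w, \<cdot>)\<close> up to the boundary over to the first variable, so the Hardy inner product is
  the inner product of boundary values.\<close>

lemma kernel_represents:
  assumes f: "f mv_holomorphic_on D" "continuous_on (closure D) f" and w: "w \<in> D"
  shows "(\<integral>\<zeta>. f \<zeta> * of_real ((cmod (C w \<zeta>))\<^sup>2) \<partial>\<beta>) = f w * C w w"
proof -
  let ?k = "\<lambda>z. C z w"
  obtain M where M: "\<And>\<zeta>. \<zeta> \<in> closure D \<Longrightarrow> cmod (C w \<zeta>) \<le> M" using kernel_bounded[OF w] by blast
  have "compact (f ` closure D)" using bounded_D f(2) by (intro compact_continuous_image) auto
  then have "\<exists>M'. \<forall>\<zeta>\<in>closure D. cmod (f \<zeta>) \<le> M'"
    by (auto dest!: compact_imp_bounded simp: bounded_iff)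
  then obtain M' where M': "\<And>\<zeta>. \<zeta> \<in> closure D \<Longrightarrow> cmod (f \<zeta>) \<le> M'" by blast
  have sub: "D \<subseteq> closure D" by (rule closure_subset)
  have k_bound: "cmod (?k z) \<le> M" if "z \<in> D" for z
    using M[of z] that sub kernel_hermitian[OF that w] by auto
  have fk_hol: "(\<lambda>z. f z * ?k z) mv_holomorphic_on D"
    by (rule mv_holomorphic_mult[OF f(1) kernel_holomorphic[OF w]])
  have fk_bound: "cmod (f z * ?k z) \<le> M' * M" if "z \<in> D" for z
    using M'[of z] k_bound[OF that] that sub unfolding norm_mult
    by (intro mult_mono) (auto intro: order_trans[OF norm_ge_zero])
  have k_lim: "(\<lambda>n. ?k (radius n *\<^sub>R \<zeta>)) \<longlonglongrightarrow> cnj (C w \<zeta>)" if \<zeta>: "\<zeta> \<in> B" for \<zeta>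
  proof -
    have "continuous_on (closure D) (\<lambda>\<zeta>. C w \<zeta>)"
      using w by (intro continuous_on_kernel continuous_intros) auto
    then have "(\<lambda>n. C w (radius n *\<^sub>R \<zeta>)) \<longlonglongrightarrow> C w \<zeta>"
      using \<zeta> B_closure by (intro radius_closure_tendsto) auto
    then have "(\<lambda>n. cnj (C w (radius n *\<^sub>R \<zeta>))) \<longlonglongrightarrow> cnj (C w \<zeta>)" by (rule tendsto_cnj)
    moreover have "cnj (C w (radius n *\<^sub>R \<zeta>)) = ?k (radius n *\<^sub>R \<zeta>)" for n
      using \<zeta> B_closure radius by (intro kernel_hermitian[symmetric] w scaleR_in_D) auto
    ultimately show ?thesis by simp
  qed
  have fk_lim: "(\<lambda>n. f (radius n *\<^sub>R \<zeta>) * ?k (radius n *\<^sub>R \<zeta>)) \<longlonglongrightarrow> f \<zeta> * cnj (C w \<zeta>)" if "\<zeta> \<in> B" for \<zeta>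
    using that B_closure by (intro tendsto_mult k_lim radius_closure_tendsto f(2)) auto
  have "f w * C w w = hardy_inner \<beta> (\<lambda>z. f z * ?k z) ?k"
    using reproducing[OF bounded_in_hardy_space[OF fk_hol fk_bound] w] by simp
  also have "\<dots> = (\<integral>\<zeta>. f \<zeta> * cnj (C w \<zeta>) * cnj (cnj (C w \<zeta>)) \<partial>\<beta>)"
    by (rule hardy_inner_boundary[OF fk_hol fk_bound fk_lim kernel_holomorphic[OF w] k_bound k_lim])
  also have "\<dots> = (\<integral>\<zeta>. f \<zeta> * of_real ((cmod (C w \<zeta>))\<^sup>2) \<partial>\<beta>)"
    by (intro Bochner_Integration.integral_cong refl) (simp add: complex_norm_square mult_ac del: of_real_power)
  finally show ?thesis by simp
qed

lemma kernel_diagonal: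
  assumes w: "w \<in> D"
  shows "(\<integral>\<zeta>. (cmod (C w \<zeta>))\<^sup>2 \<partial>\<beta>) = Re (C w w)" "C w w = of_real (Re (C w w))" "0 \<le> Re (C w w)"
proof -
  have "of_real (\<integral>\<zeta>. (cmod (C w \<zeta>))\<^sup>2 \<partial>\<beta>) = C w w"
    using kernel_represents[OF mv_holomorphic_const[of 1] continuous_on_const w]
    by (simp del: of_real_power)
  then show "(\<integral>\<zeta>. (cmod (C w \<zeta>))\<^sup>2 \<partial>\<beta>) = Re (C w w)" "C w w = of_real (Re (C w w))"
    by (metis Re_complex_of_real)+
  then show "0 \<le> Re (C w w)" by (metis Bochner_Integration.integral_nonneg zero_le_power2)
qed

lemma hardy_inner_compose:
  assumes T: "bounded_linear T" "\<And>c v. T (c *s v) = c *s T v" "T ` B \<subseteq> B" "distr \<beta> \<beta> T = \<beta>"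
    and f: "f mv_holomorphic_on D" and g: "g mv_holomorphic_on D"
  shows "hardy_inner \<beta> (\<lambda>z. f (T z)) (\<lambda>z. g (T z)) = hardy_inner \<beta> f g"
    and "hardy_sup \<beta> (\<lambda>z. f (T z)) = hardy_sup \<beta> f"
proof -
  have T_meas: "T \<in> measurable \<beta> \<beta>"
    using T(1,3) by (intro measurable_into_\<beta> continuous_imp_measurable linear_continuous_on) (auto simp: space_\<beta>)
  have sup: "hardy_sup \<beta> (\<lambda>z. h (T z)) = hardy_sup \<beta> h" if h: "h mv_holomorphic_on D" for h
    unfolding hardy_sup_def
  proof (rule SUP_cong[OF refl])
    fix \<rho> :: real assume \<rho>: "\<rho> \<in> {0..<1}"
    have [measurable]: "(\<lambda>\<zeta>. h (\<rho> *\<^sub>R \<zeta>)) \<in> borel_measurable \<beta>"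
      using \<rho> by (intro continuous_imp_measurable continuous_on_scaled h) auto
    have "(\<integral>\<^sup>+\<zeta>. ennreal ((cmod (h (T (\<rho> *\<^sub>R \<zeta>))))\<^sup>2) \<partial>\<beta>) = (\<integral>\<^sup>+\<zeta>. ennreal ((cmod (h (\<rho> *\<^sub>R T \<zeta>)))\<^sup>2) \<partial>\<beta>)"
      by (simp add: linear_simps(5)[OF T(1)])
    also have "\<dots> = (\<integral>\<^sup>+\<zeta>. ennreal ((cmod (h (\<rho> *\<^sub>R \<zeta>)))\<^sup>2) \<partial>distr \<beta> \<beta> T)"
      by (subst nn_integral_distr[OF T_meas]) auto
    finally show "(\<integral>\<^sup>+\<zeta>. ennreal ((cmod (h (T (\<rho> *\<^sub>R \<zeta>))))\<^sup>2) \<partial>\<beta>) = (\<integral>\<^sup>+\<zeta>. ennreal ((cmod (h (\<rho> *\<^sub>R \<zeta>)))\<^sup>2) \<partial>\<beta>)"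
      by (simp add: T(4))
  qed
  show "hardy_sup \<beta> (\<lambda>z. f (T z)) = hardy_sup \<beta> f" by (rule sup[OF f])
  have "(\<lambda>z. f z + \<i> ^ k * g z) mv_holomorphic_on D" for k
    by (intro mv_holomorphic_add mv_holomorphic_mult mv_holomorphic_const f g)
  from sup[OF this] show "hardy_inner \<beta> (\<lambda>z. f (T z)) (\<lambda>z. g (T z)) = hardy_inner \<beta> f g"
    by (simp add: hardy_inner_def hardy_norm_sq_def)
qed

text \<open>Composition with \<open>T\<close> preserves the Hardy inner product, so \<open>C(T \<cdot>, T w)\<close> reproduces values at \<open>w\<close>;
  the reproducing kernel is unique.\<close>

lemma kernel_invariant:
  assumes T: "bounded_linear T" "\<And>c v. T (c *s v) = c *s T v" "T ` B \<subseteq> B" "distr \<beta> \<beta> T = \<beta>" "T ` D \<subseteq> D"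
    and S: "bounded_linear S" "\<And>c v. S (c *s v) = c *s S v" "S ` B \<subseteq> B" "distr \<beta> \<beta> S = \<beta>" "S ` D \<subseteq> D"
    and ST: "\<And>z. S (T z) = z" and z: "z \<in> D" and w: "w \<in> D"
  shows "C (T z) (T w) = C z w"
proof -
  let ?k = "\<lambda>u. C u (T w)" and ?k' = "\<lambda>u. C (T u) (T w)"
  have Tw: "T w \<in> D" using T(5) w by blast
  note k = kernel_holomorphic[OF Tw]
  have "?k' \<in> hardy_space D \<beta>"
    using kernel_in_hardy[OF Tw] hardy_inner_compose(2)[OF T(1-4) k k]
      mv_holomorphic_compose_linear[OF k T(1,2,5)] by (simp add: hardy_space_def)
  then have "?k' z = hardy_inner \<beta> ?k' (\<lambda>u. C u z)" by (rule reproducing[symmetric, OF _ z])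
  also have "\<dots> = cnj (hardy_inner \<beta> (\<lambda>u. C u z) ?k')" by (rule hardy_inner_hermitian)
  also have "hardy_inner \<beta> (\<lambda>u. C u z) ?k' = hardy_inner \<beta> (\<lambda>u. C (S (T u)) z) ?k'" by (simp add: ST)
  also have "\<dots> = hardy_inner \<beta> (\<lambda>u. C (S u) z) ?k"
    by (rule hardy_inner_compose(1)[OF T(1-4) mv_holomorphic_compose_linear[OF kernel_holomorphic[OF z] S(1,2,5)] k])
  also have "\<dots> = C (S (T w)) z"
    using kernel_in_hardy[OF z] hardy_inner_compose(2)[OF S(1-4) kernel_holomorphic[OF z] kernel_holomorphic[OF z]]
      mv_holomorphic_compose_linear[OF kernel_holomorphic[OF z] S(1,2,5)]
    by (intro reproducing Tw) (simp add: hardy_space_def)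
  finally show ?thesis using kernel_hermitian[OF z w] by (simp add: ST)
qed

lemma kernel_rotate:
  assumes "cmod c = 1" "z \<in> D" "w \<in> D"
  shows "C (c *s z) w = C z (cnj c *s w)"
proof -
  have D: "(\<lambda>v. a *s v) ` D \<subseteq> D" if "cmod a = 1" for a using circular_D that by (auto simp: circular_def)
  have B: "(\<lambda>v. a *s v) ` B \<subseteq> B" if "cmod a = 1" for a using rotate_B that by auto
  have cc: "c * cnj c = 1" using assms(1) by (simp flip: complex_norm_square)
  have "C (c *s z) (c *s (cnj c *s w)) = C z (cnj c *s w)"
  proof (rule kernel_invariant[of "\<lambda>v. c *s v" "\<lambda>v. cnj c *s v"])
    show "cnj c *s w \<in> D" using D[of "cnj c"] assms by auto
  qed (use assms B D rotate_\<beta> cc in \<open>simp_all add: bounded_linear_smult_right vector_smult_assoc mult.commute\<close>)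
  then show ?thesis using cc by (simp add: vector_smult_assoc)
qed

text \<open>For \<open>|c| = 1\<close> rotation invariance gives \<open>C(c z, w) = C(z, cnj c w)\<close>. Both sides are holomorphic
  in \<open>c\<close>, so by the maximum principle the identity persists in the disc.\<close>

lemma kernel_dilate:
  assumes r: "0 \<le> r" "r \<le> 1" and z: "z \<in> D" and w: "w \<in> D"
  shows "C (r *\<^sub>R z) w = C z (r *\<^sub>R w)"
proof -
  let ?f = "\<lambda>c. C (c *s z) w" and ?g = "\<lambda>c. C (c *s w) z"
  let ?h = "\<lambda>c. ?f c - (cnj \<circ> ?g \<circ> cnj) c"
  have inD: "c *s v \<in> D" if "c \<in> cball 0 1" "v \<in> D" for c v
  proof (cases "cmod c = 1")
    case True then show ?thesis using circular_D that by (simp add: circular_def)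
  next
    case False then show ?thesis using that closure_subset by (intro scale_in_D) auto
  qed
  have "?f holomorphic_on ball 0 1" "?g holomorphic_on ball 0 1"
    using slice_holomorphic[OF kernel_holomorphic[OF w]] slice_holomorphic[OF kernel_holomorphic[OF z]]
      z w closure_subset by blast+
  moreover have "cnj ` ball 0 1 = ball 0 1"
  proof (intro equalityI subsetI)
    fix c :: complex assume "c \<in> ball 0 1"
    then show "c \<in> cnj ` ball 0 1" by (intro image_eqI[of _ _ "cnj c"]) auto
  qed auto
  ultimately have hol: "?h holomorphic_on ball 0 1"
    by (intro holomorphic_intros holomorphic_on_compose_cnj_cnj) auto
  have cont: "continuous_on (cball 0 1) ?h"
    unfolding o_def using z w inD closure_subset
    by (intro continuous_intros continuous_on_kernel) auto
  have "cmod (?h (of_real r)) \<le> 0"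
  proof (rule maximum_modulus_frontier[of ?h "cball 0 1"])
    show "?h holomorphic_on interior (cball 0 1)" using hol by simp
    show "continuous_on (closure (cball 0 1)) ?h" using cont by simp
    fix c :: complex assume "c \<in> frontier (cball 0 1)"
    then have c: "cmod c = 1" by simp
    have "C (cnj c *s w) z = cnj (C z (cnj c *s w))"
      using c inD[of "cnj c" w] w by (intro kernel_hermitian z) auto
    then show "cmod (?h c) \<le> 0" using kernel_rotate[OF c z w] by simp
  qed (use r in auto)
  then have "C (of_real r *s z) w = cnj (C (of_real r *s w) z)" by simp
  moreover have "C (of_real r *s w) z = cnj (C z (of_real r *s w))"
    using r inD[of "of_real r" w] w by (intro kernel_hermitian z) auto
  ultimately show ?thesis by (simp add: scaleR_eq_smult)
qed

text \<open>With both points inside \<open>D\<close> the dilation can be moved from one argument to the other; the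
  boundary case follows by continuity in the second argument.\<close>

lemma kernel_boundary_symmetric:
  assumes \<rho>: "0 \<le> \<rho>" "\<rho> < 1" and \<zeta>: "\<zeta> \<in> closure D" and \<eta>: "\<eta> \<in> closure D"
  shows "C (\<rho> *\<^sub>R \<zeta>) \<eta> = cnj (C (\<rho> *\<^sub>R \<eta>) \<zeta>)"
proof -
  have D\<rho>: "\<rho> *\<^sub>R \<zeta> \<in> D" "\<rho> *\<^sub>R \<eta> \<in> D" using \<rho> \<zeta> \<eta> by (auto intro: scaleR_in_D)
  have lim: "(\<lambda>n. C u (radius n *\<^sub>R v)) \<longlonglongrightarrow> C u v" if "u \<in> D" "v \<in> closure D" for u v
    using that by (intro radius_closure_tendsto continuous_on_kernel continuous_intros) auto
  have "\<forall>\<^sub>F n in sequentially. \<rho> < radius n" using radius_tendsto \<rho> by (intro order_tendstoD) auto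
  then have "\<forall>\<^sub>F n in sequentially. C (\<rho> *\<^sub>R \<zeta>) (radius n *\<^sub>R \<eta>) = cnj (C (\<rho> *\<^sub>R \<eta>) (radius n *\<^sub>R \<zeta>))"
  proof eventually_elim
    case (elim n)
    let ?r = "radius n"
    have Dr: "?r *\<^sub>R \<zeta> \<in> D" "?r *\<^sub>R \<eta> \<in> D" using radius \<zeta> \<eta> by (auto intro: scaleR_in_D)
    have "C ((\<rho> / ?r) *\<^sub>R (?r *\<^sub>R \<zeta>)) (?r *\<^sub>R \<eta>) = C (?r *\<^sub>R \<zeta>) ((\<rho> / ?r) *\<^sub>R (?r *\<^sub>R \<eta>))"
      using elim \<rho> radius[of n] by (intro kernel_dilate Dr) auto
    then have "C (\<rho> *\<^sub>R \<zeta>) (?r *\<^sub>R \<eta>) = C (?r *\<^sub>R \<zeta>) (\<rho> *\<^sub>R \<eta>)" using radius(1)[of n] by simp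
    then show ?case using kernel_hermitian[OF Dr(1) D\<rho>(2)] by simp
  qed
  then have "(\<lambda>n. cnj (C (\<rho> *\<^sub>R \<eta>) (radius n *\<^sub>R \<zeta>))) \<longlonglongrightarrow> C (\<rho> *\<^sub>R \<zeta>) \<eta>"
    by (rule Lim_transform_eventually[OF lim[OF D\<rho>(1) \<eta>]])
  then show ?thesis
    using tendsto_cnj[OF lim[OF D\<rho>(2) \<zeta>]] LIMSEQ_unique by blast
qed

end

section \<open>Approximate identities and absolutely continuous parts\<close>

lemma inner_regular_restrict_space:
  fixes M :: "'a::euclidean_space measure"
  assumes "finite_measure M" "sets M = sets (restrict_space borel B)" "B \<in> sets borel"
    and E: "E \<in> sets M" and "0 < e"
  obtains Q where "compact Q" "Q \<subseteq> E" "Q \<in> sets M" "emeasure M (E - Q) \<le> ennreal e"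
proof -
  interpret finite_measure M by fact
  have sets_iff: "A \<in> sets M \<longleftrightarrow> A \<subseteq> B \<and> A \<in> sets borel" for A
    using assms(2,3) by (simp add: sets_restrict_space_iff)
  have space: "space M = B"
    using sets_eq_imp_space_eq[OF assms(2)] by (simp add: space_restrict_space)
  have id_meas [measurable]: "(\<lambda>x. x) \<in> measurable M borel"
    unfolding measurable_cong_sets[OF assms(2) refl] by (rule measurable_restrict_space1) simp
  let ?N = "distr M borel (\<lambda>x. x)"
  have N_eq: "emeasure ?N A = emeasure M A" if "A \<in> sets M" for A
    using that by (subst emeasure_distr) (auto simp: sets_iff space Int_absorb2)
  have "emeasure ?N (space ?N) \<noteq> \<infinity>"
    by (subst emeasure_distr) (auto simp: emeasure_eq_measure)
  from inner_regular[OF _ this, of E] have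
    "emeasure ?N E = (SUP K \<in> {K. K \<subseteq> E \<and> compact K}. emeasure ?N K)"
    using E by (simp add: sets_iff)
  moreover have "emeasure ?N E \<noteq> \<infinity>" using N_eq[OF E] by (simp add: emeasure_eq_measure)
  ultimately obtain Q where Q: "Q \<subseteq> E" "compact Q" "emeasure ?N E < emeasure ?N Q + ennreal e"
    using SUP_approx_ennreal[OF \<open>0 < e\<close> _, of "{K. K \<subseteq> E \<and> compact K}" "emeasure ?N E" "emeasure ?N"]
    by (metis (mono_tags, lifting) compact_empty empty_iff empty_subsetI mem_Collect_eq)
  have QM: "Q \<in> sets M" using Q E by (auto simp: sets_iff borel_compact)
  have "measure M E \<le> measure M Q + e"
    using Q(3) \<open>0 < e\<close> unfolding N_eq[OF E] N_eq[OF QM] emeasure_eq_measure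
    by (simp add: ennreal_less_iff flip: ennreal_plus)
  then have "emeasure M (E - Q) \<le> ennreal e"
    using Q(1) E QM \<open>0 < e\<close> by (simp add: emeasure_eq_measure finite_measure_Diff)
  with Q QM show thesis using that by blast
qed

text \<open>Off a \<open>\<beta>\<close>-null set of maximal \<open>\<mu>\<close>-measure every \<open>\<beta>\<close>-null set is \<open>\<mu>\<close>-null, so the
  Radon--Nikodym theorem applies there.\<close>

lemma lebesgue_decomposition_exists:
  assumes "finite_measure \<beta>" "finite_measure \<mu>" and sets [measurable_cong]: "sets \<mu> = sets \<beta>"
  obtains w \<mu>s where "w \<in> borel_measurable \<beta>" "lebesgue_decomposition \<beta> \<mu> (density \<beta> w) \<mu>s"
proof -
  interpret \<beta>: finite_measure \<beta> by fact
  interpret \<mu>: finite_measure \<mu> by fact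
  have space: "space \<mu> = space \<beta>" using sets by (rule sets_eq_imp_space_eq)
  let ?F = "null_sets \<beta>"
  have "?F \<noteq> {}" by blast
  from ennreal_SUP_countable_SUP[OF this, of "emeasure \<mu>"]
  obtain f :: "nat \<Rightarrow> ennreal" where f: "range f \<subseteq> emeasure \<mu> ` ?F"
    "(SUP A\<in>?F. emeasure \<mu> A) = (SUP n. f n)" by blast
  then have "\<forall>n. \<exists>A\<in>?F. f n = emeasure \<mu> A" by blast
  then obtain A' where A': "\<And>n. A' n \<in> ?F" "\<And>n. f n = emeasure \<mu> (A' n)" by metis
  define A where "A = (\<Union>n. A' n)"
  have A: "A \<in> ?F" unfolding A_def using A'(1) by (intro null_sets_UN) auto
  then have A_sets [measurable]: "A \<in> sets \<beta>" by auto
  have le_A: "emeasure \<mu> N \<le> emeasure \<mu> A" if "N \<in> ?F" for N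
  proof -
    have "emeasure \<mu> N \<le> (SUP n. f n)" unfolding f(2)[symmetric] by (intro SUP_upper that)
    also have "\<dots> \<le> emeasure \<mu> A"
      unfolding A'(2) A_def using A_sets sets by (intro SUP_least emeasure_mono) (auto simp: A_def)
    finally show ?thesis .
  qed
  define \<nu> where "\<nu> = density \<mu> (indicator (space \<beta> - A))"
  define \<mu>s where "\<mu>s = density \<mu> (indicator A)"
  have \<nu>: "emeasure \<nu> E = emeasure \<mu> (E - A)" if "E \<in> sets \<beta>" for E
  proof -
    have "emeasure \<nu> E = (\<integral>\<^sup>+x. indicator (space \<beta> - A) x * indicator E x \<partial>\<mu>)"
      unfolding \<nu>_def by (rule emeasure_density) (use that sets in auto)
    also have "\<dots> = (\<integral>\<^sup>+x. indicator (E - A) x \<partial>\<mu>)"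
      using sets.sets_into_space[OF that] by (intro nn_integral_cong) (auto split: split_indicator)
    finally show ?thesis using that sets by simp
  qed
  have \<mu>s: "emeasure \<mu>s E = emeasure \<mu> (E \<inter> A)" if "E \<in> sets \<beta>" for E
  proof -
    have "emeasure \<mu>s E = (\<integral>\<^sup>+x. indicator A x * indicator E x \<partial>\<mu>)"
      unfolding \<mu>s_def by (rule emeasure_density) (use that sets in auto)
    also have "\<dots> = (\<integral>\<^sup>+x. indicator (E \<inter> A) x \<partial>\<mu>)"
      by (intro nn_integral_cong) (auto split: split_indicator)
    finally show ?thesis using that sets by simp
  qed
  have "absolutely_continuous \<beta> \<nu>"
  proof (unfold absolutely_continuous_def, safe)
    fix N assume N: "N \<in> null_sets \<beta>"
    have NA: "A \<union> (N - A) \<in> ?F" using A N null_sets.Un[OF A N] by simp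
    have "emeasure \<mu> A + emeasure \<mu> (N - A) = emeasure \<mu> (A \<union> (N - A))"
      by (rule plus_emeasure) (use null_setsD2[OF N] A_sets in \<open>simp_all add: sets sets.Diff\<close>)
    also have "\<dots> \<le> emeasure \<mu> A + 0" using le_A[OF NA] by simp
    finally have "emeasure \<mu> (N - A) \<le> 0"
      unfolding ennreal_add_left_cancel_le by (simp add: \<mu>.emeasure_eq_measure)
    then have "emeasure \<mu> (N - A) = 0" by simp
    then show "N \<in> null_sets \<nu>" using N \<nu>[of N] sets by (auto simp: null_sets_def \<nu>_def)
  qed
  then obtain w where w: "w \<in> borel_measurable \<beta>" "density \<beta> w = \<nu>"
    using \<beta>.Radon_Nikodym[of \<nu>] sets by (auto simp: \<nu>_def)
  have "lebesgue_decomposition \<beta> \<mu> (density \<beta> w) \<mu>s"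
    unfolding lebesgue_decomposition_def
  proof (intro conjI ballI)
    show "emeasure \<mu> E = emeasure (density \<beta> w) E + emeasure \<mu>s E" if "E \<in> sets \<mu>" for E
    proof -
      have "emeasure \<mu> ((E - A) \<union> (E \<inter> A)) = emeasure \<mu> (E - A) + emeasure \<mu> (E \<inter> A)"
        using that sets A_sets by (intro plus_emeasure[symmetric]) auto
      moreover have "(E - A) \<union> (E \<inter> A) = E" by blast
      ultimately show ?thesis using \<nu> \<mu>s that sets w by simp
    qed
    show "absolutely_continuous \<beta> (density \<beta> w)"
      using \<open>absolutely_continuous \<beta> \<nu>\<close> w(2) by simp
    have "emeasure \<mu>s (space \<mu>s - A) = emeasure \<mu> ((space \<beta> - A) \<inter> A)"
      using \<mu>s[of "space \<beta> - A"] A_sets space by (auto simp: \<mu>s_def)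
    also have "(space \<beta> - A) \<inter> A = {}" by blast
    finally have "emeasure \<mu>s (space \<mu>s - A) = 0" by simp
    with A show "mutually_singular \<mu>s \<beta>"
      unfolding mutually_singular_def using sets by (auto simp: \<mu>s_def intro!: bexI[of _ A])
  qed (use sets in \<open>auto simp: \<mu>s_def\<close>)
  with w(1) show thesis using that by blast
qed

lemma tendsto_zero_ennrealI:
  assumes "\<And>e::real. 0 < e \<Longrightarrow> \<forall>\<^sub>F n in F. f n \<le> ennreal e"
  shows "(f \<longlongrightarrow> (0::ennreal)) F"
proof (rule order_tendstoI)
  fix a :: ennreal assume "0 < a"
  then obtain z where z: "0 < z" "z < a" using dense by blast
  then obtain e where e: "z = ennreal e" "0 \<le> e" by (cases z) auto
  with z have "0 < e" by (simp add: le_less)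
  from assms[OF this] show "\<forall>\<^sub>F n in F. f n < a"
    by eventually_elim (use z e in simp)
qed simp

text \<open>Concentration at the diagonal is measured in quadratic mean, uniformly in \<open>y\<close>: this is what
  a representing measure on the unit sphere controls, whereas the kernel itself may stay large
  off the diagonal.\<close>

locale symmetric_approximate_identity =
  fixes B :: "'a::euclidean_space set" and \<beta> :: "'a measure"
    and p :: "nat \<Rightarrow> 'a \<Rightarrow> 'a \<Rightarrow> ennreal" and \<epsilon> :: "nat \<Rightarrow> real"
  assumes B: "B \<in> sets borel" and sets_\<beta>: "sets \<beta> = sets (restrict_space borel B)"
    and finite_\<beta>: "finite_measure \<beta>"
    and p_measurable: "\<And>n. (\<lambda>(x, y). p n x y) \<in> borel_measurable (\<beta> \<Otimes>\<^sub>M \<beta>)"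
    and p_sym: "\<And>n x y. x \<in> B \<Longrightarrow> y \<in> B \<Longrightarrow> p n x y = p n y x"
    and p_mass: "\<And>n y. y \<in> B \<Longrightarrow> (\<integral>\<^sup>+x. p n x y \<partial>\<beta>) = 1"
    and p_concentrated: "\<And>n y. y \<in> B \<Longrightarrow> (\<integral>\<^sup>+x. p n x y * ennreal ((dist x y)\<^sup>2) \<partial>\<beta>) \<le> ennreal (\<epsilon> n)"
    and \<epsilon>: "\<epsilon> \<longlonglongrightarrow> 0"
begin

sublocale finite_measure \<beta> by (rule finite_\<beta>)

lemma space_\<beta>: "space \<beta> = B"
  using sets_eq_imp_space_eq[OF sets_\<beta>] by (simp add: space_restrict_space)

lemma sets_iff: "A \<in> sets \<beta> \<longleftrightarrow> A \<subseteq> B \<and> A \<in> sets borel"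
  using sets_\<beta> B by (simp add: sets_restrict_space_iff)

lemma p_meas1: "(\<lambda>x. p n x y) \<in> borel_measurable \<beta>" if "y \<in> B"
  using measurable_compose[OF measurable_Pair2'[of y \<beta> \<beta>] p_measurable[of n]] that
  by (simp add: space_\<beta>)

lemma p_meas2: "(\<lambda>x. p n y x) \<in> borel_measurable \<beta>" if "y \<in> B"
  using p_meas1[OF that] by (rule measurable_cong[THEN iffD1, rotated]) (simp add: p_sym that space_\<beta>)

text \<open>Chebyshev's inequality.\<close>

lemma mass_far:
  assumes Q: "Q \<in> sets \<beta>" and y: "y \<in> B" and d: "0 < d" "\<And>x. x \<in> Q \<Longrightarrow> d \<le> dist x y"
  shows "(\<integral>\<^sup>+x. p n x y * indicator Q x \<partial>\<beta>) \<le> ennreal (\<epsilon> n / d\<^sup>2)"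
proof -
  note [measurable] = p_meas1[OF y] Q
  have dist_meas [measurable]: "(\<lambda>x. dist x y) \<in> borel_measurable \<beta>"
    unfolding measurable_cong_sets[OF sets_\<beta> refl]
    by (rule measurable_restrict_space1) (intro borel_measurable_continuous_onI continuous_intros)
  have "(\<integral>\<^sup>+x. p n x y * indicator Q x \<partial>\<beta>)
      \<le> (\<integral>\<^sup>+x. ennreal (1 / d\<^sup>2) * (p n x y * ennreal ((dist x y)\<^sup>2)) \<partial>\<beta>)"
  proof (rule nn_integral_mono)
    fix x
    show "p n x y * indicator Q x \<le> ennreal (1 / d\<^sup>2) * (p n x y * ennreal ((dist x y)\<^sup>2))"
    proof (cases "x \<in> Q")
      case True
      have "1 \<le> 1 / d\<^sup>2 * (dist x y)\<^sup>2"
        using d(1) power_mono[OF d(2)[OF True], of 2] by (simp add: field_simps)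
      then have "p n x y * ennreal 1 \<le> p n x y * ennreal (1 / d\<^sup>2 * (dist x y)\<^sup>2)"
        by (intro mult_left_mono ennreal_leI) auto
      also have "ennreal (1 / d\<^sup>2 * (dist x y)\<^sup>2) = ennreal (1 / d\<^sup>2) * ennreal ((dist x y)\<^sup>2)"
        by (rule ennreal_mult) auto
      finally show ?thesis using True by (simp only: mult_ac) simp
    qed simp
  qed
  also have "\<dots> = ennreal (1 / d\<^sup>2) * (\<integral>\<^sup>+x. p n x y * ennreal ((dist x y)\<^sup>2) \<partial>\<beta>)"
    by (rule nn_integral_cmult) measurable
  also have "\<dots> \<le> ennreal (1 / d\<^sup>2) * ennreal (\<epsilon> n)"
    by (intro mult_left_mono p_concentrated y) auto
  finally show ?thesis using d(1) by (simp add: ennreal_mult' flip: ennreal_mult')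
qed

lemma mass_le_1: "Q \<in> sets \<beta> \<Longrightarrow> y \<in> B \<Longrightarrow> (\<integral>\<^sup>+x. p n x y * indicator Q x \<partial>\<beta>) \<le> 1"
  unfolding p_mass[of y n, symmetric] by (intro nn_integral_mono) (auto split: split_indicator)

lemma pair_\<beta>: "pair_sigma_finite \<beta> \<beta>"
  by (simp add: pair_sigma_finite_def sigma_finite_measure_axioms)

text \<open>Up to small measure, \<open>E\<close> and its complement are compact sets at positive distance. Symmetry bounds
  the contribution of the exceptional part of the complement by its measure.\<close>

lemma crossing_mass_tendsto_0:
  assumes E: "E \<in> sets \<beta>"
  shows "(\<lambda>n. \<integral>\<^sup>+y. (\<integral>\<^sup>+x. p n x y * indicator (B - E) x \<partial>\<beta>) * indicator E y \<partial>\<beta>) \<longlonglongrightarrow> 0"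
proof (rule tendsto_zero_ennrealI)
  fix e :: real assume "0 < e"
  interpret pair_sigma_finite \<beta> \<beta> by (rule pair_\<beta>)
  have BE: "B - E \<in> sets \<beta>" using E sets.top[of \<beta>] by (metis sets.Diff space_\<beta>)
  obtain Q1 where Q1: "compact Q1" "Q1 \<subseteq> E" "Q1 \<in> sets \<beta>" "emeasure \<beta> (E - Q1) \<le> ennreal (e / 3)"
    using inner_regular_restrict_space[OF finite_\<beta> sets_\<beta> B E] \<open>0 < e\<close> by (metis divide_pos_pos zero_less_numeral)
  obtain Q2 where Q2: "compact Q2" "Q2 \<subseteq> B - E" "Q2 \<in> sets \<beta>" "emeasure \<beta> (B - E - Q2) \<le> ennreal (e / 3)"
    using inner_regular_restrict_space[OF finite_\<beta> sets_\<beta> B BE] \<open>0 < e\<close> by (metis divide_pos_pos zero_less_numeral)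
  obtain d where d: "0 < d" "\<And>x y. x \<in> Q1 \<Longrightarrow> y \<in> Q2 \<Longrightarrow> d \<le> dist x y"
    using separate_compact_closed[of Q1 Q2] Q1 Q2 by (metis Diff_disjoint compact_imp_closed disjoint_iff subset_iff)
  note [measurable] = E Q1(3) Q2(3) BE p_measurable
  have pm [measurable]: "(\<lambda>z. p n (fst z) (snd z)) \<in> borel_measurable (\<beta> \<Otimes>\<^sub>M \<beta>)"
     "(\<lambda>z. p n (snd z) (fst z)) \<in> borel_measurable (\<beta> \<Otimes>\<^sub>M \<beta>)" for n
    using p_measurable[of n] measurable_compose[OF measurable_pair_swap' p_measurable[of n]]
    by (simp_all add: split_beta')
  have bound: "(\<integral>\<^sup>+y. (\<integral>\<^sup>+x. p n x y * indicator (B - E) x \<partial>\<beta>) * indicator E y \<partial>\<beta>)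
      \<le> ennreal (e / 3) + ennreal (\<epsilon> n / d\<^sup>2) * emeasure \<beta> B + ennreal (e / 3)" for n
  proof -
    have "(\<integral>\<^sup>+y. (\<integral>\<^sup>+x. p n x y * indicator (B - E) x \<partial>\<beta>) * indicator E y \<partial>\<beta>)
      \<le> (\<integral>\<^sup>+y. indicator (E - Q1) y + (ennreal (\<epsilon> n / d\<^sup>2)
            + (\<integral>\<^sup>+x. p n x y * indicator (B - E - Q2) x \<partial>\<beta>)) \<partial>\<beta>)"
    proof (rule nn_integral_mono)
      fix y assume "y \<in> space \<beta>"
      then have y: "y \<in> B" by (simp add: space_\<beta>)
      note [measurable] = p_meas1[OF y]
      consider "y \<notin> E" | "y \<in> E - Q1" | "y \<in> Q1" using Q1 by blast
      then show "(\<integral>\<^sup>+x. p n x y * indicator (B - E) x \<partial>\<beta>) * indicator E y \<le>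
        indicator (E - Q1) y + (ennreal (\<epsilon> n / d\<^sup>2)
            + (\<integral>\<^sup>+x. p n x y * indicator (B - E - Q2) x \<partial>\<beta>))"
      proof cases
        case 2
        then show ?thesis using mass_le_1[OF BE y, of n] by (auto intro: order_trans)
      next
        case 3
        have "(\<integral>\<^sup>+x. p n x y * indicator (B - E) x \<partial>\<beta>)
            = (\<integral>\<^sup>+x. p n x y * indicator Q2 x + p n x y * indicator (B - E - Q2) x \<partial>\<beta>)"
          using Q2(2) by (intro nn_integral_cong) (auto split: split_indicator)
        also have "\<dots> = (\<integral>\<^sup>+x. p n x y * indicator Q2 x \<partial>\<beta>)
            + (\<integral>\<^sup>+x. p n x y * indicator (B - E - Q2) x \<partial>\<beta>)"
          by (rule nn_integral_add) measurable
        also have "(\<integral>\<^sup>+x. p n x y * indicator Q2 x \<partial>\<beta>) \<le> ennreal (\<epsilon> n / d\<^sup>2)"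
          using d(2)[OF 3] by (intro mass_far[OF Q2(3) y d(1)]) (simp add: dist_commute)
        finally show ?thesis using 3 Q1(2) by (auto simp: add_right_mono)
      qed simp
    qed
    also have "\<dots> = emeasure \<beta> (E - Q1) + (ennreal (\<epsilon> n / d\<^sup>2) * emeasure \<beta> B
        + (\<integral>\<^sup>+y. (\<integral>\<^sup>+x. p n x y * indicator (B - E - Q2) x \<partial>\<beta>) \<partial>\<beta>))"
      by (subst nn_integral_add nn_integral_add nn_integral_const; (simp add: space_\<beta>)?)+
    also have "(\<integral>\<^sup>+y. (\<integral>\<^sup>+x. p n x y * indicator (B - E - Q2) x \<partial>\<beta>) \<partial>\<beta>)
        = (\<integral>\<^sup>+x. (\<integral>\<^sup>+y. p n x y * indicator (B - E - Q2) x \<partial>\<beta>) \<partial>\<beta>)"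
      by (rule Fubini') measurable
    also have "\<dots> = (\<integral>\<^sup>+x. indicator (B - E - Q2) x \<partial>\<beta>)"
    proof (rule nn_integral_cong)
      fix x assume "x \<in> space \<beta>"
      then have x: "x \<in> B" by (simp add: space_\<beta>)
      have "(\<integral>\<^sup>+y. p n x y * indicator (B - E - Q2) x \<partial>\<beta>) = (\<integral>\<^sup>+y. p n x y \<partial>\<beta>) * indicator (B - E - Q2) x"
        by (rule nn_integral_multc[OF p_meas2[OF x]])
      also have "(\<integral>\<^sup>+y. p n x y \<partial>\<beta>) = (\<integral>\<^sup>+y. p n y x \<partial>\<beta>)"
        by (rule nn_integral_cong) (simp add: space_\<beta> p_sym x)
      finally show "(\<integral>\<^sup>+y. p n x y * indicator (B - E - Q2) x \<partial>\<beta>) = indicator (B - E - Q2) x"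
        by (simp add: p_mass x)
    qed
    also have "\<dots> = emeasure \<beta> (B - E - Q2)" by simp
    finally show ?thesis
      using Q1(4) Q2(4) by (smt (verit) add.assoc add_mono order_refl order_trans)
  qed
  have "(\<lambda>n. \<epsilon> n / d\<^sup>2 * measure \<beta> B) \<longlonglongrightarrow> 0"
    by (intro tendsto_mult_left_zero tendsto_divide_zero \<epsilon>)
  then have "\<forall>\<^sub>F n in sequentially. \<epsilon> n / d\<^sup>2 * measure \<beta> B < e / 3"
    using \<open>0 < e\<close> by (intro order_tendstoD) auto
  then show "\<forall>\<^sub>F n in sequentially.
      (\<integral>\<^sup>+y. (\<integral>\<^sup>+x. p n x y * indicator (B - E) x \<partial>\<beta>) * indicator E y \<partial>\<beta>) \<le> ennreal e"
  proof eventually_elim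
    case (elim n)
    have "ennreal (\<epsilon> n / d\<^sup>2) * emeasure \<beta> B = ennreal (\<epsilon> n / d\<^sup>2 * measure \<beta> B)"
      by (simp only: emeasure_eq_measure ennreal_mult'' measure_nonneg)
    also have "\<dots> \<le> ennreal (e / 3)" using elim by (intro ennreal_leI) simp
    finally have "ennreal (e / 3) + ennreal (\<epsilon> n / d\<^sup>2) * emeasure \<beta> B + ennreal (e / 3)
        \<le> ennreal (e / 3) + ennreal (e / 3) + ennreal (e / 3)"
      by (intro add_mono order_refl)
    also have "\<dots> = ennreal e" using \<open>0 < e\<close> by (simp flip: ennreal_plus)
    finally show ?case using bound[of n] by (rule order_trans[rotated])
  qed
qed

lemma p_meas_pair:
  assumes "sets \<mu> = sets \<beta>"
  shows "(\<lambda>(x, y). p n x y) \<in> borel_measurable (\<beta> \<Otimes>\<^sub>M \<mu>)"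
proof -
  have "sets (\<beta> \<Otimes>\<^sub>M \<mu>) = sets (\<beta> \<Otimes>\<^sub>M \<beta>)" using assms by (intro sets_pair_measure_cong) auto
  from measurable_cong_sets[OF this refl] show ?thesis using p_measurable by blast
qed

text \<open>By regularity it suffices to consider compact \<open>Q\<close>. There Fatou's lemma and an exchange of
  integrals bound the left hand side by the lower limit of \<open>\<integral> T\<^sub>n d\<mu>\<close>, where
  \<open>T\<^sub>n y = \<integral>\<^sub>Q p\<^sub>n(x, y) d\<beta>(x)\<close> is at most \<open>1\<close> and tends to \<open>0\<close> off \<open>Q\<close>.\<close>

lemma limit_density_le:
  assumes "compact B" "finite_measure \<mu>" and sets_\<mu>: "sets \<mu> = sets \<beta>"
    and v [measurable]: "v \<in> borel_measurable \<beta>"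
    and lim: "AE x in \<beta>. (\<lambda>n. \<integral>\<^sup>+y. p n x y \<partial>\<mu>) \<longlonglongrightarrow> v x"
    and E: "E \<in> sets \<beta>"
  shows "(\<integral>\<^sup>+x. v x * indicator E x \<partial>\<beta>) \<le> emeasure \<mu> E"
proof -
  interpret \<mu>: finite_measure \<mu> by fact
  interpret \<beta>\<mu>: pair_sigma_finite \<beta> \<mu>
    by (simp add: pair_sigma_finite_def sigma_finite_measure_axioms \<mu>.sigma_finite_measure_axioms)
  have space_\<mu>: "space \<mu> = B" using sets_eq_imp_space_eq[OF sets_\<mu>] by (simp add: space_\<beta>)
  note [measurable] = p_meas_pair[OF sets_\<mu>]
  have u_meas [measurable]: "(\<lambda>x. \<integral>\<^sup>+y. p n x y \<partial>\<mu>) \<in> borel_measurable \<beta>" for n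
    by measurable
  have compact_case: "(\<integral>\<^sup>+x. v x * indicator Q x \<partial>\<beta>) \<le> emeasure \<mu> Q"
    if Q: "compact Q" "Q \<in> sets \<beta>" for Q
  proof -
    have Q_sets [measurable]: "Q \<in> sets \<beta>" "Q \<in> sets \<mu>" using Q sets_\<mu> by auto
    have QB: "Q \<subseteq> B" using Q by (simp add: sets_iff)
    define S where "S n y = (\<integral>\<^sup>+x. p n x y * indicator Q x \<partial>\<beta>) * indicator (B - Q) y" for n y
    have BQ [measurable]: "B - Q \<in> sets \<mu>" using Q_sets(2) sets.compl_sets[of Q \<mu>] by (simp add: space_\<mu>)
    have T_meas [measurable]: "(\<lambda>y. \<integral>\<^sup>+x. p n x y * indicator Q x \<partial>\<beta>) \<in> borel_measurable \<mu>" for n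
    proof -
      have "(\<lambda>(y, x). p n x y) \<in> borel_measurable (\<mu> \<Otimes>\<^sub>M \<beta>)"
        using measurable_compose[OF measurable_pair_swap' p_meas_pair[OF sets_\<mu>, of n]]
        by (simp add: split_beta')
      then show ?thesis by measurable
    qed
    have S_meas [measurable]: "S n \<in> borel_measurable \<mu>" for n unfolding S_def by measurable
    have "(\<lambda>n. \<integral>\<^sup>+y. S n y \<partial>\<mu>) \<longlonglongrightarrow> (\<integral>\<^sup>+y. 0 \<partial>\<mu>)"
    proof (rule nn_integral_dominated_convergence[where w = "\<lambda>_. 1"])
      show "AE y in \<mu>. S n y \<le> 1" for n
      proof (rule AE_I2)
        fix y assume "y \<in> space \<mu>"
        then show "S n y \<le> 1" using mass_le_1[OF Q(2), of y n]
          by (auto simp: S_def space_\<mu> split: split_indicator)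
      qed
      show "AE y in \<mu>. (\<lambda>n. S n y) \<longlonglongrightarrow> 0"
      proof (rule AE_I2)
        fix y assume "y \<in> space \<mu>"
        then have y: "y \<in> B" by (simp add: space_\<mu>)
        show "(\<lambda>n. S n y) \<longlonglongrightarrow> 0"
        proof (cases "y \<in> Q")
          case True then show ?thesis by (simp add: S_def)
        next
          case False
          obtain d where d: "0 < d" "\<And>x. x \<in> Q \<Longrightarrow> d \<le> dist y x"
            using separate_point_closed[of Q y] False Q(1) compact_imp_closed by metis
          have "(\<lambda>n. ennreal (\<epsilon> n / d\<^sup>2)) \<longlonglongrightarrow> ennreal (0 / d\<^sup>2)"
            using d(1) by (intro tendsto_ennrealI tendsto_divide \<epsilon> tendsto_const) auto
          then have "(\<lambda>n. ennreal (\<epsilon> n / d\<^sup>2)) \<longlonglongrightarrow> 0" by simp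
          moreover have "S n y \<le> ennreal (\<epsilon> n / d\<^sup>2)" for n
            using mass_far[OF Q(2) y d(1), of n] d(2) by (auto simp: S_def dist_commute split: split_indicator)
          ultimately show ?thesis
            using tendsto_sandwich[OF _ _ tendsto_const, of 0 "\<lambda>n. S n y" sequentially
                "\<lambda>n. ennreal (\<epsilon> n / d\<^sup>2)"] by simp
        qed
      qed
    qed (auto simp: space_\<mu> \<mu>.emeasure_eq_measure)
    then have S0: "(\<lambda>n. \<integral>\<^sup>+y. S n y \<partial>\<mu>) \<longlonglongrightarrow> 0" by simp
    have upper: "(\<integral>\<^sup>+x. (\<integral>\<^sup>+y. p n x y \<partial>\<mu>) * indicator Q x \<partial>\<beta>) \<le> emeasure \<mu> Q + (\<integral>\<^sup>+y. S n y \<partial>\<mu>)" for n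
    proof -
      have "(\<integral>\<^sup>+x. (\<integral>\<^sup>+y. p n x y \<partial>\<mu>) * indicator Q x \<partial>\<beta>)
          = (\<integral>\<^sup>+x. (\<integral>\<^sup>+y. p n x y * indicator Q x \<partial>\<mu>) \<partial>\<beta>)"
      proof (rule nn_integral_cong)
        fix x assume "x \<in> space \<beta>"
        then have "(\<lambda>y. p n x y) \<in> borel_measurable \<mu>"
          using p_meas2 measurable_cong_sets[OF sets_\<mu> refl] by (auto simp: space_\<beta>)
        then show "(\<integral>\<^sup>+y. p n x y \<partial>\<mu>) * indicator Q x = (\<integral>\<^sup>+y. p n x y * indicator Q x \<partial>\<mu>)"
          by (simp add: nn_integral_multc)
      qed
      also have "\<dots> = (\<integral>\<^sup>+y. (\<integral>\<^sup>+x. p n x y * indicator Q x \<partial>\<beta>) \<partial>\<mu>)"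
        by (rule \<beta>\<mu>.Fubini'[symmetric]) measurable
      also have "\<dots> \<le> (\<integral>\<^sup>+y. indicator Q y + S n y \<partial>\<mu>)"
      proof (rule nn_integral_mono)
        fix y assume "y \<in> space \<mu>"
        then show "(\<integral>\<^sup>+x. p n x y * indicator Q x \<partial>\<beta>) \<le> indicator Q y + S n y"
          using mass_le_1[OF Q(2), of y n] by (auto simp: S_def space_\<mu> split: split_indicator)
      qed
      also have "\<dots> = emeasure \<mu> Q + (\<integral>\<^sup>+y. S n y \<partial>\<mu>)"
        by (simp add: nn_integral_add)
      finally show ?thesis .
    qed
    have "(\<integral>\<^sup>+x. v x * indicator Q x \<partial>\<beta>)
        = (\<integral>\<^sup>+x. liminf (\<lambda>n. (\<integral>\<^sup>+y. p n x y \<partial>\<mu>) * indicator Q x) \<partial>\<beta>)"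
    proof (rule nn_integral_cong_AE, use lim in eventually_elim)
      case (elim x)
      then show ?case
        by (cases "x \<in> Q") (simp_all add: lim_imp_Liminf Liminf_const)
    qed
    also have "\<dots> \<le> liminf (\<lambda>n. \<integral>\<^sup>+x. (\<integral>\<^sup>+y. p n x y \<partial>\<mu>) * indicator Q x \<partial>\<beta>)"
      by (rule nn_integral_liminf) measurable
    also have "\<dots> \<le> liminf (\<lambda>n. emeasure \<mu> Q + (\<integral>\<^sup>+y. S n y \<partial>\<mu>))"
      by (intro Liminf_mono always_eventually allI upper)
    also have "(\<lambda>n. emeasure \<mu> Q + (\<integral>\<^sup>+y. S n y \<partial>\<mu>)) \<longlonglongrightarrow> emeasure \<mu> Q + 0"
      by (intro tendsto_intros S0)
    then have "liminf (\<lambda>n. emeasure \<mu> Q + (\<integral>\<^sup>+y. S n y \<partial>\<mu>)) = emeasure \<mu> Q"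
      by (simp add: lim_imp_Liminf)
    finally show ?thesis .
  qed
  have dens: "emeasure (density \<beta> v) A = (\<integral>\<^sup>+x. v x * indicator A x \<partial>\<beta>)" if "A \<in> sets \<beta>" for A
    using that by (rule emeasure_density[OF v])
  have "B \<in> sets \<beta>" using sets.top[of \<beta>] by (simp add: space_\<beta>)
  then have "emeasure (density \<beta> v) (space (density \<beta> v)) \<le> emeasure \<mu> B"
    using compact_case[OF \<open>compact B\<close>] by (simp add: dens space_\<beta>)
  then have "finite_measure (density \<beta> v)"
    by (intro finite_measureI) (auto simp: \<mu>.emeasure_eq_measure top_unique)
  note regular = inner_regular_restrict_space[OF this, unfolded sets_density, OF sets_\<beta> B E]
  show ?thesis
  proof (rule ennreal_le_epsilon)
    fix e :: real assume "0 < e"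
    then obtain Q where Q: "compact Q" "Q \<subseteq> E" "Q \<in> sets \<beta>" "emeasure (density \<beta> v) (E - Q) \<le> ennreal e"
      using regular by metis
    have "emeasure (density \<beta> v) E = emeasure (density \<beta> v) (Q \<union> (E - Q))"
      using Q(2) by (simp add: Un_absorb1)
    also have "\<dots> = emeasure (density \<beta> v) Q + emeasure (density \<beta> v) (E - Q)"
      using Q(3) E by (intro plus_emeasure[symmetric]) auto
    also have "\<dots> \<le> emeasure \<mu> E + ennreal e"
      using order_trans[OF compact_case[OF Q(1,3)] emeasure_mono[OF Q(2)]] Q(3,4) E sets_\<mu>
      by (intro add_mono) (simp_all add: dens)
    finally show "(\<integral>\<^sup>+x. v x * indicator E x \<partial>\<beta>) \<le> emeasure \<mu> E + ennreal e" by (simp add: dens E)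
  qed
qed

text \<open>Suppose \<open>v \<le> c < c' \<le> w\<close> on \<open>E\<close>. Since \<open>\<mu> \<ge> c' \<beta>\<close> on \<open>E\<close>, the truncations \<open>min u\<^sub>n c'\<close> integrate over
  \<open>E\<close> to at least \<open>c' \<beta>(E)\<close> minus \<open>c'\<close> times the mass that crosses from \<open>E\<close> to its complement, and
  this mass tends to zero; but in the limit they integrate to at most \<open>c \<beta>(E)\<close>. So \<open>E\<close> is null.\<close>

lemma density_le_limit:
  assumes "finite_measure \<mu>" and sets_\<mu>: "sets \<mu> = sets \<beta>"
    and v [measurable]: "v \<in> borel_measurable \<beta>"
    and lim: "AE x in \<beta>. (\<lambda>n. \<integral>\<^sup>+y. p n x y \<partial>\<mu>) \<longlonglongrightarrow> v x"
    and w [measurable]: "w \<in> borel_measurable \<beta>"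
    and w_le: "\<And>E. E \<in> sets \<beta> \<Longrightarrow> (\<integral>\<^sup>+x. w x * indicator E x \<partial>\<beta>) \<le> emeasure \<mu> E"
  shows "AE x in \<beta>. w x \<le> v x"
proof -
  interpret \<mu>: finite_measure \<mu> by fact
  note [measurable] = p_meas_pair[OF sets_\<mu>]
  define u where "u n x = (\<integral>\<^sup>+y. p n x y \<partial>\<mu>)" for n x
  have u_meas [measurable]: "u n \<in> borel_measurable \<beta>" for n
    unfolding u_def by measurable
  have null: "AE x in \<beta>. \<not> (v x \<le> c \<and> c' \<le> w x)" if c: "c < c'" "c' < \<infinity>" for c c' :: ennreal
  proof -
    define E where "E = {x \<in> space \<beta>. v x \<le> c \<and> c' \<le> w x}"
    have E [measurable]: "E \<in> sets \<beta>" unfolding E_def by measurable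
    have BE [measurable]: "B - E \<in> sets \<beta>" using E sets.compl_sets[of E \<beta>] by (simp add: space_\<beta>)
    define R where "R n x = (\<integral>\<^sup>+y. p n y x * indicator (B - E) y \<partial>\<beta>)" for n x
    have R_meas [measurable]: "R n \<in> borel_measurable \<beta>" for n
    proof -
      have "(\<lambda>(x, y). p n y x) \<in> borel_measurable (\<beta> \<Otimes>\<^sub>M \<beta>)"
        using measurable_compose[OF measurable_pair_swap' p_measurable[of n]] by (simp add: split_beta')
      then show ?thesis unfolding R_def by measurable
    qed
    have "density \<beta> (\<lambda>y. c' * indicator E y) \<le> \<mu>"
    proof (subst le_measure, simp add: sets_\<mu>, intro ballI)
      fix A assume "A \<in> sets (density \<beta> (\<lambda>y. c' * indicator E y))"
      then have A: "A \<in> sets \<beta>" by simp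
      have "emeasure (density \<beta> (\<lambda>y. c' * indicator E y)) A
          \<le> (\<integral>\<^sup>+x. w x * indicator A x \<partial>\<beta>)"
        using A by (subst emeasure_density)
          (auto simp: E_def intro!: nn_integral_mono split: split_indicator)
      also have "\<dots> \<le> emeasure \<mu> A" by (rule w_le[OF A])
      finally show "emeasure (density \<beta> (\<lambda>y. c' * indicator E y)) A \<le> emeasure \<mu> A" .
    qed
    then have u_lower: "(\<integral>\<^sup>+y. c' * indicator E y * p n x y \<partial>\<beta>) \<le> u n x" if "x \<in> B" for n x
      using nn_integral_mono_measure[of "density \<beta> (\<lambda>y. c' * indicator E y)" \<mu> "p n x"]
        nn_integral_density[of "\<lambda>y. c' * indicator E y" \<beta> "p n x"] p_meas2[OF that, of n]
      by (simp add: sets_\<mu> u_def)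
    have pointwise: "c' * indicator E x \<le> (min (u n x) c' + c' * R n x) * indicator E x" if x: "x \<in> B" for n x
    proof -
      note [measurable] = p_meas1[OF x, of n]
      let ?T = "\<integral>\<^sup>+y. p n y x * indicator E y \<partial>\<beta>"
      have "(\<integral>\<^sup>+y. c' * indicator E y * p n x y \<partial>\<beta>) = (\<integral>\<^sup>+y. c' * (p n y x * indicator E y) \<partial>\<beta>)"
        using x by (intro nn_integral_cong) (simp add: p_sym space_\<beta> mult_ac)
      also have "\<dots> = c' * ?T" by (rule nn_integral_cmult) measurable
      finally have "c' * ?T \<le> u n x" using u_lower[OF x, of n] by simp
      moreover have "c' * ?T \<le> c' * 1" by (intro mult_left_mono mass_le_1 E x) auto
      ultimately have T_le: "c' * ?T \<le> min (u n x) c'" by simp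
      have "?T + R n x = (\<integral>\<^sup>+y. p n y x \<partial>\<beta>)"
        unfolding R_def by (subst nn_integral_add[symmetric])
          (auto intro!: nn_integral_cong simp: space_\<beta> split: split_indicator)
      then have "c' = c' * ?T + c' * R n x"
        using p_mass[OF x, of n] by (simp flip: distrib_left)
      also have "\<dots> \<le> min (u n x) c' + c' * R n x" by (rule add_right_mono[OF T_le])
      finally show ?thesis by (auto split: split_indicator)
    qed
    have lower: "c' * emeasure \<beta> E \<le> (\<integral>\<^sup>+x. min (u n x) c' * indicator E x \<partial>\<beta>)
        + c' * (\<integral>\<^sup>+x. R n x * indicator E x \<partial>\<beta>)" for n
    proof -
      have "c' * emeasure \<beta> E = (\<integral>\<^sup>+x. c' * indicator E x \<partial>\<beta>)"
        by (simp add: nn_integral_cmult)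
      also have "\<dots> \<le> (\<integral>\<^sup>+x. min (u n x) c' * indicator E x + c' * (R n x * indicator E x) \<partial>\<beta>)"
      proof (rule nn_integral_mono)
        fix x assume "x \<in> space \<beta>"
        then show "c' * indicator E x \<le> min (u n x) c' * indicator E x + c' * (R n x * indicator E x)"
          using pointwise[of x n] by (simp only: space_\<beta> distrib_right mult.assoc)
      qed
      also have "\<dots> = (\<integral>\<^sup>+x. min (u n x) c' * indicator E x \<partial>\<beta>) + c' * (\<integral>\<^sup>+x. R n x * indicator E x \<partial>\<beta>)"
        by (subst nn_integral_add) (auto simp: nn_integral_cmult)
      finally show ?thesis .
    qed
    have lim1: "(\<lambda>n. \<integral>\<^sup>+x. min (u n x) c' * indicator E x \<partial>\<beta>)
        \<longlonglongrightarrow> (\<integral>\<^sup>+x. min (v x) c' * indicator E x \<partial>\<beta>)"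
    proof (rule nn_integral_dominated_convergence[where w = "\<lambda>_. c'"])
      show "(\<integral>\<^sup>+x. c' \<partial>\<beta>) < \<infinity>"
        using c(2) by (simp add: emeasure_eq_measure ennreal_mult_less_top)
      show "AE x in \<beta>. (\<lambda>n. min (u n x) c' * indicator E x) \<longlonglongrightarrow> min (v x) c' * indicator E x"
        using lim by eventually_elim (auto simp: u_def intro: tendsto_min split: split_indicator)
    qed (auto split: split_indicator)
    have lim2: "(\<lambda>n. c' * (\<integral>\<^sup>+x. R n x * indicator E x \<partial>\<beta>)) \<longlonglongrightarrow> c' * 0"
      unfolding R_def using c(2) by (intro ennreal_tendsto_cmult crossing_mass_tendsto_0 E) simp
    have "c' * emeasure \<beta> E \<le> (\<integral>\<^sup>+x. min (v x) c' * indicator E x \<partial>\<beta>) + c' * 0"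
      using lower by (intro LIMSEQ_le[OF tendsto_const tendsto_add[OF lim1 lim2]]) auto
    also have "\<dots> \<le> (\<integral>\<^sup>+x. c * indicator E x \<partial>\<beta>)"
      by (auto intro!: nn_integral_mono simp: E_def min_le_iff_disj split: split_indicator)
    also have "\<dots> = c * emeasure \<beta> E" by (simp add: nn_integral_cmult)
    finally have le: "c' * emeasure \<beta> E \<le> c * emeasure \<beta> E" .
    have "emeasure \<beta> E = 0"
    proof (rule ccontr)
      assume "emeasure \<beta> E \<noteq> 0"
      then have "c * emeasure \<beta> E < c' * emeasure \<beta> E"
        using c by (intro ennreal_mult_strict_right_mono) (auto simp: emeasure_eq_measure zero_less_iff_neq_zero)
      with le show False by simp
    qed
    then show ?thesis
      by (intro AE_I[of _ _ E]) (auto simp: E_def)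
  qed
  have "AE x in \<beta>. \<forall>r r' :: rat. ennreal (of_rat r) < ennreal (of_rat r') \<longrightarrow>
      \<not> (v x \<le> ennreal (of_rat r) \<and> ennreal (of_rat r') \<le> w x)"
    unfolding AE_all_countable
  proof (intro allI)
    fix r r' :: rat
    show "AE x in \<beta>. ennreal (of_rat r) < ennreal (of_rat r') \<longrightarrow>
      \<not> (v x \<le> ennreal (of_rat r) \<and> ennreal (of_rat r') \<le> w x)"
    proof (cases "ennreal (of_rat r) < ennreal (of_rat r')")
      case True
      then have "AE x in \<beta>. \<not> (v x \<le> ennreal (of_rat r) \<and> ennreal (of_rat r') \<le> w x)"
        by (rule null) simp
      then show ?thesis by eventually_elim simp
    qed simp
  qed
  then show ?thesis
  proof eventually_elim
    case (elim x)
    show ?case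
    proof (rule ccontr)
      assume "\<not> w x \<le> v x"
      then have "v x < w x" by simp
      from ennreal_rat_dense[OF this] obtain r :: rat
        where r: "v x < ennreal (of_rat r)" "ennreal (of_rat r) < w x" by blast
      from ennreal_rat_dense[OF r(2)] obtain r' :: rat
        where "ennreal (of_rat r) < ennreal (of_rat r')" "ennreal (of_rat r') < w x" by blast
      with elim r(1) show False by (metis less_imp_le)
    qed
  qed
qed

text \<open>The two inequalities applied to the density \<open>w\<close> of the absolutely continuous part.\<close>

theorem limit_is_ac_density:
  assumes "compact B" "finite_measure \<mu>" and sets_\<mu>: "sets \<mu> = sets \<beta>"
    and h [measurable]: "h \<in> borel_measurable \<beta>"
    and lim: "AE x in \<beta>. 0 \<le> h x \<and> (\<lambda>n. \<integral>\<^sup>+y. p n x y \<partial>\<mu>) \<longlonglongrightarrow> ennreal (h x)"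
  shows "has_ac_density \<beta> \<mu> h"
proof -
  let ?v = "\<lambda>x. ennreal (h x)"
  have lim': "AE x in \<beta>. (\<lambda>n. \<integral>\<^sup>+y. p n x y \<partial>\<mu>) \<longlonglongrightarrow> ?v x"
    using lim by eventually_elim simp
  have v: "?v \<in> borel_measurable \<beta>" by measurable
  obtain w \<mu>s where w [measurable]: "w \<in> borel_measurable \<beta>"
    and dec: "lebesgue_decomposition \<beta> \<mu> (density \<beta> w) \<mu>s"
    using lebesgue_decomposition_exists[OF finite_\<beta> assms(2) sets_\<mu>] by blast
  have sum: "emeasure \<mu> E = (\<integral>\<^sup>+x. w x * indicator E x \<partial>\<beta>) + emeasure \<mu>s E" if "E \<in> sets \<beta>" for E
    using dec that sets_\<mu> by (simp add: lebesgue_decomposition_def emeasure_density)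
  obtain A where A: "A \<in> sets \<beta>" "emeasure \<beta> A = 0" "emeasure \<mu>s (space \<mu>s - A) = 0"
    and sets_\<mu>s: "sets \<mu>s = sets \<beta>"
    using dec by (auto simp: lebesgue_decomposition_def mutually_singular_def)
  have "AE x in \<beta>. w x \<le> ?v x"
    by (rule density_le_limit[OF assms(2) sets_\<mu> v lim' w]) (simp add: sum)
  then have w_le_v: "(\<integral>\<^sup>+x. w x * indicator E x \<partial>\<beta>) \<le> (\<integral>\<^sup>+x. ?v x * indicator E x \<partial>\<beta>)" for E
    by (intro nn_integral_mono_AE) (auto elim!: eventually_mono split: split_indicator)
  have v_le_w: "(\<integral>\<^sup>+x. ?v x * indicator E x \<partial>\<beta>) \<le> (\<integral>\<^sup>+x. w x * indicator E x \<partial>\<beta>)" if E: "E \<in> sets \<beta>" for E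
  proof -
    have off_A: "AE x in \<beta>. x \<notin> A" using A by (intro AE_not_in) (auto simp: null_sets_def)
    have EA: "E - A \<in> sets \<beta>" using E A by auto
    have "emeasure \<mu>s (E - A) \<le> emeasure \<mu>s (space \<mu>s - A)"
      using E A sets_\<mu>s sets.sets_into_space[OF E] sets_eq_imp_space_eq[OF sets_\<mu>s]
      by (intro emeasure_mono) auto
    then have s0: "emeasure \<mu>s (E - A) = 0" using A(3) by simp
    have "(\<integral>\<^sup>+x. ?v x * indicator E x \<partial>\<beta>) = (\<integral>\<^sup>+x. ?v x * indicator (E - A) x \<partial>\<beta>)"
      using off_A by (intro nn_integral_cong_AE) (auto elim!: eventually_mono split: split_indicator)
    also have "\<dots> \<le> emeasure \<mu> (E - A)"
      by (rule limit_density_le[OF assms(1,2) sets_\<mu> v lim' EA])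
    also have "\<dots> = (\<integral>\<^sup>+x. w x * indicator (E - A) x \<partial>\<beta>)" by (simp add: sum[OF EA] s0)
    also have "\<dots> \<le> (\<integral>\<^sup>+x. w x * indicator E x \<partial>\<beta>)"
      by (intro nn_integral_mono) (auto split: split_indicator)
    finally show ?thesis .
  qed
  have "density \<beta> w = density \<beta> ?v"
  proof (rule measure_eqI)
    fix E assume "E \<in> sets (density \<beta> w)"
    then have "E \<in> sets \<beta>" by simp
    then show "emeasure (density \<beta> w) E = emeasure (density \<beta> ?v) E"
      using w_le_v[of E] v_le_w[of E] by (simp add: emeasure_density)
  qed simp
  with dec h lim show ?thesis unfolding has_ac_density_def by (auto elim: eventually_mono)
qed

end

section \<open>The Poisson--Szego kernel as an approximate identity\<close>

lemma poisson_szego_nonneg: "0 \<le> Re (C z z) \<Longrightarrow> 0 \<le> poisson_szego C z \<zeta>"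
  by (simp add: poisson_szego_def)

context szego
begin

lemma continuous_on_poisson:
  assumes "w \<in> D"
  shows "continuous_on (closure D) (poisson_szego C w)"
  unfolding poisson_szego_def divide_inverse using assms
  by (intro continuous_intros continuous_on_kernel) auto

lemma continuous_integrable:
  fixes f :: "complex ^ 'n \<Rightarrow> 'b :: {banach, second_countable_topology}"
  assumes "finite_measure \<mu>" "sets \<mu> = sets \<beta>" "continuous_on B f"
  shows "integrable \<mu> f"
proof -
  interpret \<mu>: finite_measure \<mu> by fact
  have space: "space \<mu> = B" using sets_eq_imp_space_eq[OF assms(2)] by (simp add: space_\<beta>)
  have "bounded (f ` B)" by (intro compact_imp_bounded compact_continuous_image assms compact_B)
  then obtain M where M: "\<And>\<zeta>. \<zeta> \<in> B \<Longrightarrow> norm (f \<zeta>) \<le> M" by (auto simp: bounded_iff)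
  have "f \<in> borel_measurable \<mu>"
    using sets_\<beta> assms(2) borel_measurable_continuous_on_restrict[OF assms(3)]
    by (simp cong: measurable_cong_sets)
  then show ?thesis using M by (intro \<mu>.integrable_const_bound[of _ M] AE_I2) (auto simp: space)
qed

lemma nn_integral_poisson:
  assumes "finite_measure \<mu>" "sets \<mu> = sets \<beta>" "w \<in> D"
  shows "(\<integral>\<^sup>+\<zeta>. ennreal (poisson_szego C w \<zeta>) \<partial>\<mu>) = ennreal (poisson_integral C \<mu> w)"
  unfolding poisson_integral_def using assms B_closure
  by (intro nn_integral_eq_integral continuous_integrable continuous_on_subset[OF continuous_on_poisson] AE_I2
      poisson_szego_nonneg kernel_diagonal) auto

lemma poisson_mass:
  assumes w: "w \<in> D" "Re (C w w) \<noteq> 0"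
  shows "poisson_integral C \<beta> w = 1"
  using kernel_diagonal(1)[OF w(1)] w(2) by (simp add: poisson_integral_def poisson_szego_def)

text \<open>The kernel is a representing measure for the holomorphic linear function \<open>z \<mapsto> \<langle>z, \<eta>\<rangle>\<close>, whose real
  part is the real inner product.\<close>

lemma poisson_inner:
  fixes \<eta> :: "complex ^ 'n"
  assumes w: "w \<in> D" "Re (C w w) \<noteq> 0"
  shows "(\<integral>\<zeta>. (\<zeta> \<bullet> \<eta>) * poisson_szego C w \<zeta> \<partial>\<beta>) = w \<bullet> \<eta>"
proof -
  define f :: "complex ^ 'n \<Rightarrow> complex" where "f z = (\<Sum>i\<in>UNIV. z $ i * cnj (\<eta> $ i))" for z
  have f_lin: "bounded_linear f"
    unfolding f_def by (intro linear_conv_bounded_linear[THEN iffD1] linearI)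
      (simp_all add: algebra_simps sum.distrib scaleR_sum_right)
  have Re_f: "Re (f z) = z \<bullet> \<eta>" for z
    by (simp add: f_def inner_vec_def inner_complex_def)
  have f_hol: "f mv_holomorphic_on D"
    by (rule mv_holomorphic_linear[OF f_lin]) (simp add: f_def sum_distrib_left mult_ac)
  have f_cont: "continuous_on S f" for S using f_lin by (rule linear_continuous_on)
  let ?g = "\<lambda>\<zeta>. f \<zeta> * of_real ((cmod (C w \<zeta>))\<^sup>2)"
  obtain c where c: "C w w = of_real c" using kernel_diagonal(2)[OF w(1)] by blast
  have "continuous_on (closure D) ?g"
    using w(1) by (intro continuous_intros f_cont continuous_on_kernel) auto
  then have int: "integrable \<beta> ?g"
    by (rule continuous_integrable[OF finite_\<beta> refl continuous_on_subset[OF _ B_closure]])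
  have "(\<integral>\<zeta>. (\<zeta> \<bullet> \<eta>) * (cmod (C w \<zeta>))\<^sup>2 \<partial>\<beta>) = (\<integral>\<zeta>. Re (?g \<zeta>) \<partial>\<beta>)"
    by (simp add: Re_f del: of_real_power)
  also have "\<dots> = Re (\<integral>\<zeta>. ?g \<zeta> \<partial>\<beta>)" by (rule integral_Re[OF int])
  also have "\<dots> = Re (f w * C w w)" by (simp only: kernel_represents[OF f_hol f_cont w(1)])
  also have "\<dots> = (w \<bullet> \<eta>) * Re (C w w)"
    by (simp add: c Re_f)
  finally have "(\<integral>\<zeta>. (\<zeta> \<bullet> \<eta>) * (cmod (C w \<zeta>))\<^sup>2 \<partial>\<beta>) / Re (C w w) = w \<bullet> \<eta>" using w(2) by simp
  then show ?thesis unfolding poisson_szego_def times_divide_eq_right integral_divide_zero .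
qed

text \<open>Symmetry needs \<open>C(\<rho>\<zeta>, \<rho>\<zeta>)\<close> to be constant along \<open>B\<close>. On the unit sphere
  \<open>|x - y|\<^sup>2 = 2 - 2 \<langle>x, y\<rangle>\<close>, whose integral against the representing measure of \<open>\<rho>y\<close> is \<open>2 - 2 \<rho>\<close>.\<close>

lemma poisson_approximate_identity:
  assumes diag: "\<And>\<rho> \<zeta> \<eta>. 0 \<le> \<rho> \<Longrightarrow> \<rho> < 1 \<Longrightarrow> \<zeta> \<in> B \<Longrightarrow> \<eta> \<in> B \<Longrightarrow> C (\<rho> *\<^sub>R \<zeta>) (\<rho> *\<^sub>R \<zeta>) = C (\<rho> *\<^sub>R \<eta>) (\<rho> *\<^sub>R \<eta>)"
    and nz: "\<And>w. w \<in> D \<Longrightarrow> Re (C w w) \<noteq> 0" and sphere: "B \<subseteq> sphere 0 1"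
  shows "symmetric_approximate_identity B \<beta> (\<lambda>n x y. ennreal (poisson_szego C (radius n *\<^sub>R x) y)) (\<lambda>n. 2 - 2 * radius n)"
proof (rule symmetric_approximate_identity.intro)
  have inD: "radius n *\<^sub>R \<zeta> \<in> D" if "\<zeta> \<in> B" for n \<zeta>
    using that B_closure radius by (intro scaleR_in_D) auto
  have sym: "poisson_szego C (radius n *\<^sub>R x) y = poisson_szego C (radius n *\<^sub>R y) x" if "x \<in> B" "y \<in> B" for n x y
  proof -
    have "C (radius n *\<^sub>R x) y = cnj (C (radius n *\<^sub>R y) x)"
      using that B_closure by (intro kernel_boundary_symmetric radius) auto
    then show ?thesis
      using diag[OF radius(2,3) that, of n] by (simp add: poisson_szego_def)
  qed
  show "B \<in> sets borel" by (rule B_borel)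
  show "sets \<beta> = sets (restrict_space borel B)" by (rule sets_\<beta>)
  show "finite_measure \<beta>" by (rule finite_\<beta>)
  show "(\<lambda>n. 2 - 2 * radius n) \<longlonglongrightarrow> 0"
    using tendsto_diff[OF tendsto_const tendsto_mult[OF tendsto_const radius_tendsto], of 2 2] by simp
  show "ennreal (poisson_szego C (radius n *\<^sub>R x) y) = ennreal (poisson_szego C (radius n *\<^sub>R y) x)"
    if "x \<in> B" "y \<in> B" for n x y using sym[OF that] by simp
  show "(\<integral>\<^sup>+x. ennreal (poisson_szego C (radius n *\<^sub>R x) y) \<partial>\<beta>) = 1" if y: "y \<in> B" for n y
  proof -
    have "(\<integral>\<^sup>+x. ennreal (poisson_szego C (radius n *\<^sub>R x) y) \<partial>\<beta>)
        = (\<integral>\<^sup>+x. ennreal (poisson_szego C (radius n *\<^sub>R y) x) \<partial>\<beta>)"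
      by (intro nn_integral_cong) (simp add: space_\<beta> sym y)
    then show ?thesis
      using nn_integral_poisson[OF finite_\<beta> refl inD[OF y]] poisson_mass[OF inD[OF y] nz[OF inD[OF y]]] by simp
  qed
  show "(\<integral>\<^sup>+x. ennreal (poisson_szego C (radius n *\<^sub>R x) y) * ennreal ((dist x y)\<^sup>2) \<partial>\<beta>) \<le> ennreal (2 - 2 * radius n)"
    if y: "y \<in> B" for n y
  proof -
    let ?w = "radius n *\<^sub>R y"
    note w = inD[OF y, of n]
    have norm1: "x \<bullet> x = 1" if "x \<in> B" for x using that sphere by (auto simp: dot_square_norm)
    have dist2: "(dist x y)\<^sup>2 = 2 - 2 * (x \<bullet> y)" if "x \<in> B" for x
      using norm1[OF that] norm1[OF y]
      by (simp add: dist_norm power2_norm_eq_inner inner_diff_left inner_diff_right inner_commute)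
    have P_nonneg: "0 \<le> poisson_szego C ?w x" for x by (intro poisson_szego_nonneg kernel_diagonal w)
    have P_cont: "continuous_on B (poisson_szego C ?w)"
      by (rule continuous_on_subset[OF continuous_on_poisson[OF w] B_closure])
    have int: "integrable \<beta> (\<lambda>x. poisson_szego C ?w x * (dist x y)\<^sup>2)" "integrable \<beta> (poisson_szego C ?w)"
      "integrable \<beta> (\<lambda>x. (x \<bullet> y) * poisson_szego C ?w x)"
      by (intro continuous_integrable finite_\<beta> refl continuous_intros P_cont)+
    have "(\<integral>\<^sup>+x. ennreal (poisson_szego C (radius n *\<^sub>R x) y) * ennreal ((dist x y)\<^sup>2) \<partial>\<beta>)
        = (\<integral>\<^sup>+x. ennreal (poisson_szego C ?w x * (dist x y)\<^sup>2) \<partial>\<beta>)"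
      by (intro nn_integral_cong) (simp add: space_\<beta> sym y ennreal_mult'')
    also have "\<dots> = ennreal (\<integral>x. poisson_szego C ?w x * (dist x y)\<^sup>2 \<partial>\<beta>)"
      using P_nonneg by (intro nn_integral_eq_integral int) simp
    also have "(\<integral>x. poisson_szego C ?w x * (dist x y)\<^sup>2 \<partial>\<beta>)
        = (\<integral>x. 2 * poisson_szego C ?w x - 2 * ((x \<bullet> y) * poisson_szego C ?w x) \<partial>\<beta>)"
      by (intro Bochner_Integration.integral_cong refl) (simp add: space_\<beta> dist2 algebra_simps)
    also have "\<dots> = 2 * poisson_integral C \<beta> ?w - 2 * (\<integral>x. (x \<bullet> y) * poisson_szego C ?w x \<partial>\<beta>)"
      using int by (simp add: poisson_integral_def)
    also have "\<dots> = 2 - 2 * radius n"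
      unfolding poisson_mass[OF w nz[OF w]] poisson_inner[OF w nz[OF w]] using norm1[OF y] by simp
    finally show ?thesis by simp
  qed
  show "(\<lambda>(x, y). ennreal (poisson_szego C (radius n *\<^sub>R x) y)) \<in> borel_measurable (\<beta> \<Otimes>\<^sub>M \<beta>)" for n
  proof -
    let ?f = "\<lambda>z. poisson_szego C (radius n *\<^sub>R fst z) (snd z)"
    have f_cont: "continuous_on (B \<times> B) ?f"
      unfolding poisson_szego_def using inD nz B_closure subsetD[OF closure_subset inD]
      by (intro continuous_intros continuous_on_kernel) auto
    have "B \<times> B \<in> sets borel" using compact_Times[OF compact_B compact_B] by (rule borel_compact)
    then have "(\<lambda>z. indicator (B \<times> B) z *\<^sub>R ?f z) \<in> borel_measurable (borel \<Otimes>\<^sub>M borel)"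
      unfolding borel_prod by (intro borel_measurable_continuous_on_indicator f_cont)
    moreover have "(\<lambda>z. (fst z, snd z)) \<in> measurable (\<beta> \<Otimes>\<^sub>M \<beta>) (borel \<Otimes>\<^sub>M borel)"
      using continuous_imp_measurable[OF continuous_on_id]
      by (intro measurable_Pair measurable_compose[OF measurable_fst] measurable_compose[OF measurable_snd]) auto
    ultimately have "(\<lambda>z. indicator (B \<times> B) z *\<^sub>R ?f z) \<in> borel_measurable (\<beta> \<Otimes>\<^sub>M \<beta>)"
      using measurable_compose[of "\<lambda>z. (fst z, snd z)"] by simp
    then have "?f \<in> borel_measurable (\<beta> \<Otimes>\<^sub>M \<beta>)"
      by (rule measurable_cong[THEN iffD1, rotated]) (simp add: space_pair_measure space_\<beta> indicator_def)
    then show ?thesis by (simp add: split_beta')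
  qed
qed

theorem poisson_radial_limit_is_ac_density:
  assumes diag: "\<And>\<rho> \<zeta> \<eta>. 0 \<le> \<rho> \<Longrightarrow> \<rho> < 1 \<Longrightarrow> \<zeta> \<in> B \<Longrightarrow> \<eta> \<in> B \<Longrightarrow> C (\<rho> *\<^sub>R \<zeta>) (\<rho> *\<^sub>R \<zeta>) = C (\<rho> *\<^sub>R \<eta>) (\<rho> *\<^sub>R \<eta>)"
    and nz: "\<And>w. w \<in> D \<Longrightarrow> Re (C w w) \<noteq> 0" and sphere: "B \<subseteq> sphere 0 1"
    and \<mu>: "finite_measure \<mu>" "sets \<mu> = sets \<beta>"
    and h: "h \<in> borel_measurable \<beta>"
    and lim: "AE \<zeta> in \<beta>. ((\<lambda>\<rho>. poisson_integral C \<mu> (\<rho> *\<^sub>R \<zeta>)) \<longlongrightarrow> h \<zeta>) (at_left 1)"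
  shows "has_ac_density \<beta> \<mu> h"
proof -
  interpret P: symmetric_approximate_identity B \<beta>
    "\<lambda>n x y. ennreal (poisson_szego C (radius n *\<^sub>R x) y)" "\<lambda>n. 2 - 2 * radius n"
    by (rule poisson_approximate_identity[OF diag nz sphere])
  have "AE \<zeta> in \<beta>. \<zeta> \<in> B" by (rule AE_I2) (simp add: space_\<beta>)
  with lim have "AE \<zeta> in \<beta>. 0 \<le> h \<zeta> \<and>
      (\<lambda>n. \<integral>\<^sup>+y. ennreal (poisson_szego C (radius n *\<^sub>R \<zeta>) y) \<partial>\<mu>) \<longlonglongrightarrow> ennreal (h \<zeta>)"
  proof eventually_elim
    case (elim \<zeta>)
    have inD: "radius n *\<^sub>R \<zeta> \<in> D" for n using elim(2) B_closure radius by (intro scaleR_in_D) auto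
    have seq: "(\<lambda>n. poisson_integral C \<mu> (radius n *\<^sub>R \<zeta>)) \<longlonglongrightarrow> h \<zeta>"
      by (rule filterlim_compose[OF elim(1) radius_at_left])
    have "0 \<le> poisson_integral C \<mu> (radius n *\<^sub>R \<zeta>)" for n
      unfolding poisson_integral_def
      by (intro Bochner_Integration.integral_nonneg poisson_szego_nonneg kernel_diagonal inD)
    then have "0 \<le> h \<zeta>" by (intro LIMSEQ_le_const[OF seq]) auto
    then show ?case using tendsto_ennrealI[OF seq] by (simp add: nn_integral_poisson[OF \<mu> inD])
  qed
  then show ?thesis by (rule P.limit_is_ac_density[OF compact_B \<mu> h])
qed

end

lemma singular_iff_ac_density_zero:
  assumes sets: "sets \<mu> = sets \<beta>" and h: "has_ac_density \<beta> \<mu> h"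
  shows "mutually_singular \<mu> \<beta> \<longleftrightarrow> (AE x in \<beta>. h x = 0)"
proof -
  have h_meas [measurable]: "h \<in> borel_measurable \<beta>" and h0: "AE x in \<beta>. 0 \<le> h x"
    using h by (auto simp: has_ac_density_def)
  let ?a = "density \<beta> (\<lambda>x. ennreal (h x))"
  obtain \<mu>s where \<mu>s: "lebesgue_decomposition \<beta> \<mu> ?a \<mu>s" using h by (auto simp: has_ac_density_def)
  have sum: "emeasure \<mu> E = emeasure ?a E + emeasure \<mu>s E" if "E \<in> sets \<beta>" for E
    using \<mu>s that sets by (simp add: lebesgue_decomposition_def)
  have space: "space \<mu> = space \<beta>" "space \<mu>s = space \<beta>"
    using \<mu>s sets by (auto intro!: sets_eq_imp_space_eq simp: lebesgue_decomposition_def)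
  have a: "emeasure ?a E = (\<integral>\<^sup>+x. ennreal (h x) * indicator E x \<partial>\<beta>)" if "E \<in> sets \<beta>" for E
    using that by (simp add: emeasure_density)
  show ?thesis
  proof
    assume "mutually_singular \<mu> \<beta>"
    then obtain A where A: "A \<in> sets \<beta>" "emeasure \<beta> A = 0" "emeasure \<mu> (space \<beta> - A) = 0"
      by (auto simp: mutually_singular_def space)
    have off: "AE x in \<beta>. x \<notin> A" using A by (intro AE_not_in) (auto simp: null_sets_def)
    have "(\<integral>\<^sup>+x. ennreal (h x) * indicator (space \<beta> - A) x \<partial>\<beta>) = 0"
      using sum[of "space \<beta> - A"] a[of "space \<beta> - A"] A by simp
    then have "AE x in \<beta>. ennreal (h x) * indicator (space \<beta> - A) x = 0"
      using A by (subst (asm) nn_integral_0_iff_AE) auto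
    with off h0 AE_space show "AE x in \<beta>. h x = 0"
      by eventually_elim (auto simp: indicator_def ennreal_eq_0_iff split: if_splits)
  next
    assume zero: "AE x in \<beta>. h x = 0"
    obtain A where A: "A \<in> sets \<beta>" "emeasure \<beta> A = 0" "emeasure \<mu>s (space \<beta> - A) = 0"
      using \<mu>s by (auto simp: lebesgue_decomposition_def mutually_singular_def space)
    have "(\<integral>\<^sup>+x. ennreal (h x) * indicator (space \<beta> - A) x \<partial>\<beta>) = (\<integral>\<^sup>+x. 0 \<partial>\<beta>)"
      using zero by (intro nn_integral_cong_AE) (auto elim!: eventually_mono)
    then have "emeasure \<mu> (space \<beta> - A) = 0"
      using sum[of "space \<beta> - A"] a[of "space \<beta> - A"] A by simp
    then show "mutually_singular \<mu> \<beta>" using A sets by (auto simp: mutually_singular_def space)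
  qed
qed

section \<open>Clark measures\<close>

lemma matrix_vector_smult: "A *v (c *s x) = c *s (A *v x)" for A :: "complex ^ 'n ^ 'n"
  by (simp add: matrix_vector_mult_def vec_eq_iff sum_distrib_left mult_ac)

lemma bounded_linear_matrix_vector: "bounded_linear (\<lambda>x. A *v x)" for A :: "complex ^ 'n ^ 'n"
  by (intro linear_conv_bounded_linear[THEN iffD1] linearI)
     (simp_all add: matrix_vector_mult_def vec_eq_iff algebra_simps sum.distrib scaleR_sum_right)

lemma mat_vector_mult: "mat c *v x = c *s x" for x :: "complex ^ 'n"
  by (simp add: matrix_vector_mult_def mat_def vec_eq_iff if_distrib[of "\<lambda>a. a * _"] cong: if_cong)

theorem proposition4p6:
  fixes D B :: "(complex ^ 'n) set"
    and K :: "(complex ^ 'n ^ 'n) set"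
    and \<beta> :: "(complex ^ 'n) measure"
    and C :: "complex ^ 'n \<Rightarrow> complex ^ 'n \<Rightarrow> complex"
    and \<phi> :: "complex ^ 'n \<Rightarrow> complex"
    and \<mu> :: "complex \<Rightarrow> (complex ^ 'n) measure"
  assumes D: "bounded_symmetric_domain D" "convex D" "circular D"
    and B: "is_silov_boundary D B" "B \<subseteq> sphere 0 1"
    and K: "K = linear_automorphisms D" "K \<subseteq> unitary_matrices"
    and K_transitive: "\<forall>\<zeta>\<in>B. (\<lambda>A. A *v \<zeta>) ` K = B"
    and \<beta>: "invariant_probability_on K B \<beta>"
    and C: "is_szego_kernel D \<beta> C"
    and \<phi>: "\<phi> mv_holomorphic_on D" "\<phi> ` D \<subseteq> ball 0 1"
    and \<mu>: "\<forall>\<alpha>\<in>sphere 0 1. is_clark_measure D B C \<phi> \<alpha> (\<mu> \<alpha>)"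
  shows "(\<forall>\<alpha>\<in>sphere 0 1.
        (AE \<zeta> in \<beta>. has_radial_limit \<phi> \<zeta> (radial_limit \<phi> \<zeta>) \<and> radial_limit \<phi> \<zeta> \<noteq> \<alpha> \<and>
           Re ((\<alpha> + radial_limit \<phi> \<zeta>) / (\<alpha> - radial_limit \<phi> \<zeta>)) =
             (1 - (cmod (radial_limit \<phi> \<zeta>))\<^sup>2) / (cmod (\<alpha> - radial_limit \<phi> \<zeta>))\<^sup>2) \<and>
        has_ac_density \<beta> (\<mu> \<alpha>)
          (\<lambda>\<zeta>. Re ((\<alpha> + radial_limit \<phi> \<zeta>) / (\<alpha> - radial_limit \<phi> \<zeta>)))) \<and>
    (inner_function D \<beta> \<phi> \<longleftrightarrow> (\<exists>\<alpha>\<in>sphere 0 1. mutually_singular (\<mu> \<alpha>) \<beta>)) \<and>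
    (inner_function D \<beta> \<phi> \<longleftrightarrow> (\<forall>\<alpha>\<in>sphere 0 1. mutually_singular (\<mu> \<alpha>) \<beta>))"
proof -
  have D': "open D" "D \<noteq> {}" "bounded D" using D(1) by (auto simp: bounded_symmetric_domain_def)
  have B': "closed B" "B \<subseteq> frontier D"
    using B(1) by (auto simp: is_silov_boundary_def norming_boundary_def)
  have B_closure: "B \<subseteq> closure D" using B'(2) by (auto simp: frontier_def)
  have compact_B: "compact B"
    using B'(1) bounded_subset[OF bounded_closure[OF D'(3)] B_closure] by (simp add: compact_eq_bounded_closed)
  have KD: "invertible A" "(*v) A ` D = D" if "A \<in> K" for A
    using that K(1) by (auto simp: linear_automorphisms_def)
  have KB: "A *v \<zeta> \<in> B" if "A \<in> K" "\<zeta> \<in> B" for A \<zeta> using K_transitive that by blast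
  have K\<beta>: "distr \<beta> \<beta> ((*v) A) = \<beta>" if "A \<in> K" for A
    using \<beta> that by (simp add: invariant_probability_on_def)
  \<comment> \<open>As \<open>D\<close> is circular, the scalar matrices of modulus one belong to \<open>K\<close>.\<close>
  have rotation: "mat c \<in> K" if c: "cmod c = 1" for c
  proof -
    have cc: "cnj c * c = 1" "c * cnj c = 1"
      using c by (simp_all flip: complex_norm_square add: mult.commute[of "cnj c"])
    have mm: "mat a ** mat b = (mat (a * b) :: complex ^ 'n ^ 'n)" for a b :: complex
      by (simp add: matrix_matrix_mult_def mat_def vec_eq_iff if_distrib[of "\<lambda>a. a * _"] cong: if_cong)
    have "invertible (mat c :: complex ^ 'n ^ 'n)"
      unfolding invertible_def by (rule exI[of _ "mat (cnj c)"]) (simp add: mm cc)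
    moreover have "(*v) (mat c) ` D = D"
    proof (intro equalityI subsetI)
      fix z assume "z \<in> (*v) (mat c) ` D"
      then show "z \<in> D" using D(3) c by (auto simp: mat_vector_mult circular_def)
    next
      fix z assume "z \<in> D"
      then have "cnj c *s z \<in> D" using D(3) c by (auto simp: circular_def)
      moreover have "z = mat c *v (cnj c *s z)" by (simp add: mat_vector_mult vector_smult_assoc cc)
      ultimately show "z \<in> (*v) (mat c) ` D" by blast
    qed
    ultimately show ?thesis by (simp add: K(1) linear_automorphisms_def)
  qed
  have "circular_domain_boundary D B \<beta>"
  proof (intro circular_domain_boundary.intro circular_domain.intro circular_domain_boundary_axioms.intro)
    show "c *s \<zeta> \<in> B" if "cmod c = 1" "\<zeta> \<in> B" for c \<zeta>
      using KB[OF rotation[OF that(1)] that(2)] by (simp add: mat_vector_mult)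
    show "distr \<beta> \<beta> (\<lambda>z. c *s z) = \<beta>" if "cmod c = 1" for c
      using K\<beta>[OF rotation[OF that]] by (simp add: mat_vector_mult[abs_def])
  qed (use D' D compact_B B_closure \<beta> in \<open>simp_all add: invariant_probability_on_def radon_measure_on_def\<close>)
  then interpret szego D B \<beta> C
    using D'(3) C by (simp add: szego_def szego_axioms_def)
  have diag: "C (\<rho> *\<^sub>R \<zeta>) (\<rho> *\<^sub>R \<zeta>) = C (\<rho> *\<^sub>R \<eta>) (\<rho> *\<^sub>R \<eta>)"
    if \<rho>: "0 \<le> \<rho>" "\<rho> < 1" and \<zeta>: "\<zeta> \<in> B" and \<eta>: "\<eta> \<in> B" for \<rho> \<zeta> \<eta>
  proof -
    obtain A where A: "A \<in> K" "A *v \<zeta> = \<eta>" using K_transitive \<zeta> \<eta> by (metis imageE)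
    obtain A' where A': "A ** A' = mat 1" "A' ** A = mat 1" using KD(1)[OF A(1)] by (auto simp: invertible_def)
    have A'_inv: "A' *v (A *v z) = z" for z by (simp add: matrix_vector_mul_assoc A')
    have "(*v) A' ` D = (*v) A' ` ((*v) A ` D)" using KD(2)[OF A(1)] by simp
    also have "\<dots> = D" by (simp add: image_image A'_inv)
    finally have "A' \<in> K" using A' by (auto simp: K(1) linear_automorphisms_def invertible_def)
    then have "C (A *v (\<rho> *\<^sub>R \<zeta>)) (A *v (\<rho> *\<^sub>R \<zeta>)) = C (\<rho> *\<^sub>R \<zeta>) (\<rho> *\<^sub>R \<zeta>)"
      using A(1) KD(2) KB K\<beta> \<rho> \<zeta> B_closure
      by (intro kernel_invariant[of "(*v) A" "(*v) A'"] bounded_linear_matrix_vector matrix_vector_smult A'_inv scaleR_in_D)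
         auto
    then show ?thesis by (simp add: scaleR_eq_smult matrix_vector_smult A(2))
  qed
  have \<phi>_less: "cmod (\<phi> z) < 1" if "z \<in> D" for z using \<phi>(2) that by auto
  have clark: "finite_measure (\<mu> \<alpha>)" "sets (\<mu> \<alpha>) = sets \<beta>"
      "z \<in> D \<Longrightarrow> poisson_integral C (\<mu> \<alpha>) z = Re ((\<alpha> + \<phi> z) / (\<alpha> - \<phi> z))" if "cmod \<alpha> = 1" for \<alpha> z
    using \<mu> that sets_\<beta> by (auto simp: is_clark_measure_def radon_measure_on_def)
  have nz: "Re (C w w) \<noteq> 0" if w: "w \<in> D" for w
  proof
    assume "Re (C w w) = 0"
    \<comment> \<open>Division by zero would make the Poisson integral of a Clark measure vanish at \<open>w\<close>.\<close>
    then have "poisson_integral C (\<mu> 1) w = 0" by (simp add: poisson_integral_def poisson_szego_def)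
    then have "(1 - (cmod (\<phi> w))\<^sup>2) / (cmod (1 - \<phi> w))\<^sup>2 = 0"
      using clark(3)[of 1 w] w Re_cayley[of 1 "\<phi> w"] by simp
    moreover have "(cmod (\<phi> w))\<^sup>2 < 1" using \<phi>_less[OF w] by (simp add: power_less_one_iff)
    ultimately show False using \<phi>_less[OF w] by auto
  qed
  have limit: "AE \<zeta> in \<beta>. has_radial_limit \<phi> \<zeta> (radial_limit \<phi> \<zeta>)"
    using \<phi>_less by (intro AE_has_radial_limit[OF \<phi>(1), of 1]) (simp add: less_imp_le)
  have [measurable]: "radial_limit \<phi> \<in> borel_measurable \<beta>" by (rule radial_limit_measurable[OF \<phi>(1)])
  have neq: "AE \<zeta> in \<beta>. radial_limit \<phi> \<zeta> \<noteq> \<alpha>" if "cmod \<alpha> = 1" for \<alpha>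
    by (rule AE_radial_limit_neq[OF \<phi> that])
  let ?h = "\<lambda>\<alpha> \<zeta>. Re ((\<alpha> + radial_limit \<phi> \<zeta>) / (\<alpha> - radial_limit \<phi> \<zeta>))"
  have density: "has_ac_density \<beta> (\<mu> \<alpha>) (?h \<alpha>)" if \<alpha>: "cmod \<alpha> = 1" for \<alpha>
  proof (rule poisson_radial_limit_is_ac_density[OF diag nz B(2) clark(1,2)[OF \<alpha>]])
    have "AE \<zeta> in \<beta>. \<zeta> \<in> B" by (rule AE_I2) (simp add: space_\<beta>)
    with limit neq[OF \<alpha>] show "AE \<zeta> in \<beta>. ((\<lambda>\<rho>. poisson_integral C (\<mu> \<alpha>) (\<rho> *\<^sub>R \<zeta>)) \<longlongrightarrow> ?h \<alpha> \<zeta>) (at_left 1)"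
    proof eventually_elim
      case (elim \<zeta>)
      have "((\<lambda>\<rho>. Re ((\<alpha> + \<phi> (\<rho> *\<^sub>R \<zeta>)) / (\<alpha> - \<phi> (\<rho> *\<^sub>R \<zeta>)))) \<longlongrightarrow> ?h \<alpha> \<zeta>) (at_left 1)"
        using elim by (intro tendsto_intros) (auto simp: has_radial_limit_def)
      moreover have "\<forall>\<^sub>F \<rho> in at_left 1. Re ((\<alpha> + \<phi> (\<rho> *\<^sub>R \<zeta>)) / (\<alpha> - \<phi> (\<rho> *\<^sub>R \<zeta>)))
          = poisson_integral C (\<mu> \<alpha>) (\<rho> *\<^sub>R \<zeta>)"
        using eventually_at_left_real[OF zero_less_one]
      proof eventually_elim
        case (elim \<rho>)
        then have "\<rho> *\<^sub>R \<zeta> \<in> D" using \<open>\<zeta> \<in> B\<close> B_closure by (intro scaleR_in_D) auto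
        then show ?case by (rule clark(3)[OF \<alpha>, symmetric])
      qed
      ultimately show ?case by (rule Lim_transform_eventually)
    qed
  qed measurable
  have inner_iff: "inner_function D \<beta> \<phi> \<longleftrightarrow> (AE \<zeta> in \<beta>. cmod (radial_limit \<phi> \<zeta>) = 1)"
  proof -
    have "bounded (\<phi> ` D)" using \<phi>(2) by (rule bounded_subset[OF bounded_ball])
    then show ?thesis using \<phi>(1) limit by (auto simp: inner_function_def)
  qed
  have singular_iff: "mutually_singular (\<mu> \<alpha>) \<beta> \<longleftrightarrow> inner_function D \<beta> \<phi>" if \<alpha>: "cmod \<alpha> = 1" for \<alpha>
  proof -
    have "AE \<zeta> in \<beta>. ?h \<alpha> \<zeta> = 0 \<longleftrightarrow> cmod (radial_limit \<phi> \<zeta>) = 1"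
      using neq[OF \<alpha>]
    proof eventually_elim
      case (elim \<zeta>)
      then show ?case
        using norm_ge_zero[of "radial_limit \<phi> \<zeta>"]
        by (auto simp: Re_cayley[OF \<alpha>] power2_eq_1_iff simp del: norm_ge_zero)
    qed
    then have "(AE \<zeta> in \<beta>. ?h \<alpha> \<zeta> = 0) \<longleftrightarrow> (AE \<zeta> in \<beta>. cmod (radial_limit \<phi> \<zeta>) = 1)"
      by (rule eventually_subst)
    then show ?thesis
      unfolding inner_iff singular_iff_ac_density_zero[OF clark(2)[OF \<alpha>] density[OF \<alpha>]] .
  qed
  have one: "1 \<in> sphere (0::complex) 1" by simp
  show ?thesis
  proof (intro conjI ballI)
    fix \<alpha> :: complex assume "\<alpha> \<in> sphere 0 1"
    then have \<alpha>: "cmod \<alpha> = 1" by simp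
    show "AE \<zeta> in \<beta>. has_radial_limit \<phi> \<zeta> (radial_limit \<phi> \<zeta>) \<and> radial_limit \<phi> \<zeta> \<noteq> \<alpha> \<and>
        ?h \<alpha> \<zeta> = (1 - (cmod (radial_limit \<phi> \<zeta>))\<^sup>2) / (cmod (\<alpha> - radial_limit \<phi> \<zeta>))\<^sup>2"
      using limit neq[OF \<alpha>] by eventually_elim (simp add: Re_cayley[OF \<alpha>])
    show "has_ac_density \<beta> (\<mu> \<alpha>) (?h \<alpha>)" by (rule density[OF \<alpha>])
  next
    have singular_iff': "mutually_singular (\<mu> \<alpha>) \<beta> \<longleftrightarrow> inner_function D \<beta> \<phi>" if "\<alpha> \<in> sphere 0 1" for \<alpha>
      using singular_iff that by simp
    show "inner_function D \<beta> \<phi> \<longleftrightarrow> (\<exists>\<alpha>\<in>sphere 0 1. mutually_singular (\<mu> \<alpha>) \<beta>)"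
      "inner_function D \<beta> \<phi> \<longleftrightarrow> (\<forall>\<alpha>\<in>sphere 0 1. mutually_singular (\<mu> \<alpha>) \<beta>)"
      using singular_iff' one by blast+
  qed
qed

end
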